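(* Let $1\le p,q\le\infty$ and $r\in\mathbb{R}$ with $\frac1p-1<r<\frac1p$ (with $1/\infty=0$). Then there is a constant $C>0$, independent of $n$, such that for every $n\in\mathbb{N}$ and every symmetrized Hammersley type point set $\widetilde{\mathcal{R}}_n$ in $[0,1]^2$, which has $N=2^{n+2}$ elements (counted with multiplicity), the local discrepancy satisfies $$\left\|D_{\widetilde{\mathcal{R}}_n}\,|\,S_{p,q}^rB([0,1)^2)\right\|\le C\,N^{r-1}(\log N)^{1/q}.$$
   Context: Local discrepancy: for a multiset $\mathcal{P}$ of $N\ge1$ points in $[0,1]^2$ and $\boldsymbol t=(t_1,t_2)\in[0,1]^2$, $D_{\mathcal{P}}(\boldsymbol t)=\frac1N\sum_{\boldsymbol z\in\mathcal{P}}\mathbf 1_{[\boldsymbol 0,\boldsymbol t)}(\boldsymbol z)-t_1t_2$, where $[\boldsymbol 0,\boldsymbol t)=[0,t_1)\times[0,t_2)$, $\mathbf 1$ denotes the indicator function, and the sum is taken with multiplicity. Hammersley type point sets: for $n\in\mathbb{N}$ fix for each $i\in\{1,\dots,n\}$ one of the two rules $s_i=t_i$ or $s_i=1-t_i$ (the choice may depend on $i$), and let $$\mathcal{R}_n=\left\{\left(\tfrac{t_n}{2}+\tfrac{t_{n-1}}{2^2}+\dots+\tfrac{t_1}{2^n},\ \tfrac{s_1}{2}+\tfrac{s_2}{2^2}+\dots+\tfrac{s_n}{2^n}\right): t_1,\dots,t_n\in\{0,1\}\right\},$$ which has $2^n$ elements. The symmetrized Hammersley type point set is the multiset union (keeping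 multiplicities, $2^{n+2}$ elements in total) $\widetilde{\mathcal{R}}_n=\mathcal{R}_n\cup\{(x,1-y):(x,y)\in\mathcal{R}_n\}\cup\{(1-x,y):(x,y)\in\mathcal{R}_n\}\cup\{(1-x,1-y):(x,y)\in\mathcal{R}_n\}$. Besov spaces of dominating mixed smoothness: let $\mathcal{S}(\mathbb{R}^2)$ be the Schwartz space, $\mathcal{S}'(\mathbb{R}^2)$ the tempered distributions, $\mathcal{F}$ the Fourier transform. Let $\phi_0\in\mathcal{S}(\mathbb{R})$ be fixed with $\phi_0(t)=1$ for $|t|\le1$ and $\phi_0(t)=0$ for $|t|>\frac32$; put $\phi_k(t)=\phi_0(2^{-k}t)-\phi_0(2^{-k+1}t)$ for $k\in\mathbb{N}$, and $\phi_{\boldsymbol k}(\boldsymbol t)=\phi_{k_1}(t_1)\phi_{k_2}(t_2)$ for $\boldsymbol k=(k_1,k_2)\in\mathbb{N}_0^2$. For $0<p,q\le\infty$, $r\in\mathbb{R}$, the space $S_{p,q}^rB(\mathbb{R}^2)$ consists of all $f\in\mathcal{S}'(\mathbb{R}^2)$ with finite quasi-norm $$\|f|S_{p,q}^rB(\mathbb{R}^2)\|=\Big(\sum_{\boldsymbol k\in\mathbb{N}_0^2}2^{r(k_1+k_2)q}\|\mathcal{F}^{-1}(\phi_{\boldsymbol k}\mathcal{F}f)|L_p(\mathbb{R}^2)\|^q\Big)^{1/q}$$ (usual modification if $q=\infty$). Let $\mathcal{D}'([0,1)^2)$ be the dual of the space $\mathcal{D}([0,1)^2)$ of complex-valued infinitely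 differentiable functions on $\mathbb{R}^2$ with compact support in the interior of $[0,1)^2$. The space $S_{p,q}^rB([0,1)^2)$ consists of all $f\in\mathcal{D}'([0,1)^2)$ with finite quasi-norm $$\|f|S_{p,q}^rB([0,1)^2)\|=\inf\{\|g|S_{p,q}^rB(\mathbb{R}^2)\|: g\in S_{p,q}^rB(\mathbb{R}^2),\ g|_{[0,1)^2}=f\}.$$ *)

theory Defs
  imports
    "HOL-Analysis.Analysis"
    "HOL-Probability.Essential_Supremum"
    "HOL-Library.Multiset"
    "HOL-Library.Nat_Bijection"
begin

section \<open>Smooth functions, Schwartz functions and tempered distributions\<close>

text \<open>Iterated partial derivatives in the directions of a list of vectors, in practice
  elements of \<^const>\<open>Basis\<close>.\<close>

primrec partials :: "'a::euclidean_space list \<Rightarrow> ('a \<Rightarrow> complex) \<Rightarrow> 'a \<Rightarrow> complex" where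
  "partials [] f = f"
| "partials (b # bs) f = (\<lambda>x. frechet_derivative (partials bs f) (at x) b)"

definition smooth :: "('a::euclidean_space \<Rightarrow> complex) \<Rightarrow> bool" where
  "smooth f \<longleftrightarrow> (\<forall>bs. set bs \<subseteq> Basis \<longrightarrow> (\<forall>x. partials bs f differentiable (at x)))"

definition schwartz :: "('a::euclidean_space \<Rightarrow> complex) set" where
  "schwartz = {f. smooth f \<and>
     (\<forall>m bs. set bs \<subseteq> Basis \<longrightarrow> (\<exists>B. \<forall>x. norm x ^ m * norm (partials bs f x) \<le> B))}"

definition schwartz_null :: "(nat \<Rightarrow> 'a::euclidean_space \<Rightarrow> complex) \<Rightarrow> bool" where
  "schwartz_null \<phi> \<longleftrightarrow> (\<forall>j. \<phi> j \<in> schwartz) \<and>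
     (\<forall>m bs. set bs \<subseteq> Basis \<longrightarrow>
        uniform_limit UNIV (\<lambda>j x. norm x ^ m * norm (partials bs (\<phi> j) x)) (\<lambda>_. 0) sequentially)"

text \<open>A distribution is a functional on functions of which only the values on the relevant space of
  test functions matter. As the Schwartz space is metrizable, sequential continuity is
  continuity.\<close>

type_synonym 'a functional = "('a \<Rightarrow> complex) \<Rightarrow> complex"

definition tempered :: "'a::euclidean_space functional set" where
  "tempered = {T.
     (\<forall>\<phi>\<in>schwartz. \<forall>\<psi>\<in>schwartz. \<forall>a b. T (\<lambda>x. a * \<phi> x + b * \<psi> x) = a * T \<phi> + b * T \<psi>) \<and>
     (\<forall>\<phi>. schwartz_null \<phi> \<longrightarrow> (\<lambda>j. T (\<phi> j)) \<longlonglongrightarrow> 0)}"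

definition fourier :: "('a::euclidean_space \<Rightarrow> complex) \<Rightarrow> 'a \<Rightarrow> complex" where
  "fourier \<phi> \<xi> = of_real ((2 * pi) powr (- real DIM('a) / 2)) *
     (LINT x|lborel. \<phi> x * cis (- (x \<bullet> \<xi>)))"

definition inv_fourier :: "('a::euclidean_space \<Rightarrow> complex) \<Rightarrow> 'a \<Rightarrow> complex" where
  "inv_fourier \<phi> x = of_real ((2 * pi) powr (- real DIM('a) / 2)) *
     (LINT \<xi>|lborel. \<phi> \<xi> * cis (x \<bullet> \<xi>))"

definition dist_fourier :: "'a::euclidean_space functional \<Rightarrow> 'a functional" where
  "dist_fourier T = (\<lambda>\<phi>. T (fourier \<phi>))"

definition dist_inv_fourier :: "'a::euclidean_space functional \<Rightarrow> 'a functional" where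
  "dist_inv_fourier T = (\<lambda>\<phi>. T (inv_fourier \<phi>))"

definition dist_mult :: "('a::euclidean_space \<Rightarrow> complex) \<Rightarrow> 'a functional \<Rightarrow> 'a functional" where
  "dist_mult \<psi> T = (\<lambda>\<phi>. T (\<lambda>x. \<psi> x * \<phi> x))"


section \<open>Lebesgue norms\<close>

text \<open>Used with exponents \<open>a > 0\<close> only.\<close>

definition ennreal_powr :: "ennreal \<Rightarrow> real \<Rightarrow> ennreal" where
  "ennreal_powr x a = (if x = \<infinity> then \<infinity> else ennreal (enn2real x powr a))"

definition Lp_norm :: "ennreal \<Rightarrow> ('a::euclidean_space \<Rightarrow> complex) \<Rightarrow> ennreal" where
  "Lp_norm p u =
     (if p = \<infinity> then esssup lborel (\<lambda>x. ennreal (norm (u x)))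
      else ennreal_powr (\<integral>\<^sup>+x. ennreal (norm (u x) powr enn2real p) \<partial>lborel) (1 / enn2real p))"

definition represents :: "('a::euclidean_space \<Rightarrow> complex) \<Rightarrow> 'a functional \<Rightarrow> bool" where
  "represents u T \<longleftrightarrow> u \<in> borel_measurable lborel \<and>
     (\<forall>\<phi>\<in>schwartz. integrable lborel (\<lambda>x. u x * \<phi> x) \<and> T \<phi> = (LINT x|lborel. u x * \<phi> x))"

text \<open>The \<open>L\<^sub>p\<close> norm of a tempered distribution. The representing function is unique up to null
  sets, so the infimum is over at most one value; it is \<open>\<infinity>\<close> if the distribution is not given by
  a function.\<close>

definition dist_Lp_norm :: "ennreal \<Rightarrow> 'a::euclidean_space functional \<Rightarrow> ennreal" where
  "dist_Lp_norm p T = Inf {Lp_norm p u | u. represents u T}"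


section \<open>Besov spaces of dominating mixed smoothness\<close>

primrec dyadic_part :: "(real \<Rightarrow> complex) \<Rightarrow> nat \<Rightarrow> real \<Rightarrow> complex" where
  "dyadic_part \<phi>\<^sub>0 0 = \<phi>\<^sub>0"
| "dyadic_part \<phi>\<^sub>0 (Suc k) = (\<lambda>t. \<phi>\<^sub>0 (t / 2 ^ Suc k) - \<phi>\<^sub>0 (t / 2 ^ k))"

definition dyadic_part2 :: "(real \<Rightarrow> complex) \<Rightarrow> nat \<times> nat \<Rightarrow> real \<times> real \<Rightarrow> complex" where
  "dyadic_part2 \<phi>\<^sub>0 k t = dyadic_part \<phi>\<^sub>0 (fst k) (fst t) * dyadic_part \<phi>\<^sub>0 (snd k) (snd t)"

definition besov_block ::
  "(real \<Rightarrow> complex) \<Rightarrow> ennreal \<Rightarrow> real \<Rightarrow> (real \<times> real) functional \<Rightarrow> nat \<times> nat \<Rightarrow> ennreal" where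
  "besov_block \<phi>\<^sub>0 p r f k = ennreal (2 powr (r * real (fst k + snd k))) *
     dist_Lp_norm p (dist_inv_fourier (dist_mult (dyadic_part2 \<phi>\<^sub>0 k) (dist_fourier f)))"

definition besov_norm ::
  "(real \<Rightarrow> complex) \<Rightarrow> ennreal \<Rightarrow> ennreal \<Rightarrow> real \<Rightarrow> (real \<times> real) functional \<Rightarrow> ennreal" where
  "besov_norm \<phi>\<^sub>0 p q r f =
     (if q = \<infinity> then (SUP k. besov_block \<phi>\<^sub>0 p r f k)
      else ennreal_powr (\<Sum>\<^sub>\<infinity>k\<in>UNIV. ennreal_powr (besov_block \<phi>\<^sub>0 p r f k) (enn2real q))
             (1 / enn2real q))"

definition besov_space ::
  "(real \<Rightarrow> complex) \<Rightarrow> ennreal \<Rightarrow> ennreal \<Rightarrow> real \<Rightarrow> (real \<times> real) functional set" where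
  "besov_space \<phi>\<^sub>0 p q r = {f \<in> tempered. besov_norm \<phi>\<^sub>0 p q r f < \<infinity>}"

definition unit_square :: "(real \<times> real) set" where
  "unit_square = {0..<1} \<times> {0..<1}"

definition test_functions :: "(real \<times> real \<Rightarrow> complex) set" where
  "test_functions = {\<phi>. smooth \<phi> \<and> compact (closure {x. \<phi> x \<noteq> 0}) \<and>
     closure {x. \<phi> x \<noteq> 0} \<subseteq> interior unit_square}"

text \<open>The quasi-norm on the unit square. A functional that agrees on the test functions with a
  tempered distribution \<open>g\<close> is a distribution on the square, so the membership of \<open>f\<close> in the dual
  of the test functions follows as soon as the quasi-norm is finite.\<close>

definition besov_norm_square ::
  "(real \<Rightarrow> complex) \<Rightarrow> ennreal \<Rightarrow> ennreal \<Rightarrow> real \<Rightarrow> (real \<times> real) functional \<Rightarrow> ennreal" where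
  "besov_norm_square \<phi>\<^sub>0 p q r f =
     Inf {besov_norm \<phi>\<^sub>0 p q r g | g. g \<in> besov_space \<phi>\<^sub>0 p q r \<and> (\<forall>\<phi>\<in>test_functions. g \<phi> = f \<phi>)}"

definition regular_distribution :: "(real \<times> real \<Rightarrow> real) \<Rightarrow> (real \<times> real) functional" where
  "regular_distribution D = (\<lambda>\<phi>. LINT t:unit_square|lborel. of_real (D t) * \<phi> t)"


section \<open>Local discrepancy and Hammersley type point sets\<close>

definition local_discrepancy :: "(real \<times> real) multiset \<Rightarrow> real \<times> real \<Rightarrow> real" where
  "local_discrepancy P t =
     1 / real (size P) * (\<Sum>z\<in>#P. indicator ({0..<fst t} \<times> {0..<snd t}) z) - fst t * snd t"

text \<open>The rule for the digit \<open>s\<^sub>i\<close> is \<open>s\<^sub>i = t\<^sub>i\<close> if \<open>\<sigma> i\<close> holds, and \<open>s\<^sub>i = 1 - t\<^sub>i\<close> otherwise.\<close>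

definition hammersley :: "nat \<Rightarrow> (nat \<Rightarrow> bool) \<Rightarrow> (real \<times> real) set" where
  "hammersley n \<sigma> =
     {(\<Sum>i=1..n. t (n + 1 - i) / 2 ^ i, \<Sum>i=1..n. (if \<sigma> i then t i else 1 - t i) / 2 ^ i)
      | t :: nat \<Rightarrow> real. \<forall>i\<in>{1..n}. t i \<in> {0, 1}}"

definition symmetrized_hammersley :: "nat \<Rightarrow> (nat \<Rightarrow> bool) \<Rightarrow> (real \<times> real) multiset" where
  "symmetrized_hammersley n \<sigma> =
     (let R = mset_set (hammersley n \<sigma>) in
      R + {#(x, 1 - y). (x, y) \<in># R#} + {#(1 - x, y). (x, y) \<in># R#} + {#(1 - x, 1 - y). (x, y) \<in># R#})"

lemma finite_card_hammersley:
  "finite (hammersley n \<sigma>)" "card (hammersley n \<sigma>) = 2 ^ n"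
proof -
  define t where "t A i = (of_bool (i \<in> A) :: real)" for A and i :: nat
  define f where "f A = (\<Sum>i=1..n. t A (n + 1 - i) / 2 ^ i,
    \<Sum>i=1..n. (if \<sigma> i then t A i else 1 - t A i) / 2 ^ i)" for A
  have eq: "hammersley n \<sigma> = f ` Pow {1..n}"
  proof (intro equalityI subsetI)
    fix z assume "z \<in> hammersley n \<sigma>"
    then obtain u :: "nat \<Rightarrow> real" where u: "\<forall>i\<in>{1..n}. u i \<in> {0, 1}"
      and z: "z = (\<Sum>i=1..n. u (n + 1 - i) / 2 ^ i,
        \<Sum>i=1..n. (if \<sigma> i then u i else 1 - u i) / 2 ^ i)"
      by (auto simp: hammersley_def)
    define A where "A = {i\<in>{1..n}. u i = 1}"
    have ut: "u i = t A i" if "i \<in> {1..n}" for i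
      using u that by (auto simp: t_def A_def)
    have "z = f A"
      unfolding z f_def prod.inject
    proof (intro conjI sum.cong refl)
      fix i assume i: "i \<in> {1..n}"
      have "n + 1 - i \<in> {1..n}" using i by auto
      with ut show "u (n + 1 - i) / 2 ^ i = t A (n + 1 - i) / 2 ^ i" by simp
      show "(if \<sigma> i then u i else 1 - u i) / 2 ^ i = (if \<sigma> i then t A i else 1 - t A i) / 2 ^ i"
        using ut[OF i] by simp
    qed
    moreover have "A \<in> Pow {1..n}" by (auto simp: A_def)
    ultimately show "z \<in> f ` Pow {1..n}" by blast
  next
    fix z assume "z \<in> f ` Pow {1..n}"
    then obtain A where "z = f A" by blast
    then show "z \<in> hammersley n \<sigma>"
      unfolding hammersley_def f_def by (auto intro!: exI[of _ "t A"] simp: t_def)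
  qed
  have enc: "2 ^ (n + 1) * fst (f A) = real (set_encode A)" if "A \<subseteq> {1..n}" for A
  proof -
    have "2 ^ (n + 1) * fst (f A) = (\<Sum>i=1..n. 2 ^ (n + 1) * (t A (n + 1 - i) / 2 ^ i))"
      by (simp add: f_def sum_distrib_left)
    also have "\<dots> = (\<Sum>i=1..n. t A i * 2 ^ i)"
      by (rule sum.reindex_bij_witness[of _ "\<lambda>i. n + 1 - i" "\<lambda>i. n + 1 - i"])
         (auto simp: power_diff)
    also have "\<dots> = (\<Sum>i\<in>A. 2 ^ i)"
      using that by (intro sum.mono_neutral_cong_right) (auto simp: t_def)
    finally show ?thesis by (simp add: set_encode_def)
  qed
  have "inj_on f (Pow {1..n})"
  proof (rule inj_onI)
    fix A B assume A: "A \<in> Pow {1..n}" and B: "B \<in> Pow {1..n}" and "f A = f B"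
    then have "set_encode A = set_encode B"
      using enc[of A] enc[of B] by simp
    moreover have "finite A" "finite B" using A B finite_subset by auto
    ultimately show "A = B" by (simp add: set_encode_eq)
  qed
  then show "finite (hammersley n \<sigma>)" "card (hammersley n \<sigma>) = 2 ^ n"
    unfolding eq by (simp_all add: card_image card_Pow)
qed

lemma size_symmetrized_hammersley: "size (symmetrized_hammersley n \<sigma>) = 2 ^ (n + 2)"
  by (simp add: symmetrized_hammersley_def Let_def finite_card_hammersley)

end

theory Submission
  imports Defs "HOL-Probability.Sinc_Integral"
begin

text \<open>The discrepancy function \<open>D\<close> of the point set is extended by zero to the plane. This extension is itself
an admissible extension of the distribution on the square, so it is enough to bound its Besov norm on
the plane. Each Fourier block is estimated directly, on a finite Haar expansion of \<open>D\<close>.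

\<^bold>\<open>Haar expansion.\<close> For \<open>x\<close> in the grid \<open>2\<^sup>-\<^sup>L\<int>\<close> the indicator of \<open>x < t\<close> has a finite Haar expansion in \<open>t\<close>,
whose coefficients are values at \<open>x\<close> of tent functions (\<open>haar_expansion_indicator\<close>). The function \<open>t\<close> is
the mean of these indicators over \<open>x\<close>. Hence \<open>D\<close> is, up to \<open>O(2\<^sup>-\<^sup>L)\<close>, a finite Haar sum
with coefficients \<open>coeff\<close> equal to a mean over the points of a product of two tent functions, minus its
expected value. Here \<open>L\<close> is arbitrarily large compared with \<open>n\<close>.

\<^bold>\<open>Coefficients.\<close> The reflections make the coefficients with a constant factor vanish below level \<open>n\<close>
(\<open>coeff_0_Suc\<close>). For levels with sum \<open>s \<le> n\<close>, a dyadic box of area \<open>2\<^sup>-\<^sup>s\<close> contains \<open>2\<^bsup>n-s\<^esup>\<close> points, indexed by the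
free binary digits. The first free digit of one coordinate is, up to a flip, the last free digit
of the other; averaging over the values of these two digits leaves only one product of lowest
order terms, of size \<open>4\<^bsup>s-n\<^esup>\<close> (\<open>four_corners\<close>). This yields coefficients of size \<open>2\<^sup>-\<^sup>n 2\<^bsup>s-n\<^esup>\<close>. For \<open>s \<ge> n\<close> a box contains at
most one point and the coefficients are at most \<open>2\<^sup>-\<^sup>n\<close>, with bounded sum on each level. Both cases are
expressed through \<open>gain a = min 1 2\<^sup>a\<close> in \<open>abs_coeff_le\<close> and \<open>sum_abs_coeff_le\<close>.

\<^bold>\<open>Kernels.\<close> The block of \<open>D\<close> with index \<open>(k, l)\<close> is its convolution with the tensor product of two
kernels \<open>\<kappa>\<^sub>k\<close>, \<open>\<kappa>\<^sub>l\<close>, the inverse Fourier transforms of the dyadic bumps (\<open>block_represented\<close>). The kernel \<open>\<kappa>\<^sub>k\<close> has bounded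
\<open>L\<^sub>1\<close> norm, its derivative has \<open>L\<^sub>1\<close> norm \<open>O(2\<^sup>k)\<close> and, for \<open>k > 0\<close>, it has a primitive with \<open>L\<^sub>1\<close> norm \<open>O(2\<^sup>-\<^sup>k)\<close>.
A Haar function of level \<open>j\<close> is a difference of two adjacent indicators of length \<open>2\<^bsup>-j-1\<^esup>\<close>; therefore convolution with \<open>\<kappa>\<^sub>k\<close> gains a
factor \<open>gain (k - j)\<close>, both in the supremum summed over the position and, with an additional \<open>2\<^sup>-\<^sup>k\<close>, in \<open>L\<^sub>1\<close>
(\<open>haar_conv_bounds\<close>).

\<^bold>\<open>Conclusion.\<close> Summing over all levels bounds the block by \<open>C 2\<^sup>-\<^sup>n R\<close> in the supremum norm and by
\<open>C 2\<^bsup>-k-l\<^esup> R\<close> in \<open>L\<^sub>1\<close>, with the same \<open>R = 2\<^bsup>\<gamma>(k+l-n) - \<epsilon>/2 \<bar>k+l-n\<bar>\<^esup>\<close> for any \<open>0 < \<gamma> < 1\<close> and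
a small \<open>\<epsilon> > 0\<close> (\<open>block_bounds\<close>). For \<open>\<gamma> = 1/p - r\<close>, which lies in \<open>(0, 1)\<close> exactly under the assumption on \<open>r\<close>, interpolation between the two
norms gives \<open>2\<^bsup>r(k+l)\<^esup> \<parallel>block\<parallel>\<^sub>p \<le> C 2\<^bsup>(r-1)n\<^esup> 2\<^bsup>-\<epsilon>/2 \<bar>k+l-n\<bar>\<^esup>\<close>. The \<open>\<ell>\<^sub>q\<close> sum over \<open>(k, l)\<close> is dominated by the
\<open>n + 1\<close> pairs with \<open>k + l = n\<close>, and these produce the power of the logarithm.\<close>

section \<open>Dyadic weights\<close>

text \<open>The common shape of all estimates below. A kernel of frequency \<open>2\<^sup>k\<close> against a Haar function of level \<open>j\<close>
gains \<open>gain (k - j)\<close>: the cancellation of the Haar function helps if \<open>k < j\<close>, and nothing is gained if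
\<open>k \<ge> j\<close>.\<close>
definition gain :: "real \<Rightarrow> real" where
  "gain a = min 1 (2 powr a)"

lemma gain_nonneg: "0 \<le> gain a" by (simp add: gain_def)
lemma gain_le_1: "gain a \<le> 1" by (simp add: gain_def)
lemma gain_nonpos: "a \<le> 0 \<Longrightarrow> gain a = 2 powr a"
  using powr_mono[of a 0 2] by (simp add: gain_def)
lemma gain_nonneg_arg: "a \<ge> 0 \<Longrightarrow> gain a = 1"
  using powr_mono[of 0 a 2] by (simp add: gain_def)
lemma gain_mono: "a \<le> b \<Longrightarrow> gain a \<le> gain b"
  unfolding gain_def by (intro min.mono powr_mono) auto

text \<open>The slope of \<open>gain\<close> in the exponent is \<open>1\<close> on the left and \<open>0\<close> on the right, so it stays below the
exponential of any slope \<open>\<gamma>\<close> strictly between, with room for decay in both directions.\<close>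
lemma gain_le_powr:
  assumes "0 < \<epsilon>" "\<epsilon> \<le> \<gamma>" "\<epsilon> \<le> 1 - \<gamma>"
  shows "gain a \<le> 2 powr (\<gamma> * a - \<epsilon> * \<bar>a\<bar>)"
proof (cases "a \<le> 0")
  case True
  have "a * (1 - \<gamma> - \<epsilon>) \<le> 0" using True assms by (intro mult_nonpos_nonneg) auto
  then have "a \<le> \<gamma> * a - \<epsilon> * \<bar>a\<bar>" using True by (simp add: algebra_simps)
  then show ?thesis using True by (simp add: gain_nonpos)
next
  case False
  have "0 \<le> (\<gamma> - \<epsilon>) * a" using False assms by (intro mult_nonneg_nonneg) auto
  then have "0 \<le> \<gamma> * a - \<epsilon> * \<bar>a\<bar>" using False by (simp add: algebra_simps)
  then have "2 powr 0 \<le> 2 powr (\<gamma> * a - \<epsilon> * \<bar>a\<bar>)" by (intro powr_mono) auto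
  then show ?thesis using gain_le_1[of a] by simp
qed

lemma sum_two_sided_geometric:
  assumes "0 < \<eta>"
  shows "(\<Sum>i\<le>L::nat. 2 powr (- \<eta> * \<bar>of_int a - real i\<bar>)) \<le> 2 / (1 - 2 powr (- \<eta>))"
proof -
  define x :: real where "x = 2 powr (- \<eta>)"
  have x: "0 < x" "x < 1"
    using assms powr_less_mono[of "- \<eta>" 0 2] by (auto simp: x_def)
  have pw: "2 powr (- \<eta> * real d) = x ^ d" for d
    by (simp add: x_def powr_powr flip: powr_realpow)
  have part: "(\<Sum>i\<in>A. x ^ nat (f i)) \<le> 1 / (1 - x)"
    if "finite A" "inj_on f A" "\<And>i. i \<in> A \<Longrightarrow> f i \<ge> 0" for A :: "nat set" and f :: "nat \<Rightarrow> int"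
  proof -
    have inj: "inj_on (nat \<circ> f) A"
      using that by (auto simp: inj_on_def eq_nat_nat_iff)
    have "(\<Sum>i\<in>A. x ^ nat (f i)) = (\<Sum>d\<in>(nat \<circ> f) ` A. x ^ d)"
      using inj by (simp add: sum.reindex o_def)
    also have "\<dots> \<le> (\<Sum>d. x ^ d)"
      using x that by (intro sum_le_suminf) (auto intro: summable_geometric)
    finally show ?thesis using x by (simp add: suminf_geometric)
  qed
  have "(\<Sum>i\<le>L. 2 powr (- \<eta> * \<bar>of_int a - real i\<bar>)) = (\<Sum>i\<le>L. x ^ nat \<bar>a - int i\<bar>)"
  proof (rule sum.cong)
    fix i :: nat
    have "\<bar>of_int a - real i\<bar> = real (nat \<bar>a - int i\<bar>)" by linarith
    then show "2 powr (- \<eta> * \<bar>of_int a - real i\<bar>) = x ^ nat \<bar>a - int i\<bar>"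
      using pw by metis
  qed simp
  also have "\<dots> = (\<Sum>i\<in>{i. i \<le> L \<and> int i \<le> a}. x ^ nat \<bar>a - int i\<bar>)
      + (\<Sum>i\<in>{i. i \<le> L \<and> int i > a}. x ^ nat \<bar>a - int i\<bar>)"
    by (subst sum.union_disjoint[symmetric]) (auto intro!: sum.cong finite_subset[of _ "{..L}"])
  also have "(\<Sum>i\<in>{i. i \<le> L \<and> int i \<le> a}. x ^ nat \<bar>a - int i\<bar>)
      = (\<Sum>i\<in>{i. i \<le> L \<and> int i \<le> a}. x ^ nat (a - int i))"
    by (intro sum.cong) auto
  also have "\<dots> \<le> 1 / (1 - x)"
    by (rule part) (auto simp: inj_on_def intro: finite_subset[of _ "{..L}"])
  also have "(\<Sum>i\<in>{i. i \<le> L \<and> int i > a}. x ^ nat \<bar>a - int i\<bar>)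
      = (\<Sum>i\<in>{i. i \<le> L \<and> int i > a}. x ^ nat (int i - a))"
    by (intro sum.cong) (auto simp: abs_if)
  also have "\<dots> \<le> 1 / (1 - x)"
    by (rule part) (auto simp: inj_on_def intro: finite_subset[of _ "{..L}"])
  finally show ?thesis by (simp add: x_def)
qed

text \<open>Apart from the growth with slope \<open>\<gamma>\<close>, a peak at \<open>s = n\<close>; as a function of \<open>s = k + l\<close> it is concentrated on the
diagonal \<open>k + l = n\<close>.\<close>
definition ridge :: "real \<Rightarrow> real \<Rightarrow> nat \<Rightarrow> nat \<Rightarrow> real" where
  "ridge \<gamma> \<epsilon> n s = 2 powr (\<gamma> * (real s - real n) - \<epsilon> / 2 * \<bar>real s - real n\<bar>)"

text \<open>The arguments of the three factors \<open>gain\<close> add up to \<open>k + l - n\<close>. So the exponential parts of slope \<open>\<gamma>\<close> multiply to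
a factor independent of \<open>i\<close> and \<open>j\<close>, and by the triangle inequality one half of the remaining decay
controls the distance of \<open>k + l\<close> from \<open>n\<close> while the other half makes the sum over \<open>i\<close> and \<open>j\<close> converge.\<close>
lemma sum_gain_bound:
  assumes "0 < \<epsilon>" "\<epsilon> \<le> \<gamma>" "\<epsilon> \<le> 1 - \<gamma>"
  shows "(\<Sum>i\<le>L::nat. \<Sum>j\<le>L. gain (real k - real i) * gain (real l - real j) * gain (real i + real j - real n))
    \<le> (2 / (1 - 2 powr (- (\<epsilon> / 2))))\<^sup>2 * ridge \<gamma> \<epsilon> n (k + l)"
proof -
  define A where "A = 2 / (1 - 2 powr (- (\<epsilon> / 2)))"
  define E where "E = ridge \<gamma> \<epsilon> n (k + l)"
  define h where "h k i = 2 powr (- (\<epsilon> / 2) * \<bar>of_int (int k) - real i\<bar>)" for k i :: nat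
  have h: "(\<Sum>i\<le>L. h k i) \<le> A" for k
    unfolding h_def A_def using assms by (intro sum_two_sided_geometric) auto
  have h0: "0 \<le> h k i" for k i by (simp add: h_def)
  have A0: "0 \<le> A" using sum_nonneg[of "{..L}" "h 0"] h[of 0] h0 by (meson order_trans)
  have "gain (real k - real i) * gain (real l - real j) * gain (real i + real j - real n) \<le> E * (h k i * h l j)"
    for i j
  proof -
    define a b c where "a = real k - real i" "b = real l - real j" "c = real i + real j - real n"
    have "gain a * gain b * gain c \<le> 2 powr (\<gamma> * a - \<epsilon> * \<bar>a\<bar>) * 2 powr (\<gamma> * b - \<epsilon> * \<bar>b\<bar>) * 2 powr (\<gamma> * c - \<epsilon> * \<bar>c\<bar>)"
      by (intro mult_mono gain_le_powr assms mult_nonneg_nonneg gain_nonneg) auto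
    also have "\<dots> = 2 powr (\<gamma> * (a + b + c) - \<epsilon> * (\<bar>a\<bar> + \<bar>b\<bar> + \<bar>c\<bar>))"
      by (simp add: powr_add[symmetric] algebra_simps)
    also have "\<dots> \<le> 2 powr (\<gamma> * (a + b + c) - \<epsilon> / 2 * \<bar>a + b + c\<bar> + (- (\<epsilon> / 2) * \<bar>a\<bar>) + (- (\<epsilon> / 2) * \<bar>b\<bar>))"
    proof (rule powr_mono)
      have "\<epsilon> / 2 * \<bar>a + b + c\<bar> \<le> \<epsilon> / 2 * (\<bar>a\<bar> + \<bar>b\<bar> + \<bar>c\<bar>)"
        using assms by (intro mult_left_mono) auto
      moreover have "0 \<le> \<epsilon> / 2 * \<bar>c\<bar>" using assms by auto
      ultimately show "\<gamma> * (a + b + c) - \<epsilon> * (\<bar>a\<bar> + \<bar>b\<bar> + \<bar>c\<bar>)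
          \<le> \<gamma> * (a + b + c) - \<epsilon> / 2 * \<bar>a + b + c\<bar> + (- (\<epsilon> / 2) * \<bar>a\<bar>) + (- (\<epsilon> / 2) * \<bar>b\<bar>)"
        by (simp add: field_simps)
    qed simp
    also have "\<dots> = E * (h k i * h l j)"
      unfolding E_def ridge_def h_def by (simp add: powr_add[symmetric] a_b_c_def algebra_simps)
    finally show ?thesis by (simp add: a_b_c_def)
  qed
  then have "(\<Sum>i\<le>L. \<Sum>j\<le>L. gain (real k - real i) * gain (real l - real j) * gain (real i + real j - real n))
      \<le> (\<Sum>i\<le>L. \<Sum>j\<le>L. E * (h k i * h l j))"
    by (intro sum_mono)
  also have "\<dots> = E * ((\<Sum>i\<le>L. h k i) * (\<Sum>j\<le>L. h l j))"
    unfolding sum_product by (simp only: sum_distrib_left)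
  also have "\<dots> \<le> E * (A * A)"
    using A0 h h0 by (intro mult_left_mono mult_mono sum_nonneg) (auto simp: E_def ridge_def)
  finally show ?thesis by (simp add: A_def E_def power2_eq_square mult.commute)
qed

text \<open>Each row \<open>k \<le> n\<close> contributes a bounded amount, and the rows \<open>k > n\<close> form a convergent series; this is
the origin of the factor \<open>n + 1\<close>, hence of the logarithm.\<close>
lemma sum_diagonal_decay:
  assumes "0 < \<eta>" "finite F"
  shows "(\<Sum>(k, l)\<in>F. 2 powr (- \<eta> * \<bar>real (k + l) - real n\<bar>))
    \<le> (2 / (1 - 2 powr (- \<eta>)) + (2 / (1 - 2 powr (- \<eta>)))\<^sup>2) * (real n + 1)"
proof -
  define A where "A = 2 / (1 - 2 powr (- \<eta>))"
  define g where "g k l = 2 powr (- \<eta> * \<bar>real (k + l) - real n\<bar>)" for k l :: nat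
  have A: "(\<Sum>i\<le>L::nat. 2 powr (- \<eta> * \<bar>of_int a - real i\<bar>)) \<le> A" for L a
    unfolding A_def using assms by (intro sum_two_sided_geometric) auto
  have "0 \<le> (\<Sum>i\<le>0::nat. 2 powr (- \<eta> * \<bar>of_int 0 - real i\<bar>))" by (rule sum_nonneg) simp
  with A have A0: "0 \<le> A" by (meson order_trans)
  obtain M where M: "F \<subseteq> {..M} \<times> {..M}"
  proof
    let ?M = "Max (insert 0 (fst ` F \<union> snd ` F))"
    show "F \<subseteq> {..?M} \<times> {..?M}"
      using assms(2) by (auto intro!: Max_ge rev_image_eqI)
  qed
  have "(\<Sum>(k, l)\<in>F. g k l) \<le> (\<Sum>(k, l)\<in>{..M} \<times> {..M}. g k l)"
    using M by (intro sum_mono2) (auto simp: g_def)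
  also have "\<dots> = (\<Sum>k\<le>M. \<Sum>l\<le>M. g k l)" by (simp add: sum.cartesian_product)
  also have "\<dots> \<le> (\<Sum>k\<le>M. (if k \<le> n then A else 0) + A * 2 powr (- \<eta> * \<bar>of_int (int n) - real k\<bar>))"
  proof (rule sum_mono)
    fix k
    show "(\<Sum>l\<le>M. g k l) \<le> (if k \<le> n then A else 0) + A * 2 powr (- \<eta> * \<bar>of_int (int n) - real k\<bar>)"
    proof (cases "k \<le> n")
      case True
      have "(\<Sum>l\<le>M. g k l) = (\<Sum>l\<le>M. 2 powr (- \<eta> * \<bar>of_int (int n - int k) - real l\<bar>))"
        by (intro sum.cong refl) (simp add: g_def abs_minus_commute algebra_simps)
      also have "\<dots> \<le> A" by (rule A)
      finally show ?thesis using True A0 by (simp add: add_increasing2)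
    next
      case False
      have "(\<Sum>l\<le>M. g k l) = (\<Sum>l\<le>M. 2 powr (- \<eta> * \<bar>of_int 0 - real l\<bar>)) * 2 powr (- \<eta> * \<bar>of_int (int n) - real k\<bar>)"
        unfolding sum_distrib_right
      proof (intro sum.cong refl)
        fix l
        have "\<bar>real (k + l) - real n\<bar> = \<bar>of_int 0 - real l\<bar> + \<bar>of_int (int n) - real k\<bar>"
          using False by simp
        then show "g k l = 2 powr (- \<eta> * \<bar>of_int 0 - real l\<bar>) * 2 powr (- \<eta> * \<bar>of_int (int n) - real k\<bar>)"
          unfolding g_def by (simp add: powr_add[symmetric] algebra_simps)
      qed
      also have "\<dots> \<le> A * 2 powr (- \<eta> * \<bar>of_int (int n) - real k\<bar>)"
        by (intro mult_right_mono A) simp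
      finally show ?thesis using False by simp
    qed
  qed
  also have "\<dots> = (\<Sum>k\<in>{..M} \<inter> {..n}. A) + A * (\<Sum>k\<le>M. 2 powr (- \<eta> * \<bar>of_int (int n) - real k\<bar>))"
    by (simp add: sum.distrib sum_distrib_left sum.If_cases atMost_def)
  also have "\<dots> \<le> (\<Sum>k\<in>{..n}. A) + A * A"
    using A0 by (intro add_mono sum_mono2 mult_left_mono A) auto
  also have "\<dots> \<le> (A + A\<^sup>2) * (real n + 1)"
    using A0 by (simp add: algebra_simps power2_eq_square)
  finally show ?thesis by (simp add: g_def A_def)
qed

section \<open>Tent functions of binary expansions\<close>

text \<open>The primitive of the Haar function on the unit interval that vanishes outside of it.\<close>
definition tent :: "real \<Rightarrow> real" where
  "tent u = max 0 (min u (1 - u))"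

lemma tent_nonneg: "0 \<le> tent u" by (simp add: tent_def)
lemma tent_le: "tent u \<le> 1 / 2" by (auto simp: tent_def max_def min_def)
lemma tent_eq_0: "u \<le> 0 \<or> 1 \<le> u \<Longrightarrow> tent u = 0" by (auto simp: tent_def)

text \<open>The value of the tent function at \<open>e / 2 + w\<close> with \<open>0 \<le> w \<le> 1/2\<close>, as a polynomial in the leading binary digit
\<open>e \<in> {0, 1}\<close>.\<close>
definition tent_branch :: "real \<Rightarrow> real \<Rightarrow> real" where
  "tent_branch e w = (1 - e) * w + e * (1 / 2 - w)"

text \<open>Sets of positions encode sequences of binary digits, and toggling an element flips one digit.
As an involution it can be averaged over in sums.\<close>
definition toggle :: "'a \<Rightarrow> 'a set \<Rightarrow> 'a set" where
  "toggle p A = (if p \<in> A then A - {p} else insert p A)"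

lemma in_toggle_iff: "q \<in> toggle p A \<longleftrightarrow> (if q = p then q \<notin> A else q \<in> A)"
  by (auto simp: toggle_def)

lemma toggle_toggle: "toggle p (toggle p A) = A"
  by (auto simp: toggle_def)

lemma sum_toggle:
  assumes "\<And>A. A \<in> B \<Longrightarrow> toggle p A \<in> B"
  shows "(\<Sum>A\<in>B. F (toggle p A)) = (\<Sum>A\<in>B. F A)"
  by (rule sum.reindex_bij_witness[of _ "toggle p" "toggle p"]) (auto simp: toggle_toggle assms)

lemma card_subsets_with_trace:
  assumes "finite U" "F \<subseteq> U" "G \<subseteq> F"
  shows "card {A \<in> Pow U. A \<inter> F = G} = 2 ^ (card U - card F)"
proof -
  have "bij_betw (\<lambda>A. A - F) {A \<in> Pow U. A \<inter> F = G} (Pow (U - F))"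
    by (rule bij_betw_byWitness[where f' = "\<lambda>A. A \<union> G"]) (use assms in auto)
  then have "card {A \<in> Pow U. A \<inter> F = G} = card (Pow (U - F))"
    by (rule bij_betw_same_card)
  also have "\<dots> = 2 ^ (card U - card F)"
    using assms by (simp add: card_Pow card_Diff_subset finite_subset)
  finally show ?thesis .
qed

lemma set_decode_subset: assumes "m < 2 ^ j" shows "set_decode m \<subseteq> {..<j}"
  proof
    fix i assume "i \<in> set_decode m"
    then have "m div 2 ^ i \<noteq> 0" by (metis even_zero mem_Collect_eq set_decode_def)
    then have "2 ^ i \<le> m" by (metis div_less not_le)
    then have "(2::nat) ^ i < 2 ^ j" using assms by linarith
    then show "i \<in> {..<j}" by simp
  qed
lemma sum_binary_eq_iff:
  assumes "m < 2 ^ j"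
  shows "(\<Sum>i<j. of_bool (d i) * 2 ^ i) = m \<longleftrightarrow> (\<forall>i<j. d i \<longleftrightarrow> i \<in> set_decode m)"
proof -
  let ?D = "{i. i < j \<and> d i}"
  have S: "set_decode m \<subseteq> {..<j}" by (rule set_decode_subset[OF assms])
  have "(\<Sum>i<j. of_bool (d i) * 2 ^ i) = set_encode ?D"
    unfolding set_encode_def by (intro sum.mono_neutral_cong_right) auto
  then have "(\<Sum>i<j. of_bool (d i) * 2 ^ i) = m \<longleftrightarrow> set_encode ?D = set_encode (set_decode m)"
    by (metis set_decode_inverse)
  also have "\<dots> \<longleftrightarrow> ?D = set_decode m"
    by (rule set_encode_eq) auto
  also have "\<dots> \<longleftrightarrow> (\<forall>i<j. d i \<longleftrightarrow> i \<in> set_decode m)"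
    using S by blast
  finally show ?thesis .
qed

lemma Int_image_eq_iff:
  assumes "inj_on \<rho> I"
  shows "A \<inter> \<rho> ` I = \<rho> ` {i \<in> I. Q i} \<longleftrightarrow> (\<forall>i\<in>I. \<rho> i \<in> A \<longleftrightarrow> Q i)"
proof
  assume eq: "A \<inter> \<rho> ` I = \<rho> ` {i \<in> I. Q i}"
  show "\<forall>i\<in>I. \<rho> i \<in> A \<longleftrightarrow> Q i"
  proof
    fix i assume i: "i \<in> I"
    have "\<rho> i \<in> A \<longleftrightarrow> \<rho> i \<in> A \<inter> \<rho> ` I" using i by simp
    also have "\<dots> \<longleftrightarrow> Q i"
      unfolding eq using i assms by (simp add: inj_on_image_mem_iff)
    finally show "\<rho> i \<in> A \<longleftrightarrow> Q i" .
  qed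
qed blast

text \<open>Both coordinates of a Hammersley type point are obtained from the same digits by permuting their
positions and flipping some of them. The locale treats one such coordinate: the \<open>i\<close>-th binary digit is
read at position \<open>\<pi> i\<close> and is flipped unless \<open>\<sigma> i\<close>. The point is encoded by the set of positions
with digit \<open>1\<close>. \<open>head j\<close> is the index of the dyadic interval of level \<open>j\<close> that contains the coordinate and \<open>tail j\<close> is the
relative position in it.\<close>
locale digit_system =
  fixes n :: nat and \<pi> :: "nat \<Rightarrow> nat" and \<sigma> :: "nat \<Rightarrow> bool"
  assumes bij: "bij_betw \<pi> {1..n} {1..n}"
begin

definition digit :: "nat set \<Rightarrow> nat \<Rightarrow> nat" where
  "digit A i = of_bool ((\<pi> i \<in> A) = \<sigma> i)"

definition coord :: "nat set \<Rightarrow> real" where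
  "coord A = (\<Sum>i=1..n. real (digit A i) / 2 ^ i)"

definition head :: "nat \<Rightarrow> nat set \<Rightarrow> nat" where
  "head j A = (\<Sum>i=1..j. digit A i * 2 ^ (j - i))"

definition tail :: "nat \<Rightarrow> nat set \<Rightarrow> real" where
  "tail j A = (\<Sum>i=j+1..n. real (digit A i) * 2 ^ j / 2 ^ i)"

lemma digit_01: "digit A i = 0 \<or> digit A i = 1"
  by (simp add: digit_def)

lemma digit_toggle: "digit (toggle p A) i = (if \<pi> i = p then 1 - digit A i else digit A i)"
  by (auto simp: digit_def in_toggle_iff)

lemma pi_inj: "i \<in> {1..n} \<Longrightarrow> j \<in> {1..n} \<Longrightarrow> \<pi> i = \<pi> j \<longleftrightarrow> i = j"
  using bij by (metis bij_betw_def inj_on_eq_iff)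

lemma pi_in: "i \<in> {1..n} \<Longrightarrow> \<pi> i \<in> {1..n}"
  using bij by (auto simp: bij_betw_def)

lemma coord_split:
  assumes "j \<le> n"
  shows "2 ^ j * coord A = real (head j A) + tail j A"
proof -
  have "2 ^ j * coord A = (\<Sum>i=1..n. real (digit A i) * 2 ^ j / 2 ^ i)"
    by (simp add: coord_def sum_distrib_left mult_ac)
  also have "\<dots> = (\<Sum>i=1..j. real (digit A i) * 2 ^ j / 2 ^ i) + tail j A"
  proof -
    have "{1..n} = {1..j} \<union> {j+1..n}" using assms by auto
    then show ?thesis unfolding tail_def by (simp only:, subst sum.union_disjoint) auto
  qed
  also have "(\<Sum>i=1..j. real (digit A i) * 2 ^ j / 2 ^ i) = real (head j A)"
    unfolding head_def of_nat_sum
  proof (intro sum.cong refl)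
    fix i assume "i \<in> {1..j}"
    then have "(2::real) ^ j = 2 ^ i * 2 ^ (j - i)" by (simp flip: power_add)
    then show "real (digit A i) * 2 ^ j / 2 ^ i = real (digit A i * 2 ^ (j - i))" by simp
  qed
  finally show ?thesis .
qed

lemma tail_step:
  assumes "j < n"
  shows "tail j A = digit A (j + 1) / 2 + tail (j + 1) A / 2"
proof -
  have "{j+1..n} = insert (j+1) {j+2..n}" using assms by auto
  then show ?thesis by (simp add: tail_def sum_divide_distrib)
qed

lemma tail_nonneg: "0 \<le> tail j A"
  unfolding tail_def by (intro sum_nonneg) auto

lemma tail_less_1: "tail j A < 1"
proof (cases "j \<le> n")
  case True
  then show ?thesis
  proof (induction rule: inc_induct)
    case base
    then show ?case by (simp add: tail_def)
  next
    case (step i)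
    then show ?case
      using digit_01[of A "i + 1"] tail_step[OF step(2), of A] by auto
  qed
qed (simp add: tail_def)

text \<open>The tent functions of level \<open>j\<close> have disjoint supports, the dyadic intervals of this level.\<close>
lemma tent_coord:
  assumes "j \<le> n"
  shows "tent (2 ^ j * coord A - real m) = (if head j A = m then tent (tail j A) else 0)"
proof -
  consider "head j A = m" | "real (head j A) + 1 \<le> real m" | "real m + 1 \<le> real (head j A)"
    by linarith
  then show ?thesis
  proof cases
    case 1
    then show ?thesis by (simp add: coord_split[OF assms])
  next
    case 2
    then show ?thesis
      using tail_less_1[of j A] unfolding coord_split[OF assms] by (subst tent_eq_0) auto
  next
    case 3
    then show ?thesis
      using tail_nonneg[of j A] unfolding coord_split[OF assms] by (subst tent_eq_0) auto
  qed
qed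

text \<open>Tent functions of level at least \<open>n\<close> vanish at all points of the grid of mesh \<open>2\<^sup>-\<^sup>n\<close>.\<close>
lemma tent_coord_fine:
  assumes "n \<le> j"
  shows "tent (2 ^ j * coord A - real m) = 0"
proof -
  have "2 ^ j * coord A = 2 ^ (j - n) * (2 ^ n * coord A)"
    using assms by (simp add: power_add[symmetric] mult.assoc[symmetric])
  also have "\<dots> = real (2 ^ (j - n) * head n A)"
    using coord_split[of n A] by (simp add: tail_def)
  finally have *: "2 ^ j * coord A = real (2 ^ (j - n) * head n A)" .
  have "real N - real m \<le> 0 \<or> 1 \<le> real N - real m" for N
    by (cases "N \<le> m") auto
  then show ?thesis
    unfolding * by (intro tent_eq_0)
qed

text \<open>A dyadic interval fixes the first \<open>j\<close> digits, that is, the trace of the encoding set on \<open>j\<close> positions.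
In this form conditions on both coordinates can be intersected.\<close>
lemma head_eq_iff:
  assumes "j \<le> n" "m < 2 ^ j"
  shows "\<exists>G \<subseteq> \<pi> ` {1..j}. \<forall>A. head j A = m \<longleftrightarrow> A \<inter> \<pi> ` {1..j} = G"
proof -
  define \<rho> where "\<rho> i = \<pi> (j - i)" for i
  define G where "G = \<rho> ` {i \<in> {..<j}. (i \<in> set_decode m) = \<sigma> (j - i)}"
  have inj: "inj_on \<rho> {..<j}"
  proof (rule inj_onI)
    fix x y assume "x \<in> {..<j}" "y \<in> {..<j}" "\<rho> x = \<rho> y"
    then show "x = y" 
      using assms(1) pi_inj[of "j - x" "j - y"] by (simp add: \<rho>_def Suc_le_eq le_diff_conv)
  qed
  have im: "\<pi> ` {1..j} = \<rho> ` {..<j}"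
  proof -
    have "i \<in> (\<lambda>i. j - i) ` {..<j}" if "i \<in> {1..j}" for i
      using that by (intro image_eqI[of _ _ "j - i"]) auto
    then have "{1..j} = (\<lambda>i. j - i) ` {..<j}" by auto
    then show ?thesis by (simp add: image_image \<rho>_def[abs_def])
  qed
  have "head j A = m \<longleftrightarrow> A \<inter> \<pi> ` {1..j} = G" for A
  proof -
    have h: "head j A = (\<Sum>i<j. of_bool ((\<rho> i \<in> A) = \<sigma> (j - i)) * 2 ^ i)"
      unfolding head_def digit_def \<rho>_def
      by (rule sum.reindex_bij_witness[of _ "\<lambda>i. j - i" "\<lambda>i. j - i"]) auto
    have "head j A = m \<longleftrightarrow> (\<forall>i<j. ((\<rho> i \<in> A) = \<sigma> (j - i)) \<longleftrightarrow> i \<in> set_decode m)"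
      unfolding h by (rule sum_binary_eq_iff[OF assms(2)])
    also have "\<dots> \<longleftrightarrow> (\<forall>i\<in>{..<j}. \<rho> i \<in> A \<longleftrightarrow> (i \<in> set_decode m) = \<sigma> (j - i))"
    proof -
      have "(((\<rho> i \<in> A) = \<sigma> (j - i)) \<longleftrightarrow> i \<in> set_decode m)
          = (\<rho> i \<in> A \<longleftrightarrow> (i \<in> set_decode m) = \<sigma> (j - i))" for i
        by (cases "\<rho> i \<in> A"; cases "\<sigma> (j - i)") simp_all
      then show ?thesis by (simp only: Ball_def lessThan_iff)
    qed
    finally show ?thesis
      unfolding im G_def Int_image_eq_iff[OF inj] .
  qed
  moreover have "G \<subseteq> \<pi> ` {1..j}" unfolding im G_def by blast
  ultimately show ?thesis by blast
qed

lemma card_pi_image: "j \<le> n \<Longrightarrow> card (\<pi> ` {1..j}) = j"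
  using bij card_image[of \<pi> "{1..j}"] inj_on_subset[of \<pi> "{1..n}" "{1..j}"]
  by (simp add: bij_betw_def)

lemma head_toggle:
  assumes "p \<notin> \<pi> ` {1..j}"
  shows "head j (toggle p A) = head j A"
  unfolding head_def using assms by (intro sum.cong refl) (auto simp: digit_toggle)

lemma tail_toggle_other:
  assumes "p \<notin> \<pi> ` {j+1..n}"
  shows "tail j (toggle p A) = tail j A"
  unfolding tail_def using assms by (intro sum.cong refl) (auto simp: digit_toggle)

lemma tent_tail:
  assumes "j < n"
  shows "tent (tail j A) = tent_branch (digit A (j + 1)) (tail (j + 1) A / 2)"
  using digit_01[of A "j + 1"] tail_nonneg[of "j + 1" A] tail_less_1[of "j + 1" A] assms
  by (auto simp: tail_step tent_def tent_branch_def)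

text \<open>Flipping the first free digit replaces \<open>w\<close> by \<open>1/2 - w\<close>, so the mean of the tent function over the points in an
interval is \<open>1/4\<close>, exactly its integral.\<close>
lemma sum_tent_coord:
  assumes "m < 2 ^ j"
  shows "(\<Sum>A\<in>Pow {1..n}. tent (2 ^ j * coord A - real m)) = (if j < n then 2 ^ (n - j) / 4 else 0)"
proof (cases "j < n")
  case False
  then show ?thesis by (simp add: tent_coord_fine)
next
  case True
  define B where "B = {A \<in> Pow {1..n}. head j A = m}"
  define p where "p = \<pi> (j + 1)"
  have p: "p \<in> {1..n}" "p \<notin> \<pi> ` {1..j}" "p \<notin> \<pi> ` {j+1+1..n}"
  proof -
    have "p \<noteq> \<pi> i" if "i \<in> {1..n}" "i \<noteq> j + 1" for i
      using that True pi_inj[of "j + 1" i] by (auto simp: p_def)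
    note ne = this
    show "p \<notin> \<pi> ` {1..j}"
    proof
      assume "p \<in> \<pi> ` {1..j}"
      then obtain i where "i \<in> {1..j}" "p = \<pi> i" by blast
      then show False using ne[of i] True by auto
    qed
    show "p \<notin> \<pi> ` {j+1+1..n}"
    proof
      assume "p \<in> \<pi> ` {j+1+1..n}"
      then obtain i where "i \<in> {j+1+1..n}" "p = \<pi> i" by blast
      then show False using ne[of i] True by auto
    qed
  qed (use True pi_in[of "j + 1"] in \<open>simp add: p_def\<close>)
  obtain G where G: "G \<subseteq> \<pi> ` {1..j}" "\<And>A. head j A = m \<longleftrightarrow> A \<inter> \<pi> ` {1..j} = G"
    using head_eq_iff[of j m] True assms by auto
  have cardB: "card B = 2 ^ (n - j)"
    unfolding B_def G(2) using True pi_in G(1)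
    using card_pi_image[of j] by (subst card_subsets_with_trace) (auto simp: image_subset_iff)
  have Bp: "toggle p A \<in> B" if "A \<in> B" for A
    using that p by (auto simp: B_def head_toggle) (auto simp: toggle_def split: if_splits)
  have restrict: "(\<Sum>A\<in>Pow {1..n}. tent (2 ^ j * coord A - real m)) = (\<Sum>A\<in>B. tent (tail j A))"
    unfolding B_def using True by (simp add: tent_coord sum.If_cases Int_def)
  have "2 * (\<Sum>A\<in>B. tent (tail j A)) = (\<Sum>A\<in>B. tent (tail j A)) + (\<Sum>A\<in>B. tent (tail j (toggle p A)))"
    using sum_toggle[of B p "\<lambda>A. tent (tail j A)"] Bp by simp
  also have "\<dots> = (\<Sum>A\<in>B. 1 / 2)"
    unfolding sum.distrib[symmetric]
  proof (rule sum.cong)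
    fix A
    show "tent (tail j A) + tent (tail j (toggle p A)) = 1 / 2"
      using digit_01[of A "j + 1"] tail_toggle_other[OF p(3), of A]
      unfolding tent_tail[OF True] by (auto simp: digit_toggle p_def tent_branch_def)
  qed simp
  also have "\<dots> = 2 ^ (n - j) / 2" by (simp add: cardB)
  finally show ?thesis using True restrict by simp
qed

end

text \<open>Writing \<open>tent_branch e w = 1/4 + (1 - 2 e) (w - 1/4)\<close>, each factor is a constant plus a term with a sign that
flips with \<open>e\<close>. The digit \<open>f\<close>, which is the last one in the first coordinate, flips together with the leading digit
\<open>e'\<close> of the second coordinate, and conversely. In the sum over all four cases every product of signs cancels
except the one that contains all four digits, and this one carries the factor \<open>\<delta>\<^sup>2\<close>.\<close>
lemma four_corners:
  fixes e f e' f' R R' \<delta> :: real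
  assumes "e = 0 \<or> e = 1" "f = 0 \<or> f = 1" "e' = 0 \<or> e' = 1" "f' = 0 \<or> f' = 1"
  shows "\<bar>tent_branch e (R + f * \<delta>) * tent_branch e' (R' + f' * \<delta>)
      + tent_branch (1 - e) (R + f * \<delta>) * tent_branch e' (R' + (1 - f') * \<delta>)
      + tent_branch e (R + (1 - f) * \<delta>) * tent_branch (1 - e') (R' + f' * \<delta>)
      + tent_branch (1 - e) (R + (1 - f) * \<delta>) * tent_branch (1 - e') (R' + (1 - f') * \<delta>) - 1 / 4\<bar> = \<delta>\<^sup>2"
    (is "\<bar>?S\<bar> = _")
proof -
  define c where "c = (1 - 2 * e) * (1 - 2 * e') * (1 - 2 * f) * (1 - 2 * f')"
  have "c = 1 \<or> c = - 1" using assms by (auto simp: c_def)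
  moreover have "?S = c * \<delta>\<^sup>2"
    unfolding tent_branch_def c_def by algebra
  ultimately show ?thesis by (auto simp: abs_mult)
qed

section \<open>Tent sums over a Hammersley type point set\<close>

text \<open>Used for several digit sequences \<open>A'\<close> that differ from \<open>A\<close> in few positions; \<open>R\<close> is the same for
all of them.\<close>
lemma (in digit_system) tail_isolate:
  assumes "j < k" "k \<le> n"
  shows "\<exists>R. \<forall>A'. (\<forall>i. \<pi> i \<in> \<pi> ` {j+1..n} - {\<pi> k} \<longrightarrow> digit A' i = digit A i) \<longrightarrow>
    tail j A' = R + real (digit A' k) * 2 ^ j / 2 ^ k"
proof (intro exI allI impI)
  fix A' assume eq: "\<forall>i. \<pi> i \<in> \<pi> ` {j+1..n} - {\<pi> k} \<longrightarrow> digit A' i = digit A i"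
  have "tail j A' = (\<Sum>i\<in>{j+1..n} - {k}. real (digit A' i) * 2 ^ j / 2 ^ i) + real (digit A' k) * 2 ^ j / 2 ^ k"
    unfolding tail_def using assms by (subst sum.remove[of _ k]) auto
  also have "(\<Sum>i\<in>{j+1..n} - {k}. real (digit A' i) * 2 ^ j / 2 ^ i) = (\<Sum>i\<in>{j+1..n} - {k}. real (digit A i) * 2 ^ j / 2 ^ i :: real)"
    using eq assms pi_inj by (intro sum.cong) auto
  finally show "tail j A' = (\<Sum>i\<in>{j+1..n} - {k}. real (digit A i) * 2 ^ j / 2 ^ i) + real (digit A' k) * 2 ^ j / 2 ^ k" .
qed

text \<open>A constant of its own, as the first coordinate reads the digits in reverse order and the lambda
abstraction would be rewritten by simplification.\<close>
definition reversal :: "nat \<Rightarrow> nat \<Rightarrow> nat" where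
  "reversal n i = n + 1 - i"

lemma reversal_image: "i \<le> n \<Longrightarrow> reversal n ` {1..i} = {n + 1 - i..n}"
proof (intro equalityI subsetI)
  fix x assume "i \<le> n" "x \<in> {n + 1 - i..n}"
  then show "x \<in> reversal n ` {1..i}" by (intro image_eqI[of _ _ "n + 1 - x"]) (auto simp: reversal_def)
qed (auto simp: reversal_def)

locale hammersley_digits =
  fixes n :: nat and \<sigma> :: "nat \<Rightarrow> bool"
begin

sublocale X: digit_system n "reversal n" "\<lambda>_. True"
  by unfold_locales (rule bij_betw_byWitness[where f' = "reversal n"], auto simp: reversal_def)

sublocale Y: digit_system n "\<lambda>i. i" \<sigma>
  by unfold_locales (simp add: bij_betw_def)

text \<open>The digit sequences of the points in a dyadic box.\<close>
definition cell :: "nat \<Rightarrow> nat \<Rightarrow> nat \<Rightarrow> nat \<Rightarrow> nat set set" where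
  "cell i k j l = {A \<in> Pow {1..n}. X.head i A = k \<and> Y.head j A = l}"

text \<open>The first coordinate fixes the last \<open>i\<close> digits and the second one the first \<open>j\<close> digits. If these
positions do not overlap, every box is hit; if they do, a box may be empty.\<close>
lemma card_cell_trace:
  assumes "i \<le> n" "j \<le> n" "k < 2 ^ i" "l < 2 ^ j"
  defines "F \<equiv> {n + 1 - i..n} \<union> {1..j}"
  shows "cell i k j l = {} \<or> card (cell i k j l) = 2 ^ (n - card F)"
    and "i + j \<le> n \<Longrightarrow> card (cell i k j l) = 2 ^ (n - card F)"
proof -
  obtain G where G: "G \<subseteq> {n + 1 - i..n}" "\<And>A. X.head i A = k \<longleftrightarrow> A \<inter> {n + 1 - i..n} = G"
    using X.head_eq_iff[OF assms(1,3)] unfolding reversal_image[OF assms(1)] by blast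
  obtain G' where G': "G' \<subseteq> {1..j}" "\<And>A. Y.head j A = l \<longleftrightarrow> A \<inter> {1..j} = G'"
    using Y.head_eq_iff[OF assms(2,4)] by auto
  have F: "F \<subseteq> {1..n}" using assms by auto
  have trace: "card {A \<in> Pow {1..n}. A \<inter> F = K} = 2 ^ (n - card F)" if "K \<subseteq> F" for K
    using card_subsets_with_trace[OF _ F that] by simp
  have cell_eq: "cell i k j l = {A \<in> Pow {1..n}. A \<inter> {n + 1 - i..n} = G \<and> A \<inter> {1..j} = G'}"
    by (simp only: cell_def G G')
  show "cell i k j l = {} \<or> card (cell i k j l) = 2 ^ (n - card F)"
  proof (cases "cell i k j l = {}")
    case False
    then obtain A0 where A0: "A0 \<inter> {n + 1 - i..n} = G" "A0 \<inter> {1..j} = G'"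
      unfolding cell_eq by blast
    have "cell i k j l = {A \<in> Pow {1..n}. A \<inter> F = A0 \<inter> F}"
      unfolding cell_eq A0[symmetric] F_def by blast
    then show ?thesis using trace by simp
  qed simp
  show "card (cell i k j l) = 2 ^ (n - card F)" if "i + j \<le> n"
  proof -
    have "{n + 1 - i..n} \<inter> {1..j} = {}" using that by auto
    then have "cell i k j l = {A \<in> Pow {1..n}. A \<inter> F = G \<union> G'}"
      unfolding cell_eq F_def using G(1) G'(1) by blast
    then show ?thesis using trace[of "G \<union> G'"] G(1) G'(1) by (auto simp: F_def)
  qed
qed

lemma card_cell:
  assumes "i + j \<le> n" "k < 2 ^ i" "l < 2 ^ j"
  shows "card (cell i k j l) = 2 ^ (n - (i + j))"
proof -
  have "card ({n + 1 - i..n} \<union> {1..j}) = i + j"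
    using assms(1) by (subst card_Un_disjoint) auto
  then show ?thesis using card_cell_trace(2)[of i j k l] assms by simp
qed

lemma card_cell_le_1:
  assumes "n \<le> i + j" "i \<le> n" "j \<le> n" "k < 2 ^ i" "l < 2 ^ j"
  shows "card (cell i k j l) \<le> 1"
proof -
  have "{n + 1 - i..n} \<union> {1..j} = {1..n}" using assms by auto
  then show ?thesis using card_cell_trace(1)[of i j k l] assms by auto
qed

definition tent_sum :: "nat \<Rightarrow> nat \<Rightarrow> nat \<Rightarrow> nat \<Rightarrow> real" where
  "tent_sum i k j l =
     (\<Sum>A\<in>Pow {1..n}. tent (2 ^ i * X.coord A - real k) * tent (2 ^ j * Y.coord A - real l))"

lemma tent_sum_cell:
  assumes "i \<le> n" "j \<le> n"
  shows "tent_sum i k j l = (\<Sum>A\<in>cell i k j l. tent (X.tail i A) * tent (Y.tail j A))"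
  unfolding tent_sum_def cell_def
  by (intro sum.mono_neutral_cong_right) (auto simp: X.tent_coord Y.tent_coord assms)

lemma tent_sum_nonneg: "0 \<le> tent_sum i k j l"
  unfolding tent_sum_def by (intro sum_nonneg mult_nonneg_nonneg tent_nonneg)

lemma tent_sum_le_card:
  assumes "i \<le> n" "j \<le> n"
  shows "tent_sum i k j l \<le> card (cell i k j l) / 4"
proof -
  have "tent_sum i k j l \<le> (\<Sum>A\<in>cell i k j l. (1 / 2) * (1 / 2))"
    unfolding tent_sum_cell[OF assms] by (intro sum_mono mult_mono tent_le tent_nonneg) auto
  then show ?thesis by simp
qed

text \<open>The box of level \<open>(i, j)\<close> leaves \<open>d = n - i - j \<ge> 2\<close> digits free. The highest and the lowest of their positions
are distinct, and each of them is the leading free digit of one coordinate and the last free digit, of weight \<open>2\<^sup>-\<^sup>d\<close>,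
of the other. Averaging over these two digits is \<open>four_corners\<close> with \<open>\<delta> = 2\<^sup>-\<^sup>d\<close>.\<close>
lemma tent_sum_near_mean:
  assumes ij: "i + j + 2 \<le> n" and "k < 2 ^ i" "l < 2 ^ j"
  shows "\<bar>tent_sum i k j l - 2 ^ (n - (i + j)) / 16\<bar> \<le> 1 / (4 * 2 ^ (n - (i + j)))"
proof -
  define d where "d = n - (i + j)"
  \<comment> \<open>The leading free digit of the first coordinate is at position p, that of the second one at position q.\<close>
  define p q where "p = n - i" and "q = j + 1"
  define T where "T A = tent (X.tail i A) * tent (Y.tail j A)" for A
  let ?B = "cell i k j l"
  have i: "i \<le> n" "j \<le> n" "i < n" "j < n" "i + 1 < n - j" "n - j \<le> n" "j + 1 < n - i" "n - i \<le> n"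
    using ij by auto
  have B: "toggle p A \<in> ?B" "toggle q A \<in> ?B" if "A \<in> ?B" for A
  proof -
    have "toggle r A \<in> ?B" if r: "r \<in> {1..n}" "r \<notin> reversal n ` {1..i}" "r \<notin> (\<lambda>i. i) ` {1..j}" for r
      using \<open>A \<in> ?B\<close> r X.head_toggle[OF r(2)] Y.head_toggle[OF r(3)]
      by (auto simp: cell_def) (auto simp: toggle_def split: if_splits)
    then show "toggle p A \<in> ?B" "toggle q A \<in> ?B"
      using ij unfolding reversal_image[OF i(1)] by (simp_all add: p_def q_def)
  qed
  have four: "\<bar>T A + T (toggle p A) + T (toggle q A) + T (toggle p (toggle q A)) - 1 / 4\<bar> \<le> (1 / 2 ^ d)\<^sup>2" for A
  proof -
    obtain R where R: "\<And>A'. (\<forall>r. reversal n r \<in> reversal n ` {i+1+1..n} - {reversal n (n - j)} \<longrightarrow> X.digit A' r = X.digit A r)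
        \<Longrightarrow> X.tail (i + 1) A' = R + real (X.digit A' (n - j)) * 2 ^ (i + 1) / 2 ^ (n - j)"
      using X.tail_isolate[OF i(5,6), of A] by blast
    obtain R' where R': "\<And>A'. (\<forall>r. r \<in> (\<lambda>i. i) ` {j+1+1..n} - {n - i} \<longrightarrow> Y.digit A' r = Y.digit A r)
        \<Longrightarrow> Y.tail (j + 1) A' = R' + real (Y.digit A' (n - i)) * 2 ^ (j + 1) / 2 ^ (n - i)"
      using Y.tail_isolate[OF i(7,8), of A] by blast
    have pw: "(2::real) ^ (i + 1) / 2 ^ (n - j) = 2 * (1 / 2 ^ d)" "(2::real) ^ (j + 1) / 2 ^ (n - i) = 2 * (1 / 2 ^ d)"
    proof -
      have "n - j = i + d" "n - i = j + d" using ij by (auto simp: d_def)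
      then show "(2::real) ^ (i + 1) / 2 ^ (n - j) = 2 * (1 / 2 ^ d)" "(2::real) ^ (j + 1) / 2 ^ (n - i) = 2 * (1 / 2 ^ d)"
        by (auto simp: power_add)
    qed
    let ?Q = "{A, toggle p A, toggle q A, toggle p (toggle q A)}"
    have X: "X.tail (i + 1) A' / 2 = R / 2 + real (X.digit A' (n - j)) * (1 / 2 ^ d)" if "A' \<in> ?Q" for A'
    proof -
      have "X.tail (i + 1) A' = R + real (X.digit A' (n - j)) * 2 ^ (i + 1) / 2 ^ (n - j)"
        using that ij by (intro R) (auto simp: X.digit_toggle p_def q_def reversal_def)
      then have "X.tail (i + 1) A' = R + real (X.digit A' (n - j)) * (2 * (1 / 2 ^ d))"
        unfolding pw(1)[symmetric] by (simp only: times_divide_eq_right)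
      then show ?thesis by (simp add: add_divide_distrib)
    qed
    have Y: "Y.tail (j + 1) A' / 2 = R' / 2 + real (Y.digit A' (n - i)) * (1 / 2 ^ d)" if "A' \<in> ?Q" for A'
    proof -
      have "Y.tail (j + 1) A' = R' + real (Y.digit A' (n - i)) * 2 ^ (j + 1) / 2 ^ (n - i)"
        using that ij by (intro R') (auto simp: Y.digit_toggle p_def q_def)
      then have "Y.tail (j + 1) A' = R' + real (Y.digit A' (n - i)) * (2 * (1 / 2 ^ d))"
        unfolding pw(2)[symmetric] by (simp only: times_divide_eq_right)
      then show ?thesis by (simp add: add_divide_distrib)
    qed
    have rel: "reversal n (i + 1) = p" "reversal n (n - j) = q" "j + 1 = q" "n - i = p" "p \<noteq> q"
      using ij by (auto simp: p_def q_def reversal_def)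
    define e f e' f' where "e = real (X.digit A (i + 1))" and "f = real (X.digit A (n - j))"
      and "e' = real (Y.digit A (j + 1))" and "f' = real (Y.digit A (n - i))"
    have cases01: "e = 0 \<or> e = 1" "f = 0 \<or> f = 1" "e' = 0 \<or> e' = 1" "f' = 0 \<or> f' = 1"
      unfolding e_def f_def e'_def f'_def using X.digit_01 Y.digit_01 by (metis of_nat_0 of_nat_1)+
    have flip: "real (1 - x) = 1 - real x" if "x = 0 \<or> x = 1" for x :: nat using that by auto
    have TL: "T A' = tent_branch (X.digit A' (i + 1)) (R / 2 + real (X.digit A' (n - j)) * (1 / 2 ^ d))
        * tent_branch (Y.digit A' (j + 1)) (R' / 2 + real (Y.digit A' (n - i)) * (1 / 2 ^ d))" if "A' \<in> ?Q" for A'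
      unfolding T_def X.tent_tail[OF i(3)] Y.tent_tail[OF i(4)] X[OF that] Y[OF that] ..
    have dig: "real (X.digit (toggle p A') (i + 1)) = 1 - real (X.digit A' (i + 1))"
        "X.digit (toggle q A') (i + 1) = X.digit A' (i + 1)"
        "X.digit (toggle p A') (n - j) = X.digit A' (n - j)"
        "real (X.digit (toggle q A') (n - j)) = 1 - real (X.digit A' (n - j))"
        "Y.digit (toggle p A') (j + 1) = Y.digit A' (j + 1)"
        "real (Y.digit (toggle q A') (j + 1)) = 1 - real (Y.digit A' (j + 1))"
        "real (Y.digit (toggle p A') (n - i)) = 1 - real (Y.digit A' (n - i))"
        "Y.digit (toggle q A') (n - i) = Y.digit A' (n - i)" for A'
      unfolding X.digit_toggle Y.digit_toggle rel
      by (simp_all only: rel(5) rel(5)[symmetric] if_True if_False refl flip X.digit_01 Y.digit_01)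
    have T1: "T A = tent_branch e (R / 2 + f * (1 / 2 ^ d)) * tent_branch e' (R' / 2 + f' * (1 / 2 ^ d))"
      unfolding e_def f_def e'_def f'_def by (rule TL) simp
    have T2: "T (toggle p A) = tent_branch (1 - e) (R / 2 + f * (1 / 2 ^ d)) * tent_branch e' (R' / 2 + (1 - f') * (1 / 2 ^ d))"
      using TL[of "toggle p A"] unfolding e_def f_def e'_def f'_def dig by (simp only: insert_iff simp_thms)
    have T3: "T (toggle q A) = tent_branch e (R / 2 + (1 - f) * (1 / 2 ^ d)) * tent_branch (1 - e') (R' / 2 + f' * (1 / 2 ^ d))"
      using TL[of "toggle q A"] unfolding e_def f_def e'_def f'_def dig by (simp only: insert_iff simp_thms)
    have T4: "T (toggle p (toggle q A)) = tent_branch (1 - e) (R / 2 + (1 - f) * (1 / 2 ^ d)) * tent_branch (1 - e') (R' / 2 + (1 - f') * (1 / 2 ^ d))"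
      using TL[of "toggle p (toggle q A)"] unfolding e_def f_def e'_def f'_def dig by (simp only: insert_iff simp_thms)
    show ?thesis
      unfolding T1 T2 T3 T4 using four_corners[OF cases01, of "R / 2" "1 / 2 ^ d" "R' / 2"] by (simp only: order_refl)
  qed
  have sp: "(\<Sum>A\<in>?B. T (toggle p A)) = sum T ?B"
    by (rule sum_toggle[of ?B p T]) (rule B(1))
  have sq: "(\<Sum>A\<in>?B. T (toggle q A)) = sum T ?B"
    by (rule sum_toggle[of ?B q T]) (rule B(2))
  have spq: "(\<Sum>A\<in>?B. T (toggle p (toggle q A))) = sum T ?B"
    unfolding sp[symmetric] by (rule sum_toggle[of ?B q "\<lambda>A. T (toggle p A)"]) (rule B(2))
  have cB: "real (card ?B) = 2 ^ d"
    using card_cell[of i j k l] assms by (simp add: d_def)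
  have "4 * (sum T ?B - 2 ^ d / 16)
      = (\<Sum>A\<in>?B. T A + T (toggle p A) + T (toggle q A) + T (toggle p (toggle q A)) - 1 / 4)"
    unfolding sum_subtractf sum.distrib sp sq spq by (simp add: cB)
  then have "\<bar>4 * (sum T ?B - 2 ^ d / 16)\<bar> \<le> (\<Sum>A\<in>?B. (1 / 2 ^ d)\<^sup>2)"
    by (simp only:) (rule order_trans[OF sum_abs sum_mono[OF four]])
  also have "\<dots> = 1 / 2 ^ d"
    by (simp add: cB power2_eq_square)
  finally have "4 * \<bar>sum T ?B - 2 ^ d / 16\<bar> \<le> 1 / 2 ^ d"
    by (simp only: abs_mult abs_numeral)
  then have "\<bar>sum T ?B - 2 ^ d / 16\<bar> \<le> 1 / (4 * 2 ^ d)"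
  proof -
    assume "4 * \<bar>sum T ?B - 2 ^ d / 16\<bar> \<le> 1 / 2 ^ d"
    moreover have "1 / (4 * 2 ^ d) = 1 / 2 ^ d / (4::real)" by simp
    moreover have "y \<le> z" if "4 * y \<le> x" "z = x / 4" for x y z :: real using that by simp
    ultimately show ?thesis by blast
  qed
  then show ?thesis
    unfolding tent_sum_cell[OF i(1,2)] T_def d_def .
qed

text \<open>The subtracted term is the integral of the product of tent functions over the square. For fewer than two free
digits there is no cancellation, but then a box contains at most two points.\<close>
lemma tent_mean_coarse:
  assumes "i + j \<le> n" "k < 2 ^ i" "l < 2 ^ j"
  shows "\<bar>tent_sum i k j l / 2 ^ n - 1 / (16 * 2 ^ (i + j))\<bar> \<le> 1 / 2 ^ n * gain (real i + real j - real n)"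
proof -
  define d where "d = n - (i + j)"
  have n: "n = i + j + d" using assms by (simp add: d_def)
  have g: "gain (real i + real j - real n) = 1 / 2 ^ d"
    using n by (simp add: gain_nonpos powr_minus_divide powr_realpow)
  have "\<bar>tent_sum i k j l - 2 ^ d / 16\<bar> \<le> 1 / 2 ^ d"
  proof (cases "d \<ge> 2")
    case True
    have "\<bar>tent_sum i k j l - 2 ^ d / 16\<bar> \<le> 1 / (4 * 2 ^ d)"
      unfolding d_def using True n by (intro tent_sum_near_mean assms) linarith
    also have "\<dots> \<le> 1 / 2 ^ d" by (intro divide_left_mono) auto
    finally show ?thesis .
  next
    case False
    have "tent_sum i k j l \<le> 2 ^ d / 4"
      using tent_sum_le_card[of i j k l] assms by (simp add: card_cell d_def)
    moreover have "d = 0 \<or> d = 1" using False by auto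
    ultimately show ?thesis using tent_sum_nonneg[of i k j l] 
      by (elim disjE) (auto simp: abs_if)
  qed
  then have "\<bar>(tent_sum i k j l - 2 ^ d / 16) / 2 ^ n\<bar> \<le> 1 / 2 ^ d / 2 ^ n"
    using divide_right_mono[of "\<bar>tent_sum i k j l - 2 ^ d / 16\<bar>" "1 / 2 ^ d" "2 ^ n"] by (simp add: abs_divide)
  also have "(tent_sum i k j l - 2 ^ d / 16) / 2 ^ n = tent_sum i k j l / 2 ^ n - 1 / (16 * 2 ^ (i + j))"
    using n by (simp add: diff_divide_distrib power_add)
  finally show ?thesis by (simp add: g mult.commute)
qed

text \<open>If \<open>i + j \<ge> n\<close> at most one point lies in the box.\<close>
lemma tent_mean_fine:
  assumes "n \<le> i + j" "k < 2 ^ i" "l < 2 ^ j"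
  shows "\<bar>tent_sum i k j l / 2 ^ n - 1 / (16 * 2 ^ (i + j))\<bar> \<le> 1 / 2 ^ n"
proof -
  have "tent_sum i k j l \<le> 1"
  proof (cases "i \<le> n \<and> j \<le> n")
    case True
    have "real (card (cell i k j l)) \<le> 1" using card_cell_le_1[of i j k l] assms True by simp
    then show ?thesis using tent_sum_le_card[of i j k l] True by linarith
  next
    case False
    then have "tent_sum i k j l = 0"
      unfolding tent_sum_def by (intro sum.neutral) (auto simp: X.tent_coord_fine Y.tent_coord_fine)
    then show ?thesis by simp
  qed
  then have "tent_sum i k j l / 2 ^ n \<le> 1 / 2 ^ n" by (simp add: divide_right_mono)
  moreover have "1 / (16 * 2 ^ (i + j)) \<le> (1 / 2 ^ n :: real)"
  proof (rule divide_left_mono)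
    have "(2::real) ^ n \<le> 2 ^ (i + j)" using assms by (intro power_increasing) auto
    then show "(2::real) ^ n \<le> 16 * 2 ^ (i + j)"
      using zero_le_power[of "2::real" "i + j"] by linarith
  qed auto
  moreover have "0 \<le> tent_sum i k j l / 2 ^ n" "0 \<le> (1 / (16 * 2 ^ (i + j)) :: real)"
    using tent_sum_nonneg by auto
  ultimately show ?thesis by linarith
qed

end

section \<open>Haar expansion of the indicator of an interval\<close>

text \<open>Index \<open>0\<close> is the constant function on the unit interval and index \<open>Suc j\<close> is the \<open>j\<close>-th dyadic level, so
that the functions of index \<open>i\<close> are numbered by \<open>m < 2 ^ (i - 1)\<close>; the truncated subtraction is correct for
\<open>i = 0\<close>. The intervals are closed on the right, because the indicator of \<open>x < t\<close> is left-continuous in \<open>t\<close>; then the expansions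
hold at every point of \<open>(0, 1]\<close>.\<close>
primrec haar :: "nat \<Rightarrow> nat \<Rightarrow> real \<Rightarrow> real" where
  "haar 0 = (\<lambda>m. indicator {0<..1})"
| "haar (Suc j) = (\<lambda>m t. indicator {real m / 2 ^ j<..(real m + 1 / 2) / 2 ^ j} t
      - indicator {(real m + 1 / 2) / 2 ^ j<..(real m + 1) / 2 ^ j} t)"

text \<open>The Haar coefficients of the indicator of \<open>x < t\<close> as a function of \<open>t\<close>; the tents arise
as primitives of the Haar functions.\<close>
primrec haar_coeff :: "nat \<Rightarrow> nat \<Rightarrow> real \<Rightarrow> real" where
  "haar_coeff 0 = (\<lambda>m x. 1 - x)"
| "haar_coeff (Suc j) = (\<lambda>m x. - tent (2 ^ j * x - real m))"

text \<open>The integral of \<open>haar_coeff i m x\<close> over \<open>x\<close> in the unit interval.\<close>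
primrec haar_mean :: "nat \<Rightarrow> real" where
  "haar_mean 0 = 1 / 2"
| "haar_mean (Suc j) = - (1 / (4 * 2 ^ j))"

text \<open>Only the Haar function of the dyadic interval around \<open>t\<close> contributes.\<close>
lemma sum_haar_level:
  fixes t :: real and j :: nat
  assumes t: "0 < t" "t \<le> 1"
  defines "k \<equiv> nat (\<lceil>2 ^ j * t\<rceil> - 1)"
  shows "real k < 2 ^ j * t" "2 ^ j * t \<le> real k + 1" "real k = of_int \<lceil>2 ^ j * t\<rceil> - 1"
    "(\<Sum>m<2 ^ j. f m * haar (Suc j) m t) = f k * (if 2 ^ j * t \<le> real k + 1 / 2 then 1 else - 1)"
proof -
  have pos: "0 < \<lceil>2 ^ j * t\<rceil>" using t by simp
  then show k: "real k = of_int \<lceil>2 ^ j * t\<rceil> - 1" by (simp add: k_def)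
  show k1: "real k < 2 ^ j * t" "2 ^ j * t \<le> real k + 1" unfolding k by linarith+
  have "2 ^ j * t \<le> 2 ^ j * 1" using t by (intro mult_left_mono) auto
  then have "real k < 2 ^ j" using k1(1) by linarith
  then have "real k < real (2 ^ j)" by simp
  then have kj: "k < 2 ^ j" by (simp only: of_nat_less_iff)
  have haar: "haar (Suc j) m t = (if m = k then (if 2 ^ j * t \<le> real k + 1 / 2 then 1 else - 1) else 0)" for m
  proof -
    have *: "haar (Suc j) m t = of_bool (real m < 2 ^ j * t \<and> 2 ^ j * t \<le> real m + 1 / 2)
        - of_bool (real m + 1 / 2 < 2 ^ j * t \<and> 2 ^ j * t \<le> real m + 1)"
      by (auto simp: indicator_def field_simps)
    show ?thesis
    proof (cases "m = k")
      case True
      then show ?thesis unfolding * using k1 by auto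
    next
      case False
      then consider "real m + 1 \<le> real k" | "real k + 1 \<le> real m" by linarith
      then show ?thesis unfolding * using k1 False by cases auto
    qed
  qed
  show "(\<Sum>m<2 ^ j. f m * haar (Suc j) m t) = f k * (if 2 ^ j * t \<le> real k + 1 / 2 then 1 else - 1)"
    unfolding haar using kj by (simp add: if_distrib[of "\<lambda>x. f _ * x"] sum.delta' cong: if_cong)
qed

lemma ceiling_double:
  fixes v :: real
  assumes "real k < v" "v \<le> real k + 1"
  shows "\<lceil>2 * v\<rceil> = (if v \<le> real k + 1 / 2 then 2 * int k + 1 else 2 * int k + 2)"
  using assms by (auto simp: ceiling_eq_iff)

lemma ramp_halving:
  fixes k y :: real
  shows "max 0 (min 1 (k + 1 - y)) + - tent (y - k) * (if b then 1 else - 1)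
    = max 0 (min 1 ((if b then 2 * k + 1 else 2 * k + 2) - 2 * y))"
  by (auto simp: tent_def max_def min_def)

text \<open>The partial sums are the conditional expectations of the indicator of \<open>x < t\<close> on the dyadic intervals of level
\<open>L\<close>: the fraction of the interval around \<open>t\<close> that lies to the right of \<open>x\<close>. One more level
splits the interval in two halves (\<open>ramp_halving\<close>).\<close>
lemma haar_expansion_ramp:
  fixes t x :: real
  assumes t: "0 < t" "t \<le> 1" and x: "0 \<le> x" "x \<le> 1"
  shows "(\<Sum>i\<le>L. \<Sum>m<2 ^ (i - 1). haar_coeff i m x * haar i m t)
    = max 0 (min 1 (of_int \<lceil>2 ^ L * t\<rceil> - 2 ^ L * x))"
proof (induction L)
  case 0
  have "\<lceil>t\<rceil> = 1" using t by (simp add: ceiling_eq_iff)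
  then show ?case using t x by (simp add: indicator_def)
next
  case (Suc L)
  define k where "k = nat (\<lceil>2 ^ L * t\<rceil> - 1)"
  note k = sum_haar_level[OF t, where j = L, folded k_def]
  have c: "of_int \<lceil>2 ^ Suc L * t\<rceil> = (if 2 ^ L * t \<le> real k + 1 / 2 then 2 * real k + 1 else 2 * real k + 2)"
    using ceiling_double[OF k(1,2)] by (simp add: mult.assoc)
  have c0: "of_int \<lceil>2 ^ L * t\<rceil> = real k + 1" using k(3) by simp
  show ?case
    unfolding sum.atMost_Suc Suc.IH diff_Suc_1 k(4) c c0 haar_coeff.simps
    unfolding power_Suc mult.assoc by (rule ramp_halving)
qed

text \<open>No dyadic interval of level \<open>L\<close> contains a point of the grid of mesh \<open>2\<^sup>-\<^sup>L\<close> in its interior, so the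
conditional expectation is the indicator itself.\<close>
lemma haar_expansion_indicator:
  fixes t x :: real
  assumes t: "0 < t" "t \<le> 1" and x: "0 \<le> x" "x \<le> 1" "2 ^ L * x = of_int N"
  shows "(\<Sum>i\<le>L. \<Sum>m<2 ^ (i - 1). haar_coeff i m x * haar i m t) = of_bool (x < t)"
proof -
  have "x < t \<longleftrightarrow> 2 ^ L * x < 2 ^ L * t" by simp
  also have "\<dots> \<longleftrightarrow> N < \<lceil>2 ^ L * t\<rceil>" by (simp add: x less_ceiling_iff)
  finally show ?thesis unfolding haar_expansion_ramp[OF t x(1,2)] x(3) by auto
qed

text \<open>The partial sum is the midpoint of the dyadic interval of level \<open>L\<close> around \<open>t\<close>.\<close>
lemma haar_expansion_mean:
  fixes t :: real
  assumes t: "0 < t" "t \<le> 1"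
  shows "(\<Sum>i\<le>L. \<Sum>m<2 ^ (i - 1). haar_mean i * haar i m t) = (of_int \<lceil>2 ^ L * t\<rceil> - 1 / 2) / 2 ^ L"
proof (induction L)
  case 0
  have "\<lceil>t\<rceil> = 1" using t by (simp add: ceiling_eq_iff)
  then show ?case using t by (simp add: indicator_def)
next
  case (Suc L)
  define k where "k = nat (\<lceil>2 ^ L * t\<rceil> - 1)"
  note k = sum_haar_level[OF t, where j = L, folded k_def]
  have c: "of_int \<lceil>2 ^ Suc L * t\<rceil> = (if 2 ^ L * t \<le> real k + 1 / 2 then 2 * real k + 1 else 2 * real k + 2)"
    using ceiling_double[OF k(1,2)] by (simp add: mult.assoc)
  have c0: "of_int \<lceil>2 ^ L * t\<rceil> = real k + 1" using k(3) by simp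
  show ?case
    unfolding sum.atMost_Suc Suc.IH diff_Suc_1 k(4) c c0 haar_mean.simps
    by (simp add: field_simps)
qed

lemma haar_expansion_mean_error:
  fixes t :: real
  assumes t: "0 < t" "t \<le> 1"
  shows "\<bar>t - (\<Sum>i\<le>L. \<Sum>m<2 ^ (i - 1). haar_mean i * haar i m t)\<bar> \<le> 1 / 2 ^ L"
    and "\<bar>\<Sum>i\<le>L. \<Sum>m<2 ^ (i - 1). haar_mean i * haar i m t\<bar> \<le> 1"
proof -
  let ?c = "of_int \<lceil>2 ^ L * t\<rceil> :: real"
  have "t - (?c - 1 / 2) / 2 ^ L = (2 ^ L * t - (?c - 1 / 2)) / 2 ^ L"
    by (simp add: field_simps)
  moreover have "\<bar>2 ^ L * t - (?c - 1 / 2)\<bar> \<le> 1" by linarith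
  ultimately show "\<bar>t - (\<Sum>i\<le>L. \<Sum>m<2 ^ (i - 1). haar_mean i * haar i m t)\<bar> \<le> 1 / 2 ^ L"
    unfolding haar_expansion_mean[OF t] by (simp add: divide_right_mono)
  have "2 ^ L * t \<le> 2 ^ L * 1" using t by (intro mult_left_mono) auto
  then have "2 ^ L * t \<le> of_int (2 ^ L)" by (simp only: of_int_power of_int_numeral mult_1_right)
  then have "\<lceil>2 ^ L * t\<rceil> \<le> 2 ^ L" by (simp only: ceiling_le_iff)
  then have "?c \<le> of_int (2 ^ L)" by (simp only: of_int_le_iff)
  moreover have "0 < \<lceil>2 ^ L * t\<rceil>" using t by simp
  then have "1 \<le> ?c" by linarith
  ultimately have "\<bar>?c - 1 / 2\<bar> \<le> 2 ^ L"
    unfolding of_int_power of_int_numeral by linarith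
  then show "\<bar>\<Sum>i\<le>L. \<Sum>m<2 ^ (i - 1). haar_mean i * haar i m t\<bar> \<le> 1"
    unfolding haar_expansion_mean[OF t] by (simp add: divide_le_eq)
qed

section \<open>Haar coefficients of the discrepancy\<close>

text \<open>The optional reflection in one coordinate; the symmetrization uses all four combinations.\<close>
definition flip :: "bool \<Rightarrow> real \<Rightarrow> real" where
  "flip b x = (if b then 1 - x else x)"

lemma tent_flip:
  assumes "m < 2 ^ j"
  shows "tent (2 ^ j * flip b x - real m) = tent (2 ^ j * x - real (if b then 2 ^ j - 1 - m else m))"
proof -
  have "tent (1 - u) = tent u" for u by (simp add: tent_def min.commute)
  from this[of "2 ^ j * x - real (2 ^ j - 1 - m)"] show ?thesis
    using assms by (simp add: flip_def of_nat_diff algebra_simps)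
qed

lemma sum_tent_shifts_le:
  fixes M :: nat
  shows "(\<Sum>m<M. tent (u - real m)) \<le> 1 / 2"
proof -
  have "tent (u - real m) \<le> (if m = nat \<lfloor>u\<rfloor> then 1 / 2 else 0)" for m
  proof (cases "m = nat \<lfloor>u\<rfloor>")
    case False
    have "u - real m \<le> 0 \<or> 1 \<le> u - real m" using False by linarith
    then show ?thesis using False by (simp add: tent_eq_0)
  next
    case True
    then have "(if m = nat \<lfloor>u\<rfloor> then 1 / 2 else 0 :: real) = 1 / 2" by (rule if_P)
    with tent_le[of "u - real m"] show ?thesis by (rule ord_le_eq_trans[OF _ sym])
  qed
  then have "(\<Sum>m<M. tent (u - real m)) \<le> (\<Sum>m<M. if m = nat \<lfloor>u\<rfloor> then 1 / 2 else 0)"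
    by (rule sum_mono)
  also have "\<dots> \<le> 1 / 2" by simp
  finally show ?thesis .
qed

lemma sum_over_bool: "(\<Sum>b\<in>UNIV. f b) = f False + f True"
  by (simp add: UNIV_bool add.commute)

lemma (in digit_system) flip_coord_grid:
  assumes "n \<le> L"
  shows "\<exists>N. 2 ^ L * flip b (coord A) = of_int N" "0 \<le> flip b (coord A)" "flip b (coord A) \<le> 1"
proof -
  have "(2::real) ^ L = 2 ^ (L - n) * 2 ^ n" using assms by (simp flip: power_add)
  moreover have "2 ^ n * coord A = real (head n A)" using coord_split[of n A] by (simp add: tail_def)
  ultimately have "2 ^ L * coord A = 2 ^ (L - n) * real (head n A)" by (simp only: mult.assoc)
  then have "2 ^ L * flip b (coord A) = of_int (if b then 2 ^ L - 2 ^ (L - n) * int (head n A) else 2 ^ (L - n) * int (head n A))"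
    by (simp add: flip_def right_diff_distrib)
  then show "\<exists>N. 2 ^ L * flip b (coord A) = of_int N" by blast
  have "coord A = tail 0 A" by (simp add: coord_def tail_def)
  then show "0 \<le> flip b (coord A)" "flip b (coord A) \<le> 1"
    using tail_nonneg[of 0 A] tail_less_1[of 0 A] by (auto simp: flip_def)
qed

lemma (in digit_system) sum_flip_tent:
  assumes "m < 2 ^ j"
  shows "(\<Sum>A\<in>Pow {1..n}. \<Sum>b\<in>UNIV. tent (2 ^ j * flip b (coord A) - real m)) = (if j < n then 2 ^ (n - j) / 2 else 0)"
proof -
  have m': "2 ^ j - 1 - m < 2 ^ j" using assms by simp
  show ?thesis
    unfolding tent_flip[OF assms] sum_over_bool sum.distrib if_True if_False
      sum_tent_coord[OF assms] sum_tent_coord[OF m'] by simp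
qed

context hammersley_digits
begin

text \<open>The mean over the symmetrized point set, indexed by the digits and the two reflections.\<close>
definition average :: "(nat set \<Rightarrow> bool \<Rightarrow> bool \<Rightarrow> real) \<Rightarrow> real" where
  "average F = (\<Sum>A\<in>Pow {1..n}. \<Sum>a\<in>UNIV. \<Sum>b\<in>UNIV. F A a b) / 2 ^ (n + 2)"

lemma average_sum: "average (\<lambda>A a b. \<Sum>i\<in>I. F i A a b) = (\<Sum>i\<in>I. average (F i))"
proof (cases "finite I")
  case True
  then show ?thesis
    by (induction I rule: finite_induct)
      (simp_all add: average_def sum.distrib sum_over_bool add_divide_distrib)
qed (simp add: average_def)

lemma average_mult_right: "average (\<lambda>A a b. F A a b * c) = average F * c"
  by (simp add: average_def sum_distrib_right)

lemma hammersley_eq: "hammersley n \<sigma> = (\<lambda>A. (X.coord A, Y.coord A)) ` Pow {1..n}"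
proof (intro equalityI subsetI)
  fix z assume "z \<in> hammersley n \<sigma>"
  then obtain u :: "nat \<Rightarrow> real" where u: "\<forall>i\<in>{1..n}. u i \<in> {0, 1}"
    and z: "z = (\<Sum>i=1..n. u (n + 1 - i) / 2 ^ i, \<Sum>i=1..n. (if \<sigma> i then u i else 1 - u i) / 2 ^ i)"
    by (auto simp: hammersley_def)
  define A where "A = {i\<in>{1..n}. u i = 1}"
  have ui: "u i = of_bool (i \<in> A)" if "i \<in> {1..n}" for i
    using u that by (auto simp: A_def)
  have "z = (X.coord A, Y.coord A)"
    unfolding z X.coord_def Y.coord_def prod.inject
  proof (intro conjI sum.cong refl)
    fix i assume i: "i \<in> {1..n}"
    then have "n + 1 - i \<in> {1..n}" by auto
    from ui[OF this] show "u (n + 1 - i) / 2 ^ i = real (X.digit A i) / 2 ^ i"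
      by (simp add: X.digit_def reversal_def)
    show "(if \<sigma> i then u i else 1 - u i) / 2 ^ i = real (Y.digit A i) / 2 ^ i"
      using ui[OF i] by (simp add: Y.digit_def)
  qed
  moreover have "A \<in> Pow {1..n}" by (auto simp: A_def)
  ultimately show "z \<in> (\<lambda>A. (X.coord A, Y.coord A)) ` Pow {1..n}" by blast
next
  fix z assume "z \<in> (\<lambda>A. (X.coord A, Y.coord A)) ` Pow {1..n}"
  then obtain A where z: "z = (X.coord A, Y.coord A)" by blast
  show "z \<in> hammersley n \<sigma>"
    unfolding z X.coord_def Y.coord_def hammersley_def
    by (auto intro!: exI[of _ "\<lambda>i. of_bool (i \<in> A)"] sum.cong simp: X.digit_def Y.digit_def reversal_def)
qed

lemma sum_hammersley: "(\<Sum>z\<in>hammersley n \<sigma>. F z) = (\<Sum>A\<in>Pow {1..n}. F (X.coord A, Y.coord A))"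
proof -
  have "inj_on (\<lambda>A. (X.coord A, Y.coord A)) (Pow {1..n})"
    using finite_card_hammersley(2)[of n \<sigma>] unfolding hammersley_eq
    by (intro eq_card_imp_inj_on) (simp_all add: card_Pow)
  then show ?thesis by (simp add: hammersley_eq sum.reindex)
qed

lemma sum_symmetrized:
  fixes F :: "real \<times> real \<Rightarrow> real"
  shows "(\<Sum>z\<in>#symmetrized_hammersley n \<sigma>. F z)
    = (\<Sum>A\<in>Pow {1..n}. \<Sum>a\<in>UNIV. \<Sum>b\<in>UNIV. F (flip a (X.coord A), flip b (Y.coord A)))"
proof -
  have "(\<Sum>z\<in>#symmetrized_hammersley n \<sigma>. F z) =
      (\<Sum>z\<in>hammersley n \<sigma>. F z) + (\<Sum>z\<in>hammersley n \<sigma>. F (fst z, 1 - snd z))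
      + (\<Sum>z\<in>hammersley n \<sigma>. F (1 - fst z, snd z)) + (\<Sum>z\<in>hammersley n \<sigma>. F (1 - fst z, 1 - snd z))"
    by (simp add: symmetrized_hammersley_def Let_def sum_unfold_sum_mset multiset.map_comp o_def case_prod_unfold)
  then show ?thesis
    by (simp add: sum_hammersley UNIV_bool flip_def sum.distrib)
qed

text \<open>The Haar coefficients of the discrepancy function.\<close>
definition coeff :: "nat \<Rightarrow> nat \<Rightarrow> nat \<Rightarrow> nat \<Rightarrow> real" where
  "coeff i m j l = average (\<lambda>A a b. haar_coeff i m (flip a (X.coord A)) * haar_coeff j l (flip b (Y.coord A)))
    - haar_mean i * haar_mean j"

definition haar_sum :: "nat \<Rightarrow> real \<times> real \<Rightarrow> real" where
  "haar_sum L t = (\<Sum>i\<le>L. \<Sum>j\<le>L. \<Sum>m<2 ^ (i - 1). \<Sum>l<2 ^ (j - 1).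
      coeff i m j l * (haar i m (fst t) * haar j l (snd t)))"

lemma sum_product4:
  fixes f :: "nat \<Rightarrow> nat \<Rightarrow> real"
  shows "(\<Sum>i\<le>L. \<Sum>m<2 ^ (i - 1). f i m) * (\<Sum>j\<le>L. \<Sum>l<2 ^ (j - 1). g j l)
    = (\<Sum>i\<le>L. \<Sum>j\<le>L. \<Sum>m<2 ^ (i - 1). \<Sum>l<(2 ^ (j - 1) :: nat). f i m * g j l)"
  unfolding sum_product ..

text \<open>Since the counting part is expanded exactly, the error stems from the product of the two
coordinates alone.\<close>
lemma discrepancy_haar_sum:
  assumes L: "n \<le> L" and s: "0 < s" "s \<le> 1" and t: "0 < t" "t \<le> 1"
  shows "\<bar>local_discrepancy (symmetrized_hammersley n \<sigma>) (s, t) - haar_sum L (s, t)\<bar> \<le> 2 / 2 ^ L"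
proof -
  define S where "S f x = (\<Sum>i\<le>L. \<Sum>m<2 ^ (i - 1). f i m * haar i m x)" for f :: "nat \<Rightarrow> nat \<Rightarrow> real" and x
  define \<mu> where "\<mu> = (\<lambda>i (m::nat). haar_mean i)"
  define hx hy where "hx A a = (\<lambda>i m. haar_coeff i m (flip a (X.coord A)))"
    and "hy A b = (\<lambda>i m. haar_coeff i m (flip b (Y.coord A)))" for A a b
  have prod: "S f s * S g t = (\<Sum>i\<le>L. \<Sum>j\<le>L. \<Sum>m<2 ^ (i - 1). \<Sum>l<2 ^ (j - 1).
      f i m * g j l * (haar i m s * haar j l t))" for f g
    unfolding S_def sum_product4 by (simp add: mult_ac)
  have ind: "indicator ({0..<s} \<times> {0..<t}) (flip a (X.coord A), flip b (Y.coord A)) = S (hx A a) s * S (hy A b) t" for A a b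
  proof -
    obtain N where "2 ^ L * flip a (X.coord A) = of_int N" using X.flip_coord_grid(1)[OF L] by blast
    then have 1: "S (hx A a) s = of_bool (flip a (X.coord A) < s)"
      unfolding S_def hx_def by (intro haar_expansion_indicator s X.flip_coord_grid[OF L])
    obtain N where "2 ^ L * flip b (Y.coord A) = of_int N" using Y.flip_coord_grid(1)[OF L] by blast
    then have 2: "S (hy A b) t = of_bool (flip b (Y.coord A) < t)"
      unfolding S_def hy_def by (intro haar_expansion_indicator t Y.flip_coord_grid[OF L])
    show ?thesis unfolding 1 2 using X.flip_coord_grid(2)[OF L, of a A] Y.flip_coord_grid(2)[OF L, of b A]
      by (auto simp: indicator_def)
  qed
  have "local_discrepancy (symmetrized_hammersley n \<sigma>) (s, t)
      = average (\<lambda>A a b. S (hx A a) s * S (hy A b) t) - s * t"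
    unfolding local_discrepancy_def sum_symmetrized size_symmetrized_hammersley fst_conv snd_conv ind average_def by simp
  also have "average (\<lambda>A a b. S (hx A a) s * S (hy A b) t)
      = (\<Sum>i\<le>L. \<Sum>j\<le>L. \<Sum>m<2 ^ (i - 1). \<Sum>l<2 ^ (j - 1).
          average (\<lambda>A a b. hx A a i m * hy A b j l) * (haar i m s * haar j l t))"
    unfolding prod average_sum average_mult_right ..
  also have "\<dots> = haar_sum L (s, t) + S \<mu> s * S \<mu> t"
    unfolding prod haar_sum_def coeff_def fst_conv snd_conv
    by (simp add: hx_def hy_def \<mu>_def sum.distrib[symmetric] left_diff_distrib)
  finally have "local_discrepancy (symmetrized_hammersley n \<sigma>) (s, t) - haar_sum L (s, t)
      = - ((s - S \<mu> s) * t + S \<mu> s * (t - S \<mu> t))"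
    by (simp add: algebra_simps)
  also have "\<bar>\<dots>\<bar> \<le> \<bar>s - S \<mu> s\<bar> * \<bar>t\<bar> + \<bar>S \<mu> s\<bar> * \<bar>t - S \<mu> t\<bar>"
    by (simp add: abs_mult[symmetric])
  also have "\<dots> \<le> 1 / 2 ^ L * 1 + 1 * (1 / 2 ^ L)"
    unfolding S_def \<mu>_def using t
    by (intro add_mono mult_mono haar_expansion_mean_error s t) auto
  finally show ?thesis by simp
qed

lemma sum_flip_coeff_0: "(\<Sum>a\<in>UNIV. haar_coeff 0 m (flip a x)) = 1"
  by (simp add: UNIV_bool flip_def)

text \<open>This coefficient is the integral of the discrepancy function. It vanishes as \<open>x\<close> and \<open>1 - x\<close> occur
equally often.\<close>
lemma coeff_00: "coeff 0 m 0 l = 0"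
proof -
  have "(\<Sum>a\<in>UNIV. \<Sum>b\<in>UNIV. haar_coeff 0 m (flip a x) * haar_coeff 0 l (flip b y)) = 1" for x y
    unfolding sum_product[symmetric] sum_flip_coeff_0 by simp
  then show ?thesis unfolding coeff_def average_def by (simp add: card_Pow del: haar_coeff.simps)
qed

text \<open>The reflection of one coordinate turns the constant factor into its mean, and for the other coordinate the
tents of level below \<open>n\<close> are integrated exactly (\<open>sum_tent_coord\<close>). At finer levels the tents vanish at all points, and only the
coefficient of the product of the coordinates remains.\<close>
lemma coeff_0_Suc:
  assumes "l < 2 ^ j"
  shows "coeff 0 m (Suc j) l = (if j < n then 0 else 1 / (8 * 2 ^ j))"
    "coeff (Suc j) l 0 m = (if j < n then 0 else 1 / (8 * 2 ^ j))"
proof -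
  have v: "- (if j < n then 2 ^ (n - j) / 2 else 0) / 2 ^ (n + 2) + 1 / (8 * 2 ^ j) = (if j < n then 0 else 1 / (8 * 2 ^ j) :: real)"
    by (simp add: power_diff field_simps)
  have "(\<Sum>A\<in>Pow {1..n}. \<Sum>a\<in>UNIV. \<Sum>b\<in>UNIV.
      haar_coeff 0 m (flip a (X.coord A)) * haar_coeff (Suc j) l (flip b (Y.coord A)))
     = - (\<Sum>A\<in>Pow {1..n}. \<Sum>b\<in>UNIV. tent (2 ^ j * flip b (Y.coord A) - real l))"
    unfolding sum_product[symmetric] sum_flip_coeff_0 by (simp add: sum_negf)
  then show "coeff 0 m (Suc j) l = (if j < n then 0 else 1 / (8 * 2 ^ j))"
    unfolding coeff_def average_def Y.sum_flip_tent[OF assms] using v by simp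
  have "(\<Sum>A\<in>Pow {1..n}. \<Sum>a\<in>UNIV. \<Sum>b\<in>UNIV.
      haar_coeff (Suc j) l (flip a (X.coord A)) * haar_coeff 0 m (flip b (Y.coord A)))
     = - (\<Sum>A\<in>Pow {1..n}. \<Sum>b\<in>UNIV. tent (2 ^ j * flip b (X.coord A) - real l))"
    unfolding sum_product[symmetric] sum_flip_coeff_0 by (simp add: sum_negf)
  then show "coeff (Suc j) l 0 m = (if j < n then 0 else 1 / (8 * 2 ^ j))"
    unfolding coeff_def average_def X.sum_flip_tent[OF assms] using v by simp
qed

text \<open>A reflection permutes the tents of one level, so the symmetrized set inherits the estimates of
the Hammersley type point set.\<close>
lemma coeff_Suc_Suc:
  assumes "m < 2 ^ i" "l < 2 ^ j"
  shows "coeff (Suc i) m (Suc j) l = (\<Sum>a\<in>UNIV. \<Sum>b\<in>UNIV.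
    tent_sum i (if a then 2 ^ i - 1 - m else m) j (if b then 2 ^ j - 1 - l else l) / 2 ^ n - 1 / (16 * 2 ^ (i + j))) / 4"
proof -
  have "(\<Sum>A\<in>Pow {1..n}. \<Sum>a\<in>UNIV. \<Sum>b\<in>UNIV.
      haar_coeff (Suc i) m (flip a (X.coord A)) * haar_coeff (Suc j) l (flip b (Y.coord A)))
    = (\<Sum>a\<in>UNIV. \<Sum>b\<in>UNIV. tent_sum i (if a then 2 ^ i - 1 - m else m) j (if b then 2 ^ j - 1 - l else l))"
    unfolding tent_sum_def haar_coeff.simps tent_flip[OF assms(1)] tent_flip[OF assms(2)]
    by (simp only: sum_over_bool sum.distrib if_True if_False mult_minus_left mult_minus_right minus_minus)
  then show ?thesis
    unfolding coeff_def average_def by (simp add: UNIV_bool power_add field_simps)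
qed

lemma abs_coeff_Suc_Suc_le:
  assumes "m < 2 ^ i" "l < 2 ^ j"
    and "\<And>k r. k < 2 ^ i \<Longrightarrow> r < 2 ^ j \<Longrightarrow> \<bar>tent_sum i k j r / 2 ^ n - 1 / (16 * 2 ^ (i + j))\<bar> \<le> B"
  shows "\<bar>coeff (Suc i) m (Suc j) l\<bar> \<le> B"
proof -
  let ?f = "\<lambda>a b. tent_sum i (if a then 2 ^ i - 1 - m else m) j (if b then 2 ^ j - 1 - l else l) / 2 ^ n - 1 / (16 * 2 ^ (i + j))"
  have f: "\<bar>?f a b\<bar> \<le> B" for a b using assms(1,2) by (intro assms(3)) auto
  have "\<bar>\<Sum>a\<in>UNIV. \<Sum>b\<in>UNIV. ?f a b\<bar> \<le> (\<Sum>a\<in>(UNIV :: bool set). \<Sum>b\<in>(UNIV :: bool set). B)"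
    by (rule order_trans[OF sum_abs sum_mono[OF order_trans[OF sum_abs sum_mono[OF f]]]])
  then show ?thesis unfolding coeff_Suc_Suc[OF assms(1,2)] by (simp add: UNIV_bool)
qed

lemma abs_coeff_le:
  assumes m: "m < 2 ^ (i - 1)" and l: "l < 2 ^ (j - 1)"
  shows "\<bar>coeff i m j l\<bar> \<le> gain (real i + real j - real n) / 2 ^ n"
proof (cases i; cases j)
  assume "i = 0" "j = 0"
  then show ?thesis by (simp add: coeff_00 gain_nonneg)
next
  fix j' assume ij: "i = 0" "j = Suc j'"
  show ?thesis
  proof (cases "j' < n")
    case False
    have "(2::real) ^ n \<le> 2 ^ j'" using False by (intro power_increasing) auto
    then have "(2::real) ^ n \<le> 8 * 2 ^ j'" using zero_le_power[of "2::real" j'] by linarith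
    then show ?thesis using False l ij by (simp add: coeff_0_Suc gain_nonneg_arg frac_le)
  qed (use l ij in \<open>simp add: coeff_0_Suc gain_nonneg\<close>)
next
  fix i' assume ij: "i = Suc i'" "j = 0"
  show ?thesis
  proof (cases "i' < n")
    case False
    have "(2::real) ^ n \<le> 2 ^ i'" using False by (intro power_increasing) auto
    then have "(2::real) ^ n \<le> 8 * 2 ^ i'" using zero_le_power[of "2::real" i'] by linarith
    then show ?thesis using False m ij by (simp add: coeff_0_Suc gain_nonneg_arg frac_le)
  qed (use m ij in \<open>simp add: coeff_0_Suc gain_nonneg\<close>)
next
  fix i' j' assume ij: "i = Suc i'" "j = Suc j'"
  have "\<bar>tent_sum i' k j' r / 2 ^ n - 1 / (16 * 2 ^ (i' + j'))\<bar> \<le> gain (real i + real j - real n) / 2 ^ n"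
    if "k < 2 ^ i'" "r < 2 ^ j'" for k r
  proof (cases "i' + j' \<le> n")
    case True
    have "\<bar>tent_sum i' k j' r / 2 ^ n - 1 / (16 * 2 ^ (i' + j'))\<bar> \<le> 1 / 2 ^ n * gain (real i' + real j' - real n)"
      using True that by (rule tent_mean_coarse)
    also have "\<dots> \<le> 1 / 2 ^ n * gain (real i + real j - real n)"
      using ij by (intro mult_left_mono gain_mono) auto
    finally show ?thesis by simp
  next
    case False
    then show ?thesis using tent_mean_fine[of i' j' k r] that ij by (simp add: gain_nonneg_arg)
  qed
  with m l show ?thesis unfolding ij by (intro abs_coeff_Suc_Suc_le) auto
qed

lemma sum_tent_sum_le: "(\<Sum>m<2 ^ i. \<Sum>l<2 ^ j. tent_sum i m j l) \<le> 2 ^ n / 4"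
proof -
  have "(\<Sum>m<2 ^ i. \<Sum>l<2 ^ j. tent_sum i m j l)
      = (\<Sum>A\<in>Pow {1..n}. (\<Sum>m<2 ^ i. tent (2 ^ i * X.coord A - real m)) * (\<Sum>l<2 ^ j. tent (2 ^ j * Y.coord A - real l)))"
  proof -
    have "(\<Sum>l<2 ^ j. tent_sum i m j l) = (\<Sum>A\<in>Pow {1..n}. \<Sum>l<2 ^ j.
        tent (2 ^ i * X.coord A - real m) * tent (2 ^ j * Y.coord A - real l))" for m
      unfolding tent_sum_def by (rule sum.swap)
    then show ?thesis unfolding sum_product by (simp only: sum.swap[of _ "{..<2 ^ i}" "Pow {1..n}"])
  qed
  also have "\<dots> \<le> (\<Sum>A\<in>Pow {1..n}. 1 / 2 * (1 / 2))"
    by (intro sum_mono mult_mono sum_tent_shifts_le sum_nonneg tent_nonneg) auto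
  finally show ?thesis by (simp add: card_Pow)
qed

lemma sum_reflect:
  fixes f :: "nat \<Rightarrow> real"
  shows "(\<Sum>m<M. f (if a then M - 1 - m else m)) = (\<Sum>m<M. f m)"
proof (cases a)
  case True
  then show ?thesis
    by (simp, intro sum.reindex_bij_witness[of _ "\<lambda>m. M - 1 - m" "\<lambda>m. M - 1 - m"]) auto
qed simp

text \<open>For \<open>i' + j' \<le> n\<close> the bound of the single coefficient is multiplied by their number \<open>2 ^ (i' + j')\<close>, which even yields the
square of the gain. Otherwise there is no cancellation to use: the tents of one level add up to at most \<open>1/2\<close>
at each point.\<close>
lemma sum_abs_coeff_le:
  "(\<Sum>m<2 ^ (i - 1). \<Sum>l<2 ^ (j - 1). \<bar>coeff i m j l\<bar>) \<le> gain (real i + real j - real n)"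
proof (cases i; cases j)
  assume "i = 0" "j = 0"
  then show ?thesis by (simp add: coeff_00 gain_nonneg)
next
  fix j' assume ij: "i = 0" "j = Suc j'"
  show ?thesis
    by (cases "j' < n") (simp_all add: ij coeff_0_Suc gain_nonneg gain_nonneg_arg)
next
  fix i' assume ij: "i = Suc i'" "j = 0"
  show ?thesis
    by (cases "i' < n") (simp_all add: ij coeff_0_Suc gain_nonneg gain_nonneg_arg)
next
  fix i' j' assume ij: "i = Suc i'" "j = Suc j'"
  show ?thesis
  proof (cases "i' + j' \<le> n")
    case True
    define g where "g = gain (real i' + real j' - real n)"
    have "\<bar>coeff i m j l\<bar> \<le> g / 2 ^ n" if "m \<in> {..<2 ^ i'}" "l \<in> {..<2 ^ j'}" for m l
      unfolding ij using that tent_mean_coarse[OF True] by (intro abs_coeff_Suc_Suc_le) (auto simp: g_def)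
    then have "(\<Sum>m<2 ^ i'. \<Sum>l<2 ^ j'. \<bar>coeff i m j l\<bar>) \<le> (\<Sum>m<(2::nat) ^ i'. \<Sum>l<(2::nat) ^ j'. g / 2 ^ n)"
      by (intro sum_mono)
    also have "\<dots> = g * (2 ^ (i' + j') / 2 ^ n)" by (simp add: power_add)
    also have "2 ^ (i' + j') / 2 ^ n = g"
      using True by (simp add: g_def gain_nonpos powr_diff powr_add powr_realpow power_add)
    also have "g * g \<le> 1 * gain (real i + real j - real n)"
      unfolding g_def by (intro mult_mono gain_le_1 gain_mono gain_nonneg) (auto simp: ij)
    finally show ?thesis by (simp add: ij)
  next
    case False
    let ?t = "\<lambda>m l. tent_sum i' m j' l / 2 ^ n"
    let ?\<rho> = "\<lambda>i a m. if a then 2 ^ i - 1 - m else m :: nat"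
    have "\<bar>coeff i m j l\<bar> \<le> (\<Sum>a\<in>UNIV. \<Sum>b\<in>UNIV. ?t (?\<rho> i' a m) (?\<rho> j' b l)) / 4 + 1 / (16 * 2 ^ (i' + j'))"
      if "m \<in> {..<2 ^ i'}" "l \<in> {..<2 ^ j'}" for m l
    proof -
      define T where "T = (\<Sum>a\<in>UNIV. \<Sum>b\<in>UNIV. ?t (?\<rho> i' a m) (?\<rho> j' b l))"
      have "coeff i m j l = T / 4 - 1 / (16 * 2 ^ (i' + j'))"
        using that unfolding ij T_def by (simp add: coeff_Suc_Suc sum_subtractf)
      moreover have "0 \<le> T" unfolding T_def by (intro sum_nonneg divide_nonneg_nonneg tent_sum_nonneg) simp
      ultimately show ?thesis unfolding T_def[symmetric] by (simp add: abs_le_iff)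
    qed
    then have "(\<Sum>m<2 ^ i'. \<Sum>l<2 ^ j'. \<bar>coeff i m j l\<bar>)
        \<le> (\<Sum>m<2 ^ i'. \<Sum>l<2 ^ j'. (\<Sum>a\<in>UNIV. \<Sum>b\<in>UNIV. ?t (?\<rho> i' a m) (?\<rho> j' b l)) / 4 + 1 / (16 * 2 ^ (i' + j')))"
      by (intro sum_mono)
    also have "\<dots> = (\<Sum>m<2 ^ i'. \<Sum>l<2 ^ j'. \<Sum>a\<in>UNIV. \<Sum>b\<in>UNIV. ?t (?\<rho> i' a m) (?\<rho> j' b l)) / 4 + 1 / 16"
      by (simp add: sum.distrib sum_divide_distrib[symmetric] power_add)
    also have "(\<Sum>m<2 ^ i'. \<Sum>l<2 ^ j'. \<Sum>a\<in>UNIV. \<Sum>b\<in>UNIV. ?t (?\<rho> i' a m) (?\<rho> j' b l))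
        = (\<Sum>a\<in>UNIV. \<Sum>b\<in>UNIV. \<Sum>m<2 ^ i'. \<Sum>l<2 ^ j'. ?t (?\<rho> i' a m) (?\<rho> j' b l))"
      by (simp only: UNIV_bool sum.insert finite.intros sum.empty) (simp add: sum.distrib)
    also have "\<dots> = (\<Sum>a\<in>(UNIV :: bool set). \<Sum>b\<in>(UNIV :: bool set). \<Sum>m<2 ^ i'. \<Sum>l<2 ^ j'. ?t m l)"
      unfolding sum_reflect[where f = "\<lambda>l. ?t _ l"] sum_reflect[where f = "\<lambda>m. \<Sum>l<_. ?t m l"] ..
    also have "\<dots> = 4 * ((\<Sum>m<2 ^ i'. \<Sum>l<2 ^ j'. tent_sum i' m j' l) / 2 ^ n)"
      by (simp add: UNIV_bool sum_divide_distrib)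
    also have "\<dots> \<le> 4 * (1 / 4)"
      using sum_tent_sum_le[where i = i' and j = j'] by (simp add: divide_le_eq)
    finally show ?thesis using False by (simp add: ij gain_nonneg_arg)
  qed
qed

end

section \<open>Convolutions and inverse Fourier kernels\<close>

definition L1 :: "('a::euclidean_space \<Rightarrow> complex) \<Rightarrow> ennreal" where
  "L1 f = (\<integral>\<^sup>+x. ennreal (norm (f x)) \<partial>lborel)"

definition conv :: "('a::euclidean_space \<Rightarrow> complex) \<Rightarrow> ('a \<Rightarrow> complex) \<Rightarrow> 'a \<Rightarrow> complex" where
  "conv \<kappa> f x = (LINT y|lborel. \<kappa> (x - y) * f y)"

lemma measurable_conv [measurable]:
  fixes \<kappa> f :: "'a::euclidean_space \<Rightarrow> complex"
  assumes [measurable]: "\<kappa> \<in> borel_measurable borel" "f \<in> borel_measurable borel"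
  shows "conv \<kappa> f \<in> borel_measurable borel"
  unfolding conv_def[abs_def] by measurable

lemma nn_integral_shift:
  fixes f :: "'a::euclidean_space \<Rightarrow> ennreal"
  assumes [measurable]: "f \<in> borel_measurable borel"
  shows "(\<integral>\<^sup>+x. f (x - y) \<partial>lborel) = (\<integral>\<^sup>+x. f x \<partial>lborel)"
proof -
  have "(\<integral>\<^sup>+x. f x \<partial>lborel) = (\<integral>\<^sup>+x. f x \<partial>distr lborel borel ((+) (- y)))"
    by (simp only: lborel_distr_plus)
  also have "\<dots> = (\<integral>\<^sup>+x. f (x - y) \<partial>lborel)"
    by (subst nn_integral_distr) (simp_all add: algebra_simps)
  finally show ?thesis ..
qed

lemma nn_integral_reflect:
  fixes f :: "real \<Rightarrow> ennreal"
  assumes [measurable]: "f \<in> borel_measurable borel"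
  shows "(\<integral>\<^sup>+y. f (x - y) \<partial>lborel) = (\<integral>\<^sup>+y. f y \<partial>lborel)"
  using nn_integral_real_affine[of f "-1" x] by simp

lemma norm_conv_le:
  "ennreal (norm (conv \<kappa> f x)) \<le> (\<integral>\<^sup>+y. ennreal (norm (\<kappa> (x - y))) * ennreal (norm (f y)) \<partial>lborel)"
proof (cases "integrable lborel (\<lambda>y. \<kappa> (x - y) * f y)")
  case True
  then show ?thesis
    unfolding conv_def by (rule order_trans[OF integral_norm_bound_ennreal])
      (simp add: norm_mult ennreal_mult)
next
  case False
  then show ?thesis by (simp add: conv_def not_integrable_integral_eq)
qed

text \<open>Young's inequality, by exchanging the integrals.\<close>
lemma L1_conv_le:
  fixes \<kappa> f :: "'a::euclidean_space \<Rightarrow> complex"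
  assumes [measurable]: "\<kappa> \<in> borel_measurable borel" "f \<in> borel_measurable borel"
  shows "L1 (conv \<kappa> f) \<le> L1 \<kappa> * L1 f"
proof -
  have "L1 (conv \<kappa> f) \<le> (\<integral>\<^sup>+x. \<integral>\<^sup>+y. ennreal (norm (\<kappa> (x - y))) * ennreal (norm (f y)) \<partial>lborel \<partial>lborel)"
    unfolding L1_def by (intro nn_integral_mono norm_conv_le)
  also have "\<dots> = (\<integral>\<^sup>+y. \<integral>\<^sup>+x. ennreal (norm (\<kappa> (x - y))) * ennreal (norm (f y)) \<partial>lborel \<partial>lborel)"
    by (rule lborel_pair.Fubini') measurable
  also have "\<dots> = (\<integral>\<^sup>+y. L1 \<kappa> * ennreal (norm (f y)) \<partial>lborel)"
    by (subst nn_integral_multc) (simp_all add: nn_integral_shift[where f = "\<lambda>x. ennreal (norm (\<kappa> x))"] L1_def)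
  also have "\<dots> = L1 \<kappa> * L1 f"
    unfolding L1_def by (rule nn_integral_cmult) measurable
  finally show ?thesis .
qed

lemma L1_diff_le:
  assumes [measurable]: "f \<in> borel_measurable borel" "g \<in> borel_measurable borel"
  shows "L1 (\<lambda>x. f x - g x) \<le> L1 f + L1 g"
proof -
  have "L1 (\<lambda>x. f x - g x) \<le> (\<integral>\<^sup>+x. ennreal (norm (f x)) + ennreal (norm (g x)) \<partial>lborel)"
    unfolding L1_def by (intro nn_integral_mono) (simp add: norm_triangle_ineq4 ennreal_plus[symmetric] del: ennreal_plus)
  also have "\<dots> = L1 f + L1 g" unfolding L1_def by (rule nn_integral_add) measurable
  finally show ?thesis .
qed

lemma L1_shift:
  assumes [measurable]: "f \<in> borel_measurable borel"
  shows "L1 (\<lambda>x. f (x - y)) = L1 f"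
  unfolding L1_def by (rule nn_integral_shift[where f = "\<lambda>x. ennreal (norm (f x))"]) measurable

lemma integrable_iff_L1: "f \<in> borel_measurable borel \<Longrightarrow> integrable lborel f \<longleftrightarrow> L1 f < \<infinity>"
  by (simp add: integrable_iff_bounded L1_def)

lemma L1_indicator: "A \<in> sets borel \<Longrightarrow> L1 (indicator A) = emeasure lborel A"
proof -
  assume "A \<in> sets borel"
  moreover have "ennreal (norm (indicator A x :: complex)) = indicator A x" for x by (simp add: indicator_def)
  ultimately show ?thesis by (simp add: L1_def)
qed

lemma integrable_tensor:
  fixes f :: "'a::euclidean_space \<Rightarrow> complex" and g :: "'b::euclidean_space \<Rightarrow> complex"
  assumes f: "integrable lborel f" and g: "integrable lborel g"
    and h[measurable]: "h \<in> borel_measurable (borel \<Otimes>\<^sub>M borel)" and hB: "\<And>z. norm (h z) \<le> B"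
  shows "integrable (lborel \<Otimes>\<^sub>M lborel) (\<lambda>(x, y). f x * g y * (h (x, y) :: complex))"
proof (rule integrableI_bounded)
  have [measurable]: "f \<in> borel_measurable borel" "g \<in> borel_measurable borel"
    using f g by (simp_all add: borel_measurable_integrable[of lborel, simplified])
  show "(\<lambda>(x, y). f x * g y * h (x, y)) \<in> borel_measurable (lborel \<Otimes>\<^sub>M lborel)" by measurable
  have "(\<integral>\<^sup>+z. ennreal (norm (case z of (x, y) \<Rightarrow> f x * g y * h (x, y))) \<partial>(lborel \<Otimes>\<^sub>M lborel))
      \<le> (\<integral>\<^sup>+z. ennreal (norm (f (fst z))) * ennreal (norm (g (snd z))) * ennreal B \<partial>(lborel \<Otimes>\<^sub>M lborel))"
  proof (intro nn_integral_mono)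
    fix z :: "'a \<times> 'b"
    have "norm (f (fst z)) * norm (g (snd z)) * norm (h z) \<le> norm (f (fst z)) * norm (g (snd z)) * B"
      by (intro mult_left_mono hB) auto
    moreover have "0 \<le> B" using hB[of z] norm_ge_zero order_trans by blast
    ultimately show "ennreal (norm (case z of (x, y) \<Rightarrow> f x * g y * h (x, y)))
        \<le> ennreal (norm (f (fst z))) * ennreal (norm (g (snd z))) * ennreal B"
      by (auto simp: norm_mult ennreal_mult[symmetric] split: prod.split)
  qed
  also have "\<dots> = (\<integral>\<^sup>+x. \<integral>\<^sup>+y. ennreal (norm (f x)) * ennreal (norm (g y)) * ennreal B \<partial>lborel \<partial>lborel)"
    by (subst lborel.nn_integral_fst[symmetric]) simp_all
  also have "\<dots> = L1 f * L1 g * ennreal B"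
    unfolding L1_def by (simp add: nn_integral_cmult nn_integral_multc)
  also have "\<dots> < \<infinity>"
    using f g by (simp add: integrable_iff_L1[symmetric] ennreal_mult_less_top integrable_iff_L1[THEN iffD1, simplified])
  finally show "(\<integral>\<^sup>+z. ennreal (norm (case z of (x, y) \<Rightarrow> f x * g y * h (x, y))) \<partial>(lborel \<Otimes>\<^sub>M lborel)) < \<infinity>" .
qed

text \<open>The convolution kernel of the Fourier multiplier \<open>\<eta>\<close> on the line. In one dimension it is \<open>1 / sqrt (2 pi)\<close> times
the inverse Fourier transform with the symmetric normalization.\<close>
definition kern :: "(real \<Rightarrow> complex) \<Rightarrow> real \<Rightarrow> complex" where
  "kern \<eta> x = of_real (1 / (2 * pi)) * (LINT \<xi>|lborel. \<eta> \<xi> * cis (x * \<xi>))"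

definition bounded_support :: "(real \<Rightarrow> complex) \<Rightarrow> bool" where
  "bounded_support \<eta> \<longleftrightarrow> (\<exists>R. \<forall>x. \<bar>x\<bar> > R \<longrightarrow> \<eta> x = 0)"

text \<open>Two derivatives suffice for an integrable kernel; multiples of the cutoff function by \<open>\<xi>\<close> and \<open>1 / \<xi>\<close> are
easily seen to be in this class.\<close>
definition C2_bump :: "(real \<Rightarrow> complex) \<Rightarrow> bool" where
  "C2_bump \<eta> \<longleftrightarrow> bounded_support \<eta> \<and> (\<exists>\<eta>' \<eta>''. (\<forall>x. (\<eta> has_vector_derivative \<eta>' x) (at x)) \<and>
     (\<forall>x. (\<eta>' has_vector_derivative \<eta>'' x) (at x)) \<and> continuous_on UNIV \<eta>'')"

lemma C2_bumpI:
  assumes "\<And>x. (\<eta> has_vector_derivative \<eta>' x) (at x)" "\<And>x. (\<eta>' has_vector_derivative \<eta>'' x) (at x)"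
    "continuous_on UNIV \<eta>''" "bounded_support \<eta>"
  shows "C2_bump \<eta>"
  using assms unfolding C2_bump_def by blast

lemma continuous_on_has_vector_derivative:
  "(\<And>x. (\<eta> has_vector_derivative \<eta>' x) (at x)) \<Longrightarrow> continuous_on UNIV \<eta>"
  using has_vector_derivative_continuous continuous_at_imp_continuous_on by blast

lemma C2_bump_continuous: "C2_bump \<eta> \<Longrightarrow> continuous_on UNIV \<eta>"
  unfolding C2_bump_def using continuous_on_has_vector_derivative by blast

lemma continuous_measurable [measurable_dest]: "continuous_on UNIV (\<eta> :: real \<Rightarrow> complex) \<Longrightarrow> \<eta> \<in> borel_measurable borel"
  by (rule borel_measurable_continuous_onI)

lemma integrable_bump:
  assumes "continuous_on UNIV \<eta>" "bounded_support \<eta>"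
  shows "integrable lborel \<eta>"
proof -
  obtain R where R: "\<And>x. \<bar>x\<bar> > R \<Longrightarrow> \<eta> x = 0" using assms(2) by (auto simp: bounded_support_def)
  have "integrable lborel (\<lambda>x. indicator {-R..R} x *\<^sub>R \<eta> x)"
    by (rule borel_integrable_compact) (auto intro: continuous_on_subset[OF assms(1)])
  also have "(\<lambda>x. indicator {-R..R} x *\<^sub>R \<eta> x) = \<eta>"
    using R by (auto simp: indicator_def fun_eq_iff)
  finally show ?thesis .
qed

lemma integrable_bump_cis:
  assumes "continuous_on UNIV \<eta>" "bounded_support \<eta>"
  shows "integrable lborel (\<lambda>\<xi>. \<eta> \<xi> * cis (x * \<xi>))"
proof (rule integrable_bump)
  show "continuous_on UNIV (\<lambda>\<xi>. \<eta> \<xi> * cis (x * \<xi>))"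
    by (intro continuous_intros assms)
  show "bounded_support (\<lambda>\<xi>. \<eta> \<xi> * cis (x * \<xi>))"
    using assms(2) unfolding bounded_support_def by (metis mult_zero_left)
qed

lemma bounded_support_derivative:
  assumes "bounded_support \<eta>" "\<And>x. (\<eta> has_vector_derivative \<eta>' x) (at x)"
  shows "bounded_support \<eta>'"
proof -
  obtain R where R: "\<And>x. \<bar>x\<bar> > R \<Longrightarrow> \<eta> x = 0" using assms(1) by (auto simp: bounded_support_def)
  have "\<eta>' x = 0" if x: "\<bar>x\<bar> > R" for x
  proof -
    have "open {x::real. \<bar>x\<bar> > R}" by (intro open_Collect_less continuous_intros)
    then have "(\<eta> has_vector_derivative 0) (at x)"
      using x R by (intro has_vector_derivative_transform_within_open[OF has_vector_derivative_const, of _ _ 0]) auto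
    then show ?thesis using assms(2) vector_derivative_unique_at by blast
  qed
  then show ?thesis by (auto simp: bounded_support_def)
qed

lemma cis_has_vector_derivative:
  "((\<lambda>\<xi>. cis (x * \<xi>)) has_vector_derivative (\<i> * of_real x * cis (x * \<xi>))) (at \<xi> within S)"
  unfolding has_vector_derivative_def
  by (auto intro!: derivative_eq_intros simp: scaleR_conv_of_real)

lemma measurable_kern [measurable]:
  assumes [measurable]: "\<eta> \<in> borel_measurable borel"
  shows "kern \<eta> \<in> borel_measurable borel"
proof -
  have [measurable]: "cis \<in> borel_measurable borel"
    by (intro borel_measurable_continuous_onI continuous_intros)
  show ?thesis unfolding kern_def[abs_def] by measurable
qed

text \<open>Integration by parts; there are no boundary terms.\<close>
lemma kern_derivative:
  assumes d: "\<And>x. (\<eta> has_vector_derivative \<eta>' x) (at x)" and c: "continuous_on UNIV \<eta>'"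
    and s: "bounded_support \<eta>"
  shows "kern \<eta>' x = - (\<i> * of_real x) * kern \<eta> x"
proof -
  have s': "bounded_support \<eta>'" by (rule bounded_support_derivative[OF s d])
  have c0: "continuous_on UNIV \<eta>" using d by (rule continuous_on_has_vector_derivative)
  obtain R where R: "\<And>x. \<bar>x\<bar> > R \<Longrightarrow> \<eta> x = 0" using s by (auto simp: bounded_support_def)
  obtain R' where R': "\<And>x. \<bar>x\<bar> > R' \<Longrightarrow> \<eta>' x = 0" using s' by (auto simp: bounded_support_def)
  \<comment> \<open>Beyond this radius the function and its derivative vanish, including the endpoints.\<close>
  define M where "M = max 0 (max R R') + 1"
  define F where "F = (\<lambda>\<xi>. \<eta> \<xi> * cis (x * \<xi>))"
  define F' where "F' = (\<lambda>\<xi>. \<eta>' \<xi> * cis (x * \<xi>) + \<i> * of_real x * (\<eta> \<xi> * cis (x * \<xi>)))"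
  have "(\<integral>\<xi>. indicator {-M..M} \<xi> *\<^sub>R F' \<xi> \<partial>lborel) = F M - F (- M)"
  proof (rule integral_FTC_Icc)
    show "- M \<le> M" by (simp add: M_def)
    show "continuous_on {-M..M} F'"
      unfolding F'_def by (intro continuous_intros continuous_on_subset[OF c] continuous_on_subset[OF c0]) auto
    fix \<xi>
    have "(\<eta> has_vector_derivative \<eta>' \<xi>) (at \<xi> within {-M..M})"
      using d by (rule has_vector_derivative_at_within)
    from has_vector_derivative_mult[OF this cis_has_vector_derivative[of x \<xi>]]
    show "(F has_vector_derivative F' \<xi>) (at \<xi> within {-M..M})"
      unfolding F_def F'_def by (simp add: algebra_simps)
  qed
  moreover have "F M = 0" "F (- M) = 0" using R by (auto simp: F_def M_def)
  moreover have "(\<lambda>\<xi>. indicator {-M..M} \<xi> *\<^sub>R F' \<xi>) = F'"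
    using R R' by (auto simp: F'_def M_def indicator_def fun_eq_iff)
  ultimately have "(\<integral>\<xi>. F' \<xi> \<partial>lborel) = 0" by simp
  also have "(\<integral>\<xi>. F' \<xi> \<partial>lborel) = (\<integral>\<xi>. \<eta>' \<xi> * cis (x * \<xi>) \<partial>lborel) + \<i> * of_real x * (\<integral>\<xi>. \<eta> \<xi> * cis (x * \<xi>) \<partial>lborel)"
    unfolding F'_def
    by (subst Bochner_Integration.integral_add) (auto intro!: integrable_bump_cis c c0 s s' integrable_mult_right)
  finally show ?thesis
    by (simp add: kern_def add_eq_0_iff2 algebra_simps)
qed

lemma norm_kern_le:
  assumes "integrable lborel \<eta>"
  shows "norm (kern \<eta> x) \<le> (\<integral>\<xi>. norm (\<eta> \<xi>) \<partial>lborel)"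
proof -
  have "norm (kern \<eta> x) = 1 / (2 * pi) * norm (LINT \<xi>|lborel. \<eta> \<xi> * cis (x * \<xi>))"
    by (simp add: kern_def norm_mult norm_divide)
  also have "\<dots> \<le> 1 * norm (LINT \<xi>|lborel. \<eta> \<xi> * cis (x * \<xi>))"
    using pi_gt3 by (intro mult_right_mono) auto
  also have "\<dots> \<le> (\<integral>\<xi>. norm (\<eta> \<xi> * cis (x * \<xi>)) \<partial>lborel)"
    unfolding mult_1 by (rule integral_norm_bound)
  also have "\<dots> = (\<integral>\<xi>. norm (\<eta> \<xi>) \<partial>lborel)" by (simp add: norm_mult)
  finally show ?thesis .
qed

lemma integrable_inverse_square: "integrable lborel (\<lambda>x::real. inverse (1 + x\<^sup>2))"
  using integrable_inverse_1_plus_square by (simp add: set_integrable_def einterval_def)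

text \<open>Integrating by parts twice shows that \<open>(1 + x\<^sup>2) kern \<eta> x\<close> is bounded.\<close>
lemma kern_L1_finite:
  assumes "C2_bump \<eta>"
  shows "L1 (kern \<eta>) < \<infinity>"
proof -
  obtain \<eta>' \<eta>'' where d: "\<And>x. (\<eta> has_vector_derivative \<eta>' x) (at x)"
    and d': "\<And>x. (\<eta>' has_vector_derivative \<eta>'' x) (at x)" and c: "continuous_on UNIV \<eta>''" and s: "bounded_support \<eta>"
    using assms unfolding C2_bump_def by blast
  have c': "continuous_on UNIV \<eta>'" using d' by (rule continuous_on_has_vector_derivative)
  have s': "bounded_support \<eta>'" by (rule bounded_support_derivative[OF s d])
  have s'': "bounded_support \<eta>''" by (rule bounded_support_derivative[OF s' d'])
  have [measurable]: "\<eta> \<in> borel_measurable borel"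
    using C2_bump_continuous[OF assms] by (rule continuous_measurable)
  define B where "B = (\<integral>\<xi>. norm (\<eta> \<xi>) \<partial>lborel) + (\<integral>\<xi>. norm (\<eta>'' \<xi>) \<partial>lborel)"
  have "norm (kern \<eta> x) \<le> B * inverse (1 + x\<^sup>2)" for x
  proof -
    have "kern \<eta>'' x = - of_real (x\<^sup>2) * kern \<eta> x"
      unfolding kern_derivative[OF d' c s'] kern_derivative[OF d c' s]
      by (simp add: power2_eq_square algebra_simps)
    then have "x\<^sup>2 * norm (kern \<eta> x) = norm (kern \<eta>'' x)" by (simp add: norm_mult norm_power)
    also have "\<dots> \<le> (\<integral>\<xi>. norm (\<eta>'' \<xi>) \<partial>lborel)" by (intro norm_kern_le integrable_bump c s'')
    finally have "(1 + x\<^sup>2) * norm (kern \<eta> x) \<le> B"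
      using norm_kern_le[OF integrable_bump[OF C2_bump_continuous[OF assms] s], of x]
      by (simp add: B_def distrib_right)
    moreover have "0 < 1 + x\<^sup>2" by (simp add: add_pos_nonneg)
    ultimately show ?thesis by (simp add: field_simps)
  qed
  then have "integrable lborel (kern \<eta>)"
    by (intro Bochner_Integration.integrable_bound[OF integrable_mult_right[OF integrable_inverse_square, of B]])
      (auto intro: order_trans[OF _ abs_ge_self])
  then show ?thesis by (simp add: integrable_iff_L1)
qed

text \<open>The multiplier \<open>\<i> \<xi>\<close> is differentiation, so this is the fundamental theorem of calculus
for \<open>kern \<eta>\<close>; exchanging the integrals over \<open>y\<close> and \<open>\<xi>\<close> reduces it to the
exponential function. It is used in two ways: for a primitive of a kernel and for its derivative.\<close>
lemma conv_kern_interval: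
  assumes c: "continuous_on UNIV \<eta>" and s: "bounded_support \<eta>" and ab: "a \<le> b"
  shows "conv (kern (\<lambda>\<xi>. \<i> * of_real \<xi> * \<eta> \<xi>)) (indicator {a<..b}) x = kern \<eta> (x - a) - kern \<eta> (x - b)"
proof -
  define g where "g \<xi> = \<i> * of_real \<xi> * \<eta> \<xi>" for \<xi>
  have cg: "continuous_on UNIV g" unfolding g_def by (intro continuous_intros c)
  have sg: "bounded_support g"
    using s unfolding bounded_support_def g_def by (metis mult_zero_right)
  have inner: "(LINT y|lborel. indicator {a<..b} y * g \<xi> * cis ((x - y) * \<xi>)) = \<eta> \<xi> * cis ((x - a) * \<xi>) - \<eta> \<xi> * cis ((x - b) * \<xi>)" for \<xi>
  proof -
    have "(LINT y|lborel. indicator {a<..b} y * g \<xi> * cis ((x - y) * \<xi>))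
        = (\<integral>y. indicator {a..b} y *\<^sub>R (g \<xi> * cis ((x - y) * \<xi>)) \<partial>lborel)"
    proof (rule integral_cong_AE)
      have [measurable]: "cis \<in> borel_measurable borel"
        by (intro borel_measurable_continuous_onI continuous_intros)
      show "(\<lambda>y. indicator {a<..b} y * g \<xi> * cis ((x - y) * \<xi>)) \<in> borel_measurable lborel"
        "(\<lambda>y. indicator {a..b} y *\<^sub>R (g \<xi> * cis ((x - y) * \<xi>))) \<in> borel_measurable lborel" by measurable
      show "AE y in lborel. indicator {a<..b} y * g \<xi> * cis ((x - y) * \<xi>) = indicator {a..b} y *\<^sub>R (g \<xi> * cis ((x - y) * \<xi>))"
        using AE_lborel_singleton[of a] by eventually_elim (auto simp: indicator_def)
    qed
    also have "\<dots> = - \<eta> \<xi> * cis ((x - b) * \<xi>) - - \<eta> \<xi> * cis ((x - a) * \<xi>)"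
    proof (rule integral_FTC_Icc[OF ab])
      show "continuous_on {a..b} (\<lambda>y. g \<xi> * cis ((x - y) * \<xi>))" by (intro continuous_intros)
      fix y
      show "((\<lambda>y. - \<eta> \<xi> * cis ((x - y) * \<xi>)) has_vector_derivative g \<xi> * cis ((x - y) * \<xi>)) (at y within {a..b})"
        unfolding has_vector_derivative_def g_def
        by (auto intro!: derivative_eq_intros simp: scaleR_conv_of_real)
    qed
    finally show ?thesis by simp
  qed
  have "conv (kern g) (indicator {a<..b}) x
      = of_real (1 / (2 * pi)) * (LINT y|lborel. LINT \<xi>|lborel. indicator {a<..b} y * g \<xi> * cis ((x - y) * \<xi>))"
    unfolding conv_def kern_def by (simp add: mult_ac flip: integral_mult_right_zero)
  also have "(LINT y|lborel. LINT \<xi>|lborel. indicator {a<..b} y * g \<xi> * cis ((x - y) * \<xi>))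
      = (LINT \<xi>|lborel. LINT y|lborel. indicator {a<..b} y * g \<xi> * cis ((x - y) * \<xi>))"
  proof (rule lborel_pair.Fubini_integral[symmetric])
    have [measurable]: "cis \<in> borel_measurable borel"
      by (intro borel_measurable_continuous_onI continuous_intros)
    have "integrable lborel (indicator {a<..b} :: real \<Rightarrow> complex)"
      using ab by (simp add: integrable_iff_L1 L1_indicator)
    from integrable_tensor[OF this integrable_bump[OF cg sg], of "\<lambda>z. cis ((x - fst z) * snd z)" 1]
    show "integrable (lborel \<Otimes>\<^sub>M lborel) (\<lambda>(y, \<xi>). indicator {a<..b} y * g \<xi> * cis ((x - y) * \<xi>))"
      by simp
  qed
  also have "\<dots> = (LINT \<xi>|lborel. \<eta> \<xi> * cis ((x - a) * \<xi>)) - (LINT \<xi>|lborel. \<eta> \<xi> * cis ((x - b) * \<xi>))"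
    unfolding inner by (intro Bochner_Integration.integral_diff integrable_bump_cis c s)
  finally have "conv (kern g) (indicator {a<..b}) x = kern \<eta> (x - a) - kern \<eta> (x - b)"
    by (simp add: kern_def[of \<eta>] right_diff_distrib)
  moreover have "g = (\<lambda>\<xi>. \<i> * of_real \<xi> * \<eta> \<xi>)" by (simp add: g_def fun_eq_iff)
  ultimately show ?thesis by simp
qed

lemma kern_dilate:
  assumes "c > 0"
  shows "kern (\<lambda>\<xi>. \<eta> (\<xi> / c)) x = of_real c * kern \<eta> (c * x)"
  using lborel_integral_real_affine[of c "\<lambda>\<xi>. \<eta> (\<xi> / c) * cis (x * \<xi>)" 0] assms
  by (simp add: kern_def scaleR_conv_of_real mult_ac)

text \<open>Dilating the multiplier rescales the kernel and keeps its \<open>L\<^sub>1\<close> norm. All dyadic kernels are therefore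
controlled by finitely many fixed functions.\<close>
lemma L1_kern_dilate:
  assumes "c > 0" and [measurable]: "\<eta> \<in> borel_measurable borel"
  shows "L1 (kern (\<lambda>\<xi>. \<eta> (\<xi> / c))) = L1 (kern \<eta>)"
proof -
  have "L1 (kern \<eta>) = ennreal c * (\<integral>\<^sup>+x. ennreal (norm (kern \<eta> (c * x))) \<partial>lborel)"
    unfolding L1_def using nn_integral_real_affine[of "\<lambda>x. ennreal (norm (kern \<eta> x))" c 0] assms by simp
  also have "\<dots> = (\<integral>\<^sup>+x. ennreal c * ennreal (norm (kern \<eta> (c * x))) \<partial>lborel)"
    by (rule nn_integral_cmult[symmetric]) measurable
  also have "\<dots> = L1 (kern (\<lambda>\<xi>. \<eta> (\<xi> / c)))"
    unfolding L1_def kern_dilate[OF assms(1)] using assms(1)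
    by (simp add: norm_mult ennreal_mult)
  finally show ?thesis ..
qed

lemma kern_scale: "kern (\<lambda>\<xi>. c * \<eta> \<xi>) x = c * kern \<eta> x"
  by (simp add: kern_def mult.assoc)

lemma L1_scale:
  assumes [measurable]: "f \<in> borel_measurable borel"
  shows "L1 (\<lambda>x. c * f x) = ennreal (norm c) * L1 f"
  unfolding L1_def by (simp add: norm_mult ennreal_mult nn_integral_cmult)

section \<open>Kernels of the dyadic resolution of unity\<close>

text \<open>The factor \<open>\<omega>\<close> may be singular where \<open>\<eta>\<close> vanishes on an open set; this admits \<open>1 / \<xi>\<close>.\<close>
lemma C2_bump_mult:
  fixes \<eta> \<omega> :: "real \<Rightarrow> complex"
  assumes "C2_bump \<eta>"
    and "open U" "open V" "U \<union> V = UNIV" and zero: "\<And>x. x \<in> V \<Longrightarrow> \<eta> x = 0"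
    and w: "\<And>x. x \<in> U \<Longrightarrow> (\<omega> has_vector_derivative \<omega>' x) (at x)"
    and w': "\<And>x. x \<in> U \<Longrightarrow> (\<omega>' has_vector_derivative \<omega>'' x) (at x)"
    and w'': "continuous_on U \<omega>''"
  shows "C2_bump (\<lambda>x. \<eta> x * \<omega> x)"
proof -
  obtain \<eta>' \<eta>'' where d: "\<And>x. (\<eta> has_vector_derivative \<eta>' x) (at x)"
    and d': "\<And>x. (\<eta>' has_vector_derivative \<eta>'' x) (at x)" and c: "continuous_on UNIV \<eta>''" and s: "bounded_support \<eta>"
    using assms(1) unfolding C2_bump_def by blast
  have vanish: "f' x = 0" if "\<And>x. (f has_vector_derivative f' x) (at x)" "\<And>x. x \<in> V \<Longrightarrow> f x = 0" "x \<in> V"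
    for f f' :: "real \<Rightarrow> complex" and x
  proof -
    have "(f has_vector_derivative 0) (at x)"
      by (rule has_vector_derivative_transform_within_open[OF has_vector_derivative_const \<open>open V\<close> that(3)])
        (simp add: that(2))
    then show ?thesis using that(1) vector_derivative_unique_at by blast
  qed
  have z': "\<eta>' x = 0" if "x \<in> V" for x using vanish[OF d zero that] .
  have z'': "\<eta>'' x = 0" if "x \<in> V" for x using vanish[OF d' z' that] .
  have prod: "((\<lambda>x. f x) has_vector_derivative f' x) (at x)"
    if "x \<in> U \<Longrightarrow> (f has_vector_derivative f' x) (at x)" "\<And>x. x \<in> V \<Longrightarrow> f x = 0 \<and> f' x = 0"
    for f f' :: "real \<Rightarrow> complex" and x
  proof (cases "x \<in> U")
    case False
    then have "x \<in> V" using \<open>U \<union> V = UNIV\<close> by auto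
    then have "(f has_vector_derivative 0) (at x)"
      by (rule has_vector_derivative_transform_within_open[OF has_vector_derivative_const \<open>open V\<close>])
        (simp add: that(2))
    then show ?thesis using that(2) \<open>x \<in> V\<close> by simp
  qed (rule that(1))
  define p' where "p' = (\<lambda>x. \<eta>' x * \<omega> x + \<eta> x * \<omega>' x)"
  define p'' where "p'' = (\<lambda>x. \<eta>'' x * \<omega> x + \<eta>' x * \<omega>' x + (\<eta>' x * \<omega>' x + \<eta> x * \<omega>'' x))"
  have "((\<lambda>x. \<eta> x * \<omega> x) has_vector_derivative p' x) (at x)" for x
  proof (rule prod)
    assume x: "x \<in> U"
    show "((\<lambda>x. \<eta> x * \<omega> x) has_vector_derivative p' x) (at x)"
      using has_vector_derivative_mult[OF d w[OF x]] by (simp add: p'_def add.commute)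
  next
    fix y assume "y \<in> V"
    then show "\<eta> y * \<omega> y = 0 \<and> p' y = 0" by (simp add: zero z' p'_def)
  qed
  moreover have "(p' has_vector_derivative p'' x) (at x)" for x
  proof (rule prod)
    assume x: "x \<in> U"
    show "(p' has_vector_derivative p'' x) (at x)"
      using has_vector_derivative_add[OF has_vector_derivative_mult[OF d' w[OF x]] has_vector_derivative_mult[OF d w'[OF x]]]
      unfolding p'_def p''_def by (simp only: add_ac)
  next
    fix y assume "y \<in> V"
    then show "p' y = 0 \<and> p'' y = 0" by (simp add: zero z' z'' p'_def p''_def)
  qed
  moreover have "continuous_on UNIV p''"
  proof -
    have cU: "continuous_on U \<omega>" "continuous_on U \<omega>'"
      by (auto intro!: continuous_at_imp_continuous_on has_vector_derivative_continuous w w')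
    have cc: "continuous_on UNIV \<eta>" "continuous_on UNIV \<eta>'"
      using continuous_on_has_vector_derivative[OF d] continuous_on_has_vector_derivative[OF d'] .
    have "continuous_on U p''"
      unfolding p''_def
      by (intro continuous_intros cU w'' continuous_on_subset[OF c] continuous_on_subset[OF cc(1)] continuous_on_subset[OF cc(2)]) auto
    moreover have "continuous_on V p''"
      by (rule continuous_on_eq[OF continuous_on_const[of _ 0]]) (simp add: p''_def zero z' z'')
    ultimately have "continuous_on (U \<union> V) p''" using assms(2,3) continuous_on_open_Un by blast
    then show ?thesis by (simp add: \<open>U \<union> V = UNIV\<close>)
  qed
  moreover have "bounded_support (\<lambda>x. \<eta> x * \<omega> x)"
    using s unfolding bounded_support_def by (metis mult_zero_left)
  ultimately show ?thesis unfolding C2_bump_def by blast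
qed

lemma C2_bump_mult_i: 
  assumes "C2_bump \<eta>"
  shows "C2_bump (\<lambda>\<xi>. \<i> * of_real \<xi> * \<eta> \<xi>)"
proof -
  have "C2_bump (\<lambda>\<xi>. \<eta> \<xi> * (\<i> * of_real \<xi>))"
    by (rule C2_bump_mult[OF assms, of UNIV "{}" _ "\<lambda>_. \<i>" "\<lambda>_. 0"])
      (auto intro!: derivative_eq_intros simp: has_vector_derivative_def scaleR_conv_of_real)
  then show ?thesis by (simp add: mult.commute)
qed

text \<open>Division by \<open>\<i> \<xi>\<close> corresponds to taking a primitive of the kernel.\<close>
lemma C2_bump_divide_i:
  assumes "C2_bump \<eta>" "\<And>x. \<bar>x\<bar> < \<delta> \<Longrightarrow> \<eta> x = 0" "\<delta> > 0"
  shows "C2_bump (\<lambda>\<xi>. \<eta> \<xi> * (1 / (\<i> * of_real \<xi>)))"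
proof (rule C2_bump_mult[OF assms(1), of "- {0}" "{x. \<bar>x\<bar> < \<delta>}" "\<lambda>\<xi>. 1 / (\<i> * of_real \<xi>)"
      "\<lambda>\<xi>. - (1 / (\<i> * of_real \<xi> ^ 2))" "\<lambda>\<xi>. 2 / (\<i> * of_real \<xi> ^ 3)"])
  show "open {x. \<bar>x\<bar> < \<delta>}" by (intro open_Collect_less continuous_intros)
  show "- {0} \<union> {x. \<bar>x\<bar> < \<delta>} = UNIV" using assms(3) by auto
  show "continuous_on (- {0}) (\<lambda>\<xi>. 2 / (\<i> * complex_of_real \<xi> ^ 3))"
    by (intro continuous_intros) auto
  fix x :: real assume x: "x \<in> - {0}"
  have "((\<lambda>z. 1 / (\<i> * z)) has_field_derivative - (1 / (\<i> * of_real x ^ 2))) (at (complex_of_real x))"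
    using x by (auto intro!: derivative_eq_intros simp: field_simps power2_eq_square)
  from has_vector_derivative_real_field[OF this]
  show "((\<lambda>\<xi>. 1 / (\<i> * complex_of_real \<xi>)) has_vector_derivative - (1 / (\<i> * of_real x ^ 2))) (at x)" .
  have "((\<lambda>z. - (1 / (\<i> * z ^ 2))) has_field_derivative 2 / (\<i> * of_real x ^ 3)) (at (complex_of_real x))"
    using x by (auto intro!: derivative_eq_intros simp: field_simps power2_eq_square power3_eq_cube)
  from has_vector_derivative_real_field[OF this]
  show "((\<lambda>\<xi>. - (1 / (\<i> * complex_of_real \<xi> ^ 2))) has_vector_derivative 2 / (\<i> * of_real x ^ 3)) (at x)" .
qed (use assms(2) in auto)

lemma C2_bump_diff_dilate:
  assumes "C2_bump \<eta>"
  shows "C2_bump (\<lambda>x. \<eta> x - \<eta> (2 * x))"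
proof -
  obtain \<eta>' \<eta>'' where d: "\<And>x. (\<eta> has_vector_derivative \<eta>' x) (at x)"
    and d': "\<And>x. (\<eta>' has_vector_derivative \<eta>'' x) (at x)" and c: "continuous_on UNIV \<eta>''" and s: "bounded_support \<eta>"
    using assms(1) unfolding C2_bump_def by blast
  have dil: "((\<lambda>x. f (2 * x)) has_vector_derivative 2 * f' (2 * x)) (at x)"
    if "\<And>x. (f has_vector_derivative f' x) (at x)" for f f' :: "real \<Rightarrow> complex" and x
  proof -
    have "((\<lambda>x. 2 * x) has_vector_derivative 2) (at x)"
      by (auto intro!: derivative_eq_intros simp: has_vector_derivative_def)
    from vector_diff_chain_at[OF this that] show ?thesis by (simp add: o_def scaleR_conv_of_real)
  qed
  have "((\<lambda>x. \<eta> x - \<eta> (2 * x)) has_vector_derivative \<eta>' x - 2 * \<eta>' (2 * x)) (at x)" for x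
    by (intro has_vector_derivative_diff d dil)
  moreover have "((\<lambda>x. \<eta>' x - 2 * \<eta>' (2 * x)) has_vector_derivative \<eta>'' x - 2 * (2 * \<eta>'' (2 * x))) (at x)" for x
    by (intro has_vector_derivative_diff d' has_vector_derivative_mult_right dil)
  moreover have "continuous_on UNIV (\<lambda>x. \<eta>'' x - 2 * (2 * \<eta>'' (2 * x)))"
    by (intro continuous_intros c continuous_on_compose2[OF c]) auto
  moreover have "bounded_support (\<lambda>x. \<eta> x - \<eta> (2 * x))"
  proof -
    obtain R where "\<And>x. \<bar>x\<bar> > R \<Longrightarrow> \<eta> x = 0" using s by (auto simp: bounded_support_def)
    then have "\<eta> x - \<eta> (2 * x) = 0" if "\<bar>x\<bar> > max R 0" for x using that by auto
    then show ?thesis unfolding bounded_support_def by blast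
  qed
  ultimately show ?thesis by (rule C2_bumpI)
qed

lemma smooth_has_vector_derivative:
  fixes f :: "real \<Rightarrow> complex"
  assumes "f differentiable (at x)"
  shows "(f has_vector_derivative frechet_derivative f (at x) 1) (at x)"
proof -
  have d: "(f has_derivative frechet_derivative f (at x)) (at x)"
    using assms frechet_derivative_works by blast
  have "frechet_derivative f (at x) = (\<lambda>h. h *\<^sub>R frechet_derivative f (at x) 1)"
    using linear_frechet_derivative[OF assms] by (auto simp: fun_eq_iff linear_scale[symmetric])
  with d show ?thesis unfolding has_vector_derivative_def by metis
qed

lemma schwartz_C2_bump:
  fixes \<phi> :: "real \<Rightarrow> complex"
  assumes "\<phi> \<in> schwartz" "bounded_support \<phi>"
  shows "C2_bump \<phi>"
proof -
  have "partials bs \<phi> differentiable (at x)" if "set bs \<subseteq> {1}" for bs x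
    using assms(1) that by (auto simp: schwartz_def smooth_def)
  from this[of "[]"] this[of "[1]"] this[of "[1, 1]"]
  have *: "\<phi> differentiable (at x)" "partials [1] \<phi> differentiable (at x)" "partials [1, 1] \<phi> differentiable (at x)" for x
    by auto
  have "(\<phi> has_vector_derivative partials [1] \<phi> x) (at x)" for x
    using smooth_has_vector_derivative[OF *(1)] by simp
  moreover have "(partials [1] \<phi> has_vector_derivative partials [1, 1] \<phi> x) (at x)" for x
    using smooth_has_vector_derivative[OF *(2)] by simp
  moreover have "continuous_on UNIV (partials [1, 1] \<phi>)"
    using *(3) by (intro continuous_at_imp_continuous_on ballI differentiable_imp_continuous_within)
  ultimately show ?thesis unfolding C2_bump_def using assms(2) by blast
qed

text \<open>For \<open>k > 0\<close> the bump is a dilate of \<open>\<psi> t = \<phi>\<^sub>0 t - \<phi>\<^sub>0 (2 t)\<close>, which vanishes near \<open>0\<close>, so that \<open>\<psi> \<xi> / (\<i> \<xi>)\<close> is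
again smooth. The multipliers \<open>\<i> \<xi> \<psi>\<close> and \<open>\<psi> / (\<i> \<xi>)\<close> give the derivative and the primitive of the kernel, and
they scale like \<open>2\<^sup>k\<close> and \<open>2\<^sup>-\<^sup>k\<close>. The bump with \<open>k = 0\<close> does not vanish at \<open>0\<close> and has no such primitive.\<close>
lemma kernel_family:
  assumes "\<phi>\<^sub>0 \<in> schwartz" "\<And>t. \<bar>t\<bar> \<le> 1 \<Longrightarrow> \<phi>\<^sub>0 t = 1" "\<And>t. \<bar>t\<bar> > 3 / 2 \<Longrightarrow> \<phi>\<^sub>0 t = 0"
  obtains C where "C \<ge> 0"
    "\<And>k. continuous_on UNIV (dyadic_part \<phi>\<^sub>0 k)" "\<And>k. bounded_support (dyadic_part \<phi>\<^sub>0 k)"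
    "\<And>k. L1 (kern (dyadic_part \<phi>\<^sub>0 k)) \<le> ennreal C"
    "\<And>k. L1 (kern (\<lambda>\<xi>. \<i> * of_real \<xi> * dyadic_part \<phi>\<^sub>0 k \<xi>)) \<le> ennreal (C * 2 ^ k)"
    "\<And>k. k > 0 \<Longrightarrow> \<exists>\<zeta>. continuous_on UNIV \<zeta> \<and> bounded_support \<zeta> \<and>
        dyadic_part \<phi>\<^sub>0 k = (\<lambda>\<xi>. \<i> * of_real \<xi> * \<zeta> \<xi>) \<and> L1 (kern \<zeta>) \<le> ennreal (C / 2 ^ k)"
proof -
  have "bounded_support \<phi>\<^sub>0" using assms(3) unfolding bounded_support_def by blast
  with assms(1) have b0: "C2_bump \<phi>\<^sub>0" by (rule schwartz_C2_bump)
  define \<psi> where "\<psi> = (\<lambda>t. \<phi>\<^sub>0 t - \<phi>\<^sub>0 (2 * t))"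
  define \<theta> where "\<theta> = (\<lambda>\<xi>. \<i> * of_real \<xi> * \<psi> \<xi>)"
  define \<zeta> where "\<zeta> = (\<lambda>\<xi>. \<psi> \<xi> * (1 / (\<i> * of_real \<xi>)))"
  have \<psi>: "C2_bump \<psi>" unfolding \<psi>_def using b0 by (rule C2_bump_diff_dilate)
  have \<theta>: "C2_bump \<theta>" unfolding \<theta>_def using \<psi> by (rule C2_bump_mult_i)
  have \<psi>0: "\<psi> x = 0" if "\<bar>x\<bar> < 1 / 2" for x
  proof -
    have "\<bar>x\<bar> \<le> 1" "\<bar>2 * x\<bar> \<le> 1" using that by auto
    then show ?thesis using assms(2) unfolding \<psi>_def by simp
  qed
  have \<zeta>: "C2_bump \<zeta>" unfolding \<zeta>_def by (rule C2_bump_divide_i[OF \<psi>, of "1 / 2"]) (use \<psi>0 in auto)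
  have \<zeta>\<psi>: "\<i> * of_real \<xi> * \<zeta> \<xi> = \<psi> \<xi>" for \<xi>
    using \<psi>0[of 0] by (cases "\<xi> = 0") (simp_all add: \<zeta>_def)
  have i0: "C2_bump (\<lambda>\<xi>. \<i> * of_real \<xi> * \<phi>\<^sub>0 \<xi>)" using b0 by (rule C2_bump_mult_i)
  have m[measurable]: "\<psi> \<in> borel_measurable borel" "\<theta> \<in> borel_measurable borel" "\<zeta> \<in> borel_measurable borel"
    using \<psi> \<theta> \<zeta> by (auto intro: continuous_measurable C2_bump_continuous)
  have dil: "C2_bump f \<Longrightarrow> continuous_on UNIV (\<lambda>\<xi>. f (\<xi> / c))" "C2_bump f \<Longrightarrow> bounded_support (\<lambda>\<xi>. f (\<xi> / c))"
    if "c > 0" for f and c :: real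
  proof -
    assume f: "C2_bump f"
    show "continuous_on UNIV (\<lambda>\<xi>. f (\<xi> / c))"
      by (rule continuous_on_compose2[OF C2_bump_continuous[OF f]]) (use that in \<open>auto intro!: continuous_intros\<close>)
    obtain R where R: "\<And>x. \<bar>x\<bar> > R \<Longrightarrow> f x = 0" using f by (auto simp: C2_bump_def bounded_support_def)
    have "f (x / c) = 0" if "\<bar>x\<bar> > c * R" for x
      using that \<open>c > 0\<close> by (intro R) (simp add: field_simps)
    then show "bounded_support (\<lambda>\<xi>. f (\<xi> / c))" unfolding bounded_support_def by blast
  qed
  define S where "S = L1 (kern \<phi>\<^sub>0) + L1 (kern (\<lambda>\<xi>. \<i> * of_real \<xi> * \<phi>\<^sub>0 \<xi>)) + L1 (kern \<psi>) + L1 (kern \<theta>) + L1 (kern \<zeta>)"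
  define C where "C = enn2real S"
  have "S < \<infinity>" unfolding S_def using b0 i0 \<psi> \<theta> \<zeta> by (simp add: kern_L1_finite[simplified])
  then have S: "S = ennreal C" by (simp add: C_def)
  have le: "L1 (kern \<phi>\<^sub>0) \<le> ennreal C" "L1 (kern (\<lambda>\<xi>. \<i> * of_real \<xi> * \<phi>\<^sub>0 \<xi>)) \<le> ennreal C"
    "L1 (kern \<psi>) \<le> ennreal C" "L1 (kern \<theta>) \<le> ennreal C" "L1 (kern \<zeta>) \<le> ennreal C"
    unfolding S[symmetric] S_def by (simp_all add: add_increasing add_increasing2)
  have dyadic_Suc: "dyadic_part \<phi>\<^sub>0 (Suc k) = (\<lambda>\<xi>. \<psi> (\<xi> / 2 ^ Suc k))" for k
    by (auto simp: \<psi>_def fun_eq_iff)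
  show thesis
  proof (rule that[of C])
    show "C \<ge> 0" by (simp add: C_def)
    fix k
    show "continuous_on UNIV (dyadic_part \<phi>\<^sub>0 k)"
      by (cases k) (use b0 C2_bump_continuous dil(1)[OF _ \<psi>] in \<open>auto simp: dyadic_Suc simp del: dyadic_part.simps(2)\<close>)
    show "bounded_support (dyadic_part \<phi>\<^sub>0 k)"
      by (cases k) (use b0 dil(2)[OF _ \<psi>] in \<open>auto simp: dyadic_Suc C2_bump_def simp del: dyadic_part.simps(2)\<close>)
    show "L1 (kern (dyadic_part \<phi>\<^sub>0 k)) \<le> ennreal C"
      by (cases k) (use le in \<open>simp_all add: dyadic_Suc L1_kern_dilate[of "2 ^ Suc _", OF _ m(1)] del: dyadic_part.simps(2) power_Suc\<close>)
    show "L1 (kern (\<lambda>\<xi>. \<i> * of_real \<xi> * dyadic_part \<phi>\<^sub>0 k \<xi>)) \<le> ennreal (C * 2 ^ k)"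
    proof (cases k)
      case (Suc j)
      have "(\<lambda>\<xi>. \<i> * of_real \<xi> * dyadic_part \<phi>\<^sub>0 k \<xi>) = (\<lambda>\<xi>. of_real (2 ^ k) * \<theta> (\<xi> / 2 ^ k))"
      proof
        fix \<xi> :: real
        have "dyadic_part \<phi>\<^sub>0 k \<xi> = \<psi> (\<xi> / 2 ^ k)" using fun_cong[OF dyadic_Suc] by (simp only: \<open>k = Suc j\<close>)
        then show "\<i> * of_real \<xi> * dyadic_part \<phi>\<^sub>0 k \<xi> = of_real (2 ^ k) * \<theta> (\<xi> / 2 ^ k)"
          by (simp add: \<theta>_def)
      qed
      then have "kern (\<lambda>\<xi>. \<i> * of_real \<xi> * dyadic_part \<phi>\<^sub>0 k \<xi>) = (\<lambda>x. of_real (2 ^ k) * kern (\<lambda>\<xi>. \<theta> (\<xi> / 2 ^ k)) x)"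
        by (simp only: kern_scale fun_eq_iff) simp
      then have "L1 (kern (\<lambda>\<xi>. \<i> * of_real \<xi> * dyadic_part \<phi>\<^sub>0 k \<xi>)) = ennreal (2 ^ k) * L1 (kern \<theta>)"
        by (simp add: L1_scale L1_kern_dilate norm_power)
      also have "\<dots> \<le> ennreal (2 ^ k) * ennreal C" by (intro mult_left_mono le) simp
      finally show ?thesis by (simp add: ennreal_mult[symmetric] C_def mult.commute)
    qed (use le in simp)
    assume "k > 0"
    then obtain j where k: "k = Suc j" by (cases k) auto
    let ?\<zeta> = "\<lambda>\<xi>. of_real (1 / 2 ^ k) * \<zeta> (\<xi> / 2 ^ k)"
    have "kern ?\<zeta> = (\<lambda>x. of_real (1 / 2 ^ k) * kern (\<lambda>\<xi>. \<zeta> (\<xi> / 2 ^ k)) x)"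
      by (simp only: kern_scale fun_eq_iff) simp
    note scaled = this
    have "L1 (kern ?\<zeta>) = ennreal (norm (of_real (1 / 2 ^ k) :: complex)) * L1 (kern (\<lambda>\<xi>. \<zeta> (\<xi> / 2 ^ k)))"
      unfolding scaled by (rule L1_scale) measurable
    also have "\<dots> = ennreal (1 / 2 ^ k) * L1 (kern \<zeta>)"
      by (simp add: L1_kern_dilate norm_divide norm_power)
    also have "\<dots> \<le> ennreal (1 / 2 ^ k) * ennreal C" by (intro mult_left_mono le) simp
    finally have "L1 (kern ?\<zeta>) \<le> ennreal (C / 2 ^ k)" by (simp add: ennreal_mult[symmetric] C_def)
    moreover have "continuous_on UNIV ?\<zeta>" by (intro continuous_intros dil \<zeta>) simp
    moreover have "bounded_support ?\<zeta>"
      using dil(2)[OF _ \<zeta>, of "2 ^ k"] unfolding bounded_support_def by auto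
    moreover have "dyadic_part \<phi>\<^sub>0 k = (\<lambda>\<xi>. \<i> * of_real \<xi> * ?\<zeta> \<xi>)"
    proof
      fix \<xi> :: real
      have "dyadic_part \<phi>\<^sub>0 k \<xi> = \<psi> (\<xi> / 2 ^ k)" unfolding k dyadic_Suc ..
      also have "\<dots> = \<i> * of_real \<xi> * ?\<zeta> \<xi>" using \<zeta>\<psi>[of "\<xi> / 2 ^ k"] by simp
      finally show "dyadic_part \<phi>\<^sub>0 k \<xi> = \<i> * of_real \<xi> * ?\<zeta> \<xi>" .
    qed
    ultimately show "\<exists>\<zeta>. continuous_on UNIV \<zeta> \<and> bounded_support \<zeta> \<and>
        dyadic_part \<phi>\<^sub>0 k = (\<lambda>\<xi>. \<i> * of_real \<xi> * \<zeta> \<xi>) \<and> L1 (kern \<zeta>) \<le> ennreal (C / 2 ^ k)" by blast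
  qed
qed

section \<open>Kernels against Haar functions\<close>

text \<open>On disjoint sets the convolutions are integrals of the kernel over disjoint sets as well.\<close>
lemma sum_norm_conv_disjoint_le:
  fixes \<kappa> :: "real \<Rightarrow> complex" and I :: "nat \<Rightarrow> real set"
  assumes [measurable]: "\<kappa> \<in> borel_measurable borel" "\<And>m. I m \<in> sets borel" and disj: "disjoint_family I"
  shows "(\<Sum>m<M. ennreal (norm (conv \<kappa> (indicator (I m)) x))) \<le> L1 \<kappa>"
proof -
  have "(\<Sum>m<M. ennreal (norm (conv \<kappa> (indicator (I m)) x)))
      \<le> (\<Sum>m<M. \<integral>\<^sup>+y. ennreal (norm (\<kappa> (x - y))) * indicator (I m) y \<partial>lborel)"
  proof (rule sum_mono)
    fix m
    have "ennreal (norm (indicator (I m) y :: complex)) = indicator (I m) y" for y by (simp add: indicator_def)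
    then show "ennreal (norm (conv \<kappa> (indicator (I m)) x)) \<le> (\<integral>\<^sup>+y. ennreal (norm (\<kappa> (x - y))) * indicator (I m) y \<partial>lborel)"
      using norm_conv_le[of \<kappa> "indicator (I m)" x] by simp
  qed
  also have "\<dots> = (\<integral>\<^sup>+y. (\<Sum>m<M. ennreal (norm (\<kappa> (x - y))) * indicator (I m) y) \<partial>lborel)"
    by (rule nn_integral_sum[symmetric]) measurable
  also have "\<dots> \<le> (\<integral>\<^sup>+y. ennreal (norm (\<kappa> (x - y))) \<partial>lborel)"
  proof (rule nn_integral_mono)
    fix y
    have "(\<Sum>m<M. indicator (I m) y :: ennreal) = indicator (\<Union>m<M. I m) y"
      by (intro indicator_UN_disjoint[symmetric]) (use disj in \<open>auto simp: disjoint_family_on_def\<close>)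
    also have "\<dots> \<le> 1" by (simp add: indicator_def)
    finally have "(\<Sum>m<M. indicator (I m) y :: ennreal) \<le> 1" .
    then have "ennreal (norm (\<kappa> (x - y))) * (\<Sum>m<M. indicator (I m) y) \<le> ennreal (norm (\<kappa> (x - y))) * 1"
      by (intro mult_left_mono) auto
    then show "(\<Sum>m<M. ennreal (norm (\<kappa> (x - y))) * indicator (I m) y) \<le> ennreal (norm (\<kappa> (x - y)))"
      by (simp add: sum_distrib_left)
  qed
  also have "\<dots> = L1 \<kappa>"
    unfolding L1_def by (rule nn_integral_reflect[where f = "\<lambda>x. ennreal (norm (\<kappa> x))"]) measurable
  finally show ?thesis .
qed

lemma integrable_conv_integrand:
  fixes \<kappa> f :: "real \<Rightarrow> complex"
  assumes [measurable]: "\<kappa> \<in> borel_measurable borel" "f \<in> borel_measurable borel"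
    and fin: "L1 \<kappa> < \<infinity>" and f1: "\<And>y. norm (f y) \<le> 1"
  shows "integrable lborel (\<lambda>y. \<kappa> (x - y) * f y)"
proof -
  have "L1 (\<lambda>y. \<kappa> (x - y)) = L1 \<kappa>"
    unfolding L1_def by (rule nn_integral_reflect[where f = "\<lambda>x. ennreal (norm (\<kappa> x))"]) measurable
  then have "integrable lborel (\<lambda>y. \<kappa> (x - y))" using fin by (simp add: integrable_iff_L1)
  then show ?thesis
    by (rule Bochner_Integration.integrable_bound) (auto simp: norm_mult intro!: mult_left_le f1)
qed

lemma conv_indicator_shift:
  "conv \<kappa> (indicator {a + d<..b + d}) x = conv (\<lambda>z. \<kappa> (z - d)) (indicator {a<..b}) (x :: real)"
  unfolding conv_def
  by (subst lborel_integral_real_affine[of 1 _ d]) (auto simp: indicator_def algebra_simps intro!: Bochner_Integration.integral_cong)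

lemma conv_diff_kernel:
  fixes \<kappa> \<kappa>' f :: "real \<Rightarrow> complex"
  assumes "\<kappa> \<in> borel_measurable borel" "\<kappa>' \<in> borel_measurable borel" "f \<in> borel_measurable borel"
    and "L1 \<kappa> < \<infinity>" "L1 \<kappa>' < \<infinity>" and "\<And>y. norm (f y) \<le> 1"
  shows "conv (\<lambda>z. \<kappa> z - \<kappa>' z) f x = conv \<kappa> f x - conv \<kappa>' f x"
  unfolding conv_def left_diff_distrib
  by (intro Bochner_Integration.integral_diff integrable_conv_integrand assms)

lemma conv_diff:
  fixes \<kappa> f g :: "real \<Rightarrow> complex"
  assumes "\<kappa> \<in> borel_measurable borel" "g \<in> borel_measurable borel" "f \<in> borel_measurable borel"
    and "L1 \<kappa> < \<infinity>" and "\<And>y. norm (f y) \<le> 1" "\<And>y. norm (g y) \<le> 1"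
  shows "conv \<kappa> (\<lambda>y. f y - g y) x = conv \<kappa> f x - conv \<kappa> g x"
  unfolding conv_def right_diff_distrib
  by (intro Bochner_Integration.integral_diff integrable_conv_integrand assms)

definition chaar :: "nat \<Rightarrow> nat \<Rightarrow> real \<Rightarrow> complex" where
  "chaar i m y = of_real (haar i m y)"

lemma measurable_haar [measurable]: "haar i m \<in> borel_measurable borel"
  by (cases i) simp_all

lemma measurable_chaar [measurable]: "chaar i m \<in> borel_measurable borel"
  unfolding chaar_def[abs_def] by measurable

lemma haar_Suc_intervals:
  fixes j m :: nat
  defines "d \<equiv> 1 / 2 ^ Suc j" and "a \<equiv> real m / 2 ^ j"
  shows "chaar (Suc j) m = (\<lambda>y. indicator {a<..a + d} y - indicator {a + d<..a + d + d} y)"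
proof -
  have "(real m + 1 / 2) / 2 ^ j = a + d" "(real m + 1) / 2 ^ j = a + d + d"
    by (simp_all add: a_def d_def field_simps)
  then show ?thesis by (auto simp: chaar_def fun_eq_iff indicator_def a_def)
qed

lemma norm_indicator_le_1: "norm (indicator A y :: complex) \<le> 1"
  by (simp add: indicator_def)

lemma L1_conv_interval_le:
  fixes \<kappa> :: "real \<Rightarrow> complex"
  assumes "\<kappa> \<in> borel_measurable borel" "a \<le> b"
  shows "L1 (conv \<kappa> (indicator {a<..b})) \<le> L1 \<kappa> * ennreal (b - a)"
  using L1_conv_le[OF assms(1), of "indicator {a<..b}"] assms(2) by (simp add: L1_indicator)

text \<open>A Haar function of level \<open>j\<close> is an indicator of an interval of length \<open>d = 2\<^bsup>-j-1\<^esup>\<close> minus its translate by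
\<open>d\<close>. Moving the difference to the kernel, the convolution is that of \<open>\<Delta> z = \<kappa> z - \<kappa> (z - d)\<close> with the indicator. The \<open>L\<^sub>1\<close> norm
of \<open>\<Delta>\<close> is bounded, and it is at most \<open>d\<close> times that of the derivative of \<open>\<kappa>\<close>; this gives the first estimate. For the
second one, either use the length \<open>d\<close> of the interval, or express the convolution by values of the
primitive of \<open>\<kappa>\<close>.\<close>
lemma haar_conv_bounds:
  assumes "\<phi>\<^sub>0 \<in> schwartz" "\<And>t. \<bar>t\<bar> \<le> 1 \<Longrightarrow> \<phi>\<^sub>0 t = 1" "\<And>t. \<bar>t\<bar> > 3 / 2 \<Longrightarrow> \<phi>\<^sub>0 t = 0"
  obtains C where "C \<ge> 0"
    "\<And>k. continuous_on UNIV (dyadic_part \<phi>\<^sub>0 k)" "\<And>k. bounded_support (dyadic_part \<phi>\<^sub>0 k)"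
    "\<And>k. L1 (kern (dyadic_part \<phi>\<^sub>0 k)) \<le> ennreal C"
    "\<And>k i x. (\<Sum>m<2 ^ (i - 1). norm (conv (kern (dyadic_part \<phi>\<^sub>0 k)) (chaar i m) x)) \<le> C * gain (real k - real i)"
    "\<And>k i m. L1 (conv (kern (dyadic_part \<phi>\<^sub>0 k)) (chaar i m)) \<le> ennreal (C * gain (real k - real i) / 2 ^ k)"
proof (rule kernel_family[OF assms])
  fix C :: real
  assume C0: "C \<ge> 0"
    and cont: "\<And>k. continuous_on UNIV (dyadic_part \<phi>\<^sub>0 k)" and supp: "\<And>k. bounded_support (dyadic_part \<phi>\<^sub>0 k)"
    and L: "\<And>k. L1 (kern (dyadic_part \<phi>\<^sub>0 k)) \<le> ennreal C"
    and L': "\<And>k. L1 (kern (\<lambda>\<xi>. \<i> * of_real \<xi> * dyadic_part \<phi>\<^sub>0 k \<xi>)) \<le> ennreal (C * 2 ^ k)"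
    and P: "\<And>k. k > 0 \<Longrightarrow> \<exists>\<zeta>. continuous_on UNIV \<zeta> \<and> bounded_support \<zeta> \<and>
        dyadic_part \<phi>\<^sub>0 k = (\<lambda>\<xi>. \<i> * of_real \<xi> * \<zeta> \<xi>) \<and> L1 (kern \<zeta>) \<le> ennreal (C / 2 ^ k)"
  have [measurable]: "dyadic_part \<phi>\<^sub>0 k \<in> borel_measurable borel" for k
    by (rule continuous_measurable[OF cont])
  define \<kappa> where "\<kappa> k = kern (dyadic_part \<phi>\<^sub>0 k)" for k
  have [measurable]: "\<kappa> k \<in> borel_measurable borel" for k unfolding \<kappa>_def by measurable
  have L\<kappa>: "L1 (\<kappa> k) \<le> ennreal C" "L1 (\<kappa> k) < \<infinity>" for k
    using L[of k] by (auto simp: \<kappa>_def intro: le_less_trans)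
  define \<Delta> where "\<Delta> k j = (\<lambda>z. \<kappa> k z - \<kappa> k (z - 1 / 2 ^ Suc j))" for k j
  have [measurable]: "\<Delta> k j \<in> borel_measurable borel" for k j unfolding \<Delta>_def by measurable
  have \<Delta>: "L1 (\<Delta> k j) \<le> ennreal (2 * C * gain (real k - real (Suc j)))" for k j
  proof -
    have 1: "L1 (\<Delta> k j) \<le> ennreal (2 * C)"
    proof -
      have "L1 (\<Delta> k j) \<le> L1 (\<kappa> k) + L1 (\<lambda>z. \<kappa> k (z - 1 / 2 ^ Suc j))"
        unfolding \<Delta>_def by (rule L1_diff_le) measurable
      also have "\<dots> = L1 (\<kappa> k) + L1 (\<kappa> k)" by (subst L1_shift) auto
      also have "\<dots> \<le> ennreal C + ennreal C" by (intro add_mono L\<kappa>)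
      finally show ?thesis using C0 by (simp add: ennreal_plus[symmetric] del: ennreal_plus)
    qed
    have 2: "L1 (\<Delta> k j) \<le> ennreal (2 * C * 2 powr (real k - real (Suc j)))"
    proof -
      let ?\<kappa>' = "kern (\<lambda>\<xi>. \<i> * of_real \<xi> * dyadic_part \<phi>\<^sub>0 k \<xi>)"
      have eq: "\<Delta> k j = conv ?\<kappa>' (indicator {0<..1 / 2 ^ Suc j})"
        unfolding \<Delta>_def \<kappa>_def by (rule ext) (simp add: conv_kern_interval[OF cont supp])
      have "L1 (\<Delta> k j) \<le> L1 ?\<kappa>' * ennreal (1 / 2 ^ Suc j - 0)"
        unfolding eq
        by (rule L1_conv_interval_le[OF measurable_kern[OF continuous_measurable]]) (intro continuous_intros cont, simp)
      also have "\<dots> \<le> ennreal (C * 2 ^ k) * ennreal (1 / 2 ^ Suc j)"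
        by (intro mult_mono L') auto
      also have "\<dots> = ennreal (C * 2 powr (real k - real (Suc j)))"
        using C0 by (simp add: ennreal_mult[symmetric] powr_diff powr_realpow del: power_Suc of_nat_Suc)
      also have "\<dots> \<le> ennreal (2 * C * 2 powr (real k - real (Suc j)))"
        using C0 by (intro ennreal_leI mult_right_mono) auto
      finally show ?thesis .
    qed
    show ?thesis using 1 2 by (simp add: gain_def min_def)
  qed
  have haar_\<Delta>: "conv (\<kappa> k) (chaar (Suc j) m) x = conv (\<Delta> k j) (indicator {real m / 2 ^ j<..real m / 2 ^ j + 1 / 2 ^ Suc j}) x"
    for k j m x
  proof -
    let ?a = "real m / 2 ^ j" and ?d = "1 / 2 ^ Suc j :: real"
    have "conv (\<kappa> k) (chaar (Suc j) m) x = conv (\<kappa> k) (indicator {?a<..?a + ?d}) x - conv (\<kappa> k) (indicator {?a + ?d<..?a + ?d + ?d}) x"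
      unfolding haar_Suc_intervals by (rule conv_diff) (auto intro: norm_indicator_le_1 L\<kappa>[simplified])
    also have "conv (\<kappa> k) (indicator {?a + ?d<..?a + ?d + ?d}) x = conv (\<lambda>z. \<kappa> k (z - ?d)) (indicator {?a<..?a + ?d}) x"
      by (rule conv_indicator_shift)
    also have "conv (\<kappa> k) (indicator {?a<..?a + ?d}) x - \<dots> = conv (\<Delta> k j) (indicator {?a<..?a + ?d}) x"
      unfolding \<Delta>_def
      by (rule conv_diff_kernel[symmetric]) (auto intro: norm_indicator_le_1 simp: L1_shift L\<kappa>[simplified])
    finally show ?thesis .
  qed
  show thesis
  proof (rule that[of "4 * C"])
    show "4 * C \<ge> 0" using C0 by simp
    fix k
    show "continuous_on UNIV (dyadic_part \<phi>\<^sub>0 k)" "bounded_support (dyadic_part \<phi>\<^sub>0 k)" by (rule cont supp)+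
    have "ennreal C \<le> ennreal (4 * C)" using C0 by (intro ennreal_leI) auto
    with L[of k] show "L1 (kern (dyadic_part \<phi>\<^sub>0 k)) \<le> ennreal (4 * C)" by (rule order_trans)
    fix i
    show "(\<Sum>m<2 ^ (i - 1). norm (conv (kern (dyadic_part \<phi>\<^sub>0 k)) (chaar i m) x)) \<le> 4 * C * gain (real k - real i)" for x
    proof -
      have "ennreal (\<Sum>m<2 ^ (i - 1). norm (conv (\<kappa> k) (chaar i m) x)) \<le> ennreal (2 * C * gain (real k - real i))"
      proof (cases i)
        case 0
        have "chaar 0 0 = indicator {0<..1}" by (auto simp: chaar_def indicator_def)
        then have "ennreal (norm (conv (\<kappa> k) (chaar 0 0) x)) \<le> L1 (\<kappa> k)"
          using sum_norm_conv_disjoint_le[of "\<kappa> k" "\<lambda>m. if m = 0 then {0<..1} else {}", where M = 1 and x = x]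
          by (auto simp: disjoint_family_on_def)
        also have "\<dots> \<le> ennreal (2 * C)" using C0 by (intro order_trans[OF L\<kappa>(1) ennreal_leI]) auto
        finally show ?thesis using 0 by (simp add: gain_nonneg_arg)
      next
        case (Suc j)
        let ?I = "\<lambda>m. {real m / 2 ^ j<..real m / 2 ^ j + 1 / 2 ^ Suc j}"
        have "disjoint_family ?I"
        proof -
          have "?I m \<inter> ?I l = {}" if "m < l" for m l
          proof -
            have "real m + 1 \<le> real l" using that by linarith
            then have "(real m + 1) / 2 ^ j \<le> real l / 2 ^ j" by (intro divide_right_mono) auto
            moreover have "real m / 2 ^ j + 1 / 2 ^ Suc j \<le> (real m + 1) / 2 ^ j" by (simp add: field_simps)
            ultimately show ?thesis by auto
          qed
          then show ?thesis unfolding disjoint_family_on_def by (metis Int_commute linorder_neqE_nat)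
        qed
        then have "(\<Sum>m<2 ^ j. ennreal (norm (conv (\<Delta> k j) (indicator (?I m)) x))) \<le> L1 (\<Delta> k j)"
          by (intro sum_norm_conv_disjoint_le) measurable
        also have "\<dots> \<le> ennreal (2 * C * gain (real k - real (Suc j)))" by (rule \<Delta>)
        finally show ?thesis unfolding Suc haar_\<Delta> by simp
      qed
      then have "(\<Sum>m<2 ^ (i - 1). norm (conv (\<kappa> k) (chaar i m) x)) \<le> 2 * C * gain (real k - real i)"
        using C0 gain_nonneg[of "real k - real i"] by (subst (asm) ennreal_le_iff) auto
      also have "\<dots> \<le> 4 * C * gain (real k - real i)"
        using C0 gain_nonneg[of "real k - real i"] by (intro mult_right_mono) auto
      finally show ?thesis by (simp add: \<kappa>_def)
    qed
    fix m
    have fine: "L1 (conv (\<kappa> k) (chaar i m)) \<le> ennreal (4 * C / 2 ^ i)"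
    proof (cases i)
      case 0
      have "chaar 0 m = indicator {0<..1}" by (auto simp: chaar_def indicator_def fun_eq_iff)
      then have "L1 (conv (\<kappa> k) (chaar i m)) \<le> L1 (\<kappa> k) * ennreal (1 - 0)"
        using L1_conv_interval_le[of "\<kappa> k" 0 1] 0 by simp
      also have "L1 (\<kappa> k) * ennreal (1 - 0) = L1 (\<kappa> k)" by simp
      also have "\<dots> \<le> ennreal (4 * C)" using C0 by (intro order_trans[OF L\<kappa>(1) ennreal_leI]) auto
      finally show ?thesis using 0 by simp
    next
      case (Suc j)
      have "L1 (conv (\<kappa> k) (chaar i m)) \<le> L1 (\<Delta> k j) * ennreal (1 / 2 ^ Suc j)"
        unfolding Suc haar_\<Delta>[abs_def] using L1_conv_interval_le[of "\<Delta> k j" "real m / 2 ^ j" "real m / 2 ^ j + 1 / 2 ^ Suc j"]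
        by simp
      also have "\<dots> \<le> ennreal (2 * C * gain (real k - real (Suc j))) * ennreal (1 / 2 ^ Suc j)"
        by (intro mult_right_mono \<Delta>) simp
      also have "\<dots> = ennreal (2 * C * gain (real k - real i) * (1 / 2 ^ i))"
        unfolding Suc using C0 by (subst ennreal_mult) (auto simp: gain_nonneg)
      also have "\<dots> \<le> ennreal (4 * C * 1 * (1 / 2 ^ i))"
        using C0 by (intro ennreal_leI mult_mono gain_le_1 gain_nonneg) auto
      finally show ?thesis by simp
    qed
    have coarse: "L1 (conv (\<kappa> k) (chaar i m)) \<le> ennreal (4 * C / 2 ^ k)"
    proof (cases "k = 0")
      case True
      have "L1 (conv (\<kappa> k) (chaar i m)) \<le> ennreal (4 * C / 2 ^ i)" by (rule fine)
      also have "\<dots> \<le> ennreal (4 * C / 2 ^ k)"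
        using C0 True by (intro ennreal_leI divide_left_mono) auto
      finally show ?thesis .
    next
      case False
      then obtain \<zeta> where \<zeta>: "continuous_on UNIV \<zeta>" "bounded_support \<zeta>"
        "dyadic_part \<phi>\<^sub>0 k = (\<lambda>\<xi>. \<i> * of_real \<xi> * \<zeta> \<xi>)" "L1 (kern \<zeta>) \<le> ennreal (C / 2 ^ k)"
        using P[of k] by auto
      have [measurable]: "\<zeta> \<in> borel_measurable borel" by (rule continuous_measurable[OF \<zeta>(1)])
      have prim: "conv (\<kappa> k) (indicator {a<..b}) = (\<lambda>x. kern \<zeta> (x - a) - kern \<zeta> (x - b))" if "a \<le> b" for a b
        unfolding \<kappa>_def \<zeta>(3) using conv_kern_interval[OF \<zeta>(1,2) that] by (rule ext)
      have interval: "L1 (conv (\<kappa> k) (indicator {a<..b})) \<le> ennreal (2 * C / 2 ^ k)" if "a \<le> b" for a b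
      proof -
        have "L1 (conv (\<kappa> k) (indicator {a<..b})) \<le> L1 (\<lambda>x. kern \<zeta> (x - a)) + L1 (\<lambda>x. kern \<zeta> (x - b))"
          unfolding prim[OF that] by (rule L1_diff_le) measurable
        also have "\<dots> = L1 (kern \<zeta>) + L1 (kern \<zeta>)" by (simp add: L1_shift)
        also have "\<dots> \<le> ennreal (C / 2 ^ k) + ennreal (C / 2 ^ k)" by (intro add_mono \<zeta>(4))
        also have "\<dots> = ennreal (2 * C / 2 ^ k)" using C0 by (simp add: ennreal_plus[symmetric] del: ennreal_plus)
        finally show ?thesis .
      qed
      show ?thesis
      proof (cases i)
        case 0
        have "chaar 0 m = indicator {0<..1}" by (auto simp: chaar_def indicator_def fun_eq_iff)
        then have "L1 (conv (\<kappa> k) (chaar i m)) \<le> ennreal (2 * C / 2 ^ k)" using interval[of 0 1] 0 by simp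
        also have "\<dots> \<le> ennreal (4 * C / 2 ^ k)" using C0 by (intro ennreal_leI divide_right_mono) auto
        finally show ?thesis .
      next
        case (Suc j)
        let ?a = "real m / 2 ^ j" and ?d = "1 / 2 ^ Suc j :: real"
        have "conv (\<kappa> k) (chaar (Suc j) m) = (\<lambda>x. conv (\<kappa> k) (indicator {?a<..?a + ?d}) x - conv (\<kappa> k) (indicator {?a + ?d<..?a + ?d + ?d}) x)"
          unfolding haar_Suc_intervals by (rule ext, rule conv_diff) (auto intro: norm_indicator_le_1 L\<kappa>[simplified])
        then have "L1 (conv (\<kappa> k) (chaar i m)) \<le> L1 (conv (\<kappa> k) (indicator {?a<..?a + ?d})) + L1 (conv (\<kappa> k) (indicator {?a + ?d<..?a + ?d + ?d}))"
          unfolding Suc by (simp only:) (rule L1_diff_le; measurable)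
        also have "\<dots> \<le> ennreal (2 * C / 2 ^ k) + ennreal (2 * C / 2 ^ k)" by (intro add_mono interval) auto
        also have "\<dots> = ennreal (4 * C / 2 ^ k)" using C0 by (simp add: ennreal_plus[symmetric] del: ennreal_plus)
        finally show ?thesis .
      qed
    qed
    show "L1 (conv (kern (dyadic_part \<phi>\<^sub>0 k)) (chaar i m)) \<le> ennreal (4 * C * gain (real k - real i) / 2 ^ k)"
    proof (cases "k \<le> i")
      case True
      then have "4 * C * gain (real k - real i) / 2 ^ k = 4 * C / 2 ^ i"
        by (simp add: gain_nonpos powr_diff powr_realpow)
      then show ?thesis using fine by (simp add: \<kappa>_def)
    next
      case False
      then show ?thesis using coarse by (simp add: \<kappa>_def gain_nonneg_arg)
    qed
  qed
qed

section \<open>Regular distributions on the square and their Fourier blocks\<close>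

lemma integrable_lborel_tensor:
  fixes f :: "'a::euclidean_space \<Rightarrow> complex" and g :: "'b::euclidean_space \<Rightarrow> complex"
  assumes "integrable lborel f" "integrable lborel g"
  shows "integrable lborel (\<lambda>z. f (fst z) * g (snd z))"
  using integrable_tensor[OF assms, of "\<lambda>_. 1" 1] by (simp add: lborel_prod case_prod_unfold)

lemma integral_lborel_tensor:
  fixes f :: "'a::euclidean_space \<Rightarrow> complex" and g :: "'b::euclidean_space \<Rightarrow> complex"
  assumes "integrable lborel f" "integrable lborel g"
  shows "(LINT z|lborel. f (fst z) * g (snd z)) = (LINT x|lborel. f x) * (LINT y|lborel. g y)"
proof -
  have "integrable (lborel \<Otimes>\<^sub>M lborel) (\<lambda>z. f (fst z) * g (snd z))"
    using integrable_lborel_tensor[OF assms] by (simp add: lborel_prod)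
  from lborel_pair.integral_fst'[OF this] show ?thesis
    by (simp add: lborel_prod)
qed

lemma L1_tensor:
  fixes f :: "'a::euclidean_space \<Rightarrow> complex" and g :: "'b::euclidean_space \<Rightarrow> complex"
  assumes [measurable]: "f \<in> borel_measurable borel" "g \<in> borel_measurable borel"
  shows "L1 (\<lambda>z. f (fst z) * g (snd z)) = L1 f * L1 g"
proof -
  have "L1 (\<lambda>z. f (fst z) * g (snd z)) = (\<integral>\<^sup>+z. ennreal (norm (f (fst z))) * ennreal (norm (g (snd z))) \<partial>(lborel \<Otimes>\<^sub>M lborel))"
    unfolding L1_def lborel_prod by (simp add: norm_mult ennreal_mult)
  also have "\<dots> = (\<integral>\<^sup>+x. \<integral>\<^sup>+y. ennreal (norm (f x)) * ennreal (norm (g y)) \<partial>lborel \<partial>lborel)"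
    by (subst lborel.nn_integral_fst[symmetric]) simp_all
  also have "\<dots> = L1 f * L1 g"
    unfolding L1_def by (simp add: nn_integral_cmult nn_integral_multc)
  finally show ?thesis .
qed

lemma smooth_continuous: "smooth \<phi> \<Longrightarrow> continuous_on UNIV \<phi>"
  unfolding smooth_def
  by (auto intro!: continuous_at_imp_continuous_on differentiable_imp_continuous_within dest!: spec[of _ "[]"])

lemma schwartz_measurable: "\<phi> \<in> schwartz \<Longrightarrow> \<phi> \<in> borel_measurable borel"
  by (auto simp: schwartz_def intro: borel_measurable_continuous_onI smooth_continuous)

text \<open>Compare with \<open>1 / ((1 + x\<^sup>2) (1 + y\<^sup>2))\<close>, using the Schwartz bounds with exponents \<open>0\<close> and \<open>4\<close>.\<close>
lemma schwartz_integrable: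
  fixes \<phi> :: "real \<times> real \<Rightarrow> complex"
  assumes "\<phi> \<in> schwartz"
  shows "integrable lborel \<phi>"
proof -
  have "\<exists>B. \<forall>x. norm x ^ m * norm (\<phi> x) \<le> B" for m
  proof -
    have "\<forall>m bs. set bs \<subseteq> Basis \<longrightarrow> (\<exists>B. \<forall>x. norm x ^ m * norm (partials bs \<phi> x) \<le> B)"
      using assms by (simp add: schwartz_def)
    from this[rule_format, of "[]" m] show ?thesis by simp
  qed
  then obtain B0 B4 where "\<And>x. norm x ^ 0 * norm (\<phi> x) \<le> B0" and B4: "\<And>x. norm x ^ 4 * norm (\<phi> x) \<le> B4"
    by metis
  then have B0: "\<And>x. norm (\<phi> x) \<le> B0" by simp
  define f where "f x = complex_of_real (inverse (1 + x\<^sup>2))" for x :: real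
  have norm_f: "norm (f t) = inverse (1 + t\<^sup>2)" for t
    unfolding f_def norm_of_real by (simp add: add_nonneg_nonneg)
  have f: "integrable lborel f" unfolding f_def by (intro integrable_of_real integrable_inverse_square)
  have "integrable lborel (\<lambda>z. of_real (2 * (B0 + B4)) * (f (fst z) * f (snd z)))"
    by (intro integrable_mult_right integrable_lborel_tensor f)
  then show ?thesis
  proof (rule Bochner_Integration.integrable_bound)
    show "\<phi> \<in> borel_measurable lborel" using schwartz_measurable[OF assms] by simp
    show "AE z in lborel. norm (\<phi> z) \<le> norm (of_real (2 * (B0 + B4)) * (f (fst z) * f (snd z)))"
    proof (rule AE_I2)
      fix z :: "real \<times> real"
      obtain x y where z: "z = (x, y)" by (cases z)
      let ?a = "1 + x\<^sup>2" and ?b = "1 + y\<^sup>2"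
      have ab: "0 < ?a" "0 < ?b" by (simp_all add: add_pos_nonneg)
      have n: "norm z ^ 2 = x\<^sup>2 + y\<^sup>2" by (simp add: z norm_Pair)
      have n4: "norm z ^ 4 = (x\<^sup>2 + y\<^sup>2)\<^sup>2" unfolding n[symmetric] by simp
      \<comment> \<open>This is \<open>2 \<bar>z\<bar>\<^sup>2 \<le> 1 + \<bar>z\<bar>\<^sup>4\<close>, in Cartesian coordinates.\<close>
      have "0 \<le> (x\<^sup>2 + y\<^sup>2 - 1)\<^sup>2" "0 \<le> x\<^sup>2 * x\<^sup>2" "0 \<le> y\<^sup>2 * y\<^sup>2" "0 \<le> x\<^sup>2 * y\<^sup>2" by simp_all
      then have "?a * ?b \<le> 2 + 2 * norm z ^ 4"
        unfolding n4 by (simp add: power2_eq_square algebra_simps)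
      then have "?a * ?b * norm (\<phi> z) \<le> (2 + 2 * norm z ^ 4) * norm (\<phi> z)" by (rule mult_right_mono) simp
      also have "\<dots> \<le> 2 * (B0 + B4)" using B0[of z] B4[of z] by (simp add: algebra_simps)
      finally have "norm (\<phi> z) \<le> 2 * (B0 + B4) * (inverse ?a * inverse ?b)"
      proof -
        have "n \<le> c * (inverse a * inverse b)" if "0 < a" "0 < b" "a * b * n \<le> c" for a b c n :: real
          using that by (simp add: field_simps)
        then show "?a * ?b * norm (\<phi> z) \<le> 2 * (B0 + B4) \<Longrightarrow> ?thesis" using ab by blast
      qed
      also have "\<dots> \<le> \<bar>2 * (B0 + B4)\<bar> * (inverse ?a * inverse ?b)"
        using ab by (intro mult_right_mono) auto
      finally show "norm (\<phi> z) \<le> norm (of_real (2 * (B0 + B4)) * (f (fst z) * f (snd z)))"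
        by (simp only: norm_mult norm_of_real norm_f z fst_conv snd_conv)
    qed
  qed
qed

definition zero_extend :: "(real \<times> real \<Rightarrow> real) \<Rightarrow> real \<times> real \<Rightarrow> complex" where
  "zero_extend D t = indicator unit_square t * of_real (D t)"

lemma regular_distribution_eq: "regular_distribution D \<phi> = (LINT t|lborel. zero_extend D t * \<phi> t)"
  unfolding regular_distribution_def set_lebesgue_integral_def zero_extend_def
  by (intro Bochner_Integration.integral_cong) (auto simp: indicator_def)

lemma unit_square_borel [measurable]: "unit_square \<in> sets borel"
  unfolding unit_square_def by (intro borel_Times) auto

lemma emeasure_unit_square: "emeasure lborel unit_square = 1"
proof -
  have "emeasure lborel unit_square = emeasure (lborel \<Otimes>\<^sub>M lborel) ({0..<1::real} \<times> {0..<1::real})"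
    by (simp add: unit_square_def lborel_prod)
  also have "\<dots> = 1" by (subst lborel.emeasure_pair_measure_Times) auto
  finally show ?thesis .
qed

locale bounded_function =
  fixes D :: "real \<times> real \<Rightarrow> real" and M :: real
  assumes D_measurable [measurable]: "D \<in> borel_measurable borel"
    and D_bound: "\<And>t. t \<in> unit_square \<Longrightarrow> \<bar>D t\<bar> \<le> M"
begin

lemma zero_extend_measurable [measurable]: "zero_extend D \<in> borel_measurable borel"
  unfolding zero_extend_def[abs_def] by measurable

lemma M_nonneg: "0 \<le> M"
  using D_bound[of "(0, 0)"] by (simp add: unit_square_def)

lemma norm_zero_extend: "norm (zero_extend D t) \<le> M * indicator unit_square t"
  using D_bound[of t] by (auto simp: zero_extend_def indicator_def)

lemma norm_zero_extend': "norm (zero_extend D t) \<le> M"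
  using norm_zero_extend[of t] M_nonneg by (cases "t \<in> unit_square") simp_all

lemma zero_extend_integrable: "integrable lborel (zero_extend D)"
proof (rule Bochner_Integration.integrable_bound)
  show "integrable lborel (\<lambda>t. M * indicator unit_square t)"
    by (intro integrable_mult_right integrable_real_indicator) (auto simp: emeasure_unit_square)
  show "AE t in lborel. norm (zero_extend D t) \<le> norm (M * indicator unit_square t)"
    by (rule AE_I2, simp only: real_norm_def) (rule order_trans[OF norm_zero_extend abs_ge_self])
qed simp

lemma zero_extend_mult_integrable:
  assumes "integrable lborel \<phi>"
  shows "integrable lborel (\<lambda>t. zero_extend D t * \<phi> t)"
proof (rule Bochner_Integration.integrable_bound[OF integrable_mult_right[OF assms, of "of_real M"]])
  show "(\<lambda>t. zero_extend D t * \<phi> t) \<in> borel_measurable lborel"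
    using borel_measurable_integrable[OF assms] by simp
  show "AE t in lborel. norm (zero_extend D t * \<phi> t) \<le> norm (of_real M * \<phi> t)"
    using norm_zero_extend' M_nonneg by (auto simp: norm_mult intro!: mult_right_mono)
qed

text \<open>Convergence to zero in the Schwartz space implies uniform convergence to zero, and the function is integrable.\<close>
lemma regular_distribution_tempered: "regular_distribution D \<in> tempered"
  unfolding tempered_def
proof (intro CollectI conjI ballI allI impI)
  fix \<phi> \<psi> :: "real \<times> real \<Rightarrow> complex" and a b
  assume s: "\<phi> \<in> schwartz" "\<psi> \<in> schwartz"
  have i: "integrable lborel (\<lambda>t. zero_extend D t * \<phi> t)" "integrable lborel (\<lambda>t. zero_extend D t * \<psi> t)"
    by (rule zero_extend_mult_integrable[OF schwartz_integrable], rule s)+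
  have "(\<lambda>t. zero_extend D t * (a * \<phi> t + b * \<psi> t)) = (\<lambda>t. a * (zero_extend D t * \<phi> t) + b * (zero_extend D t * \<psi> t))"
    by (auto simp: algebra_simps)
  then show "regular_distribution D (\<lambda>x. a * \<phi> x + b * \<psi> x) = a * regular_distribution D \<phi> + b * regular_distribution D \<psi>"
    unfolding regular_distribution_eq
    using Bochner_Integration.integral_add[OF integrable_mult_right[OF i(1), of a] integrable_mult_right[OF i(2), of b]]
    by (simp only: integral_mult_right_zero)
next
  fix \<phi> :: "nat \<Rightarrow> real \<times> real \<Rightarrow> complex"
  assume null: "schwartz_null \<phi>"
  then have s: "\<And>j. \<phi> j \<in> schwartz" by (simp add: schwartz_null_def)
  have "uniform_limit UNIV (\<lambda>j x. norm x ^ 0 * norm (partials [] (\<phi> j) x)) (\<lambda>_. 0) sequentially"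
  proof -
    have "\<forall>m bs. set bs \<subseteq> Basis \<longrightarrow>
        uniform_limit UNIV (\<lambda>j x. norm x ^ m * norm (partials bs (\<phi> j) x)) (\<lambda>_. 0) sequentially"
      using null[unfolded schwartz_null_def] by (rule conjunct2)
    from this[rule_format, of "[]" 0] show ?thesis by (simp only: list.set empty_subsetI)
  qed
  then have u: "uniform_limit UNIV (\<lambda>j x. norm (\<phi> j x)) (\<lambda>_. 0) sequentially" by simp
  show "(\<lambda>j. regular_distribution D (\<phi> j)) \<longlonglongrightarrow> 0"
  proof (rule tendstoI)
    fix e :: real assume "e > 0"
    define d where "d = e / (2 * (M + 1))"
    have d: "d > 0" "M * d < e"
    proof -
      show "d > 0" using \<open>e > 0\<close> M_nonneg by (simp add: d_def)
      have "M * d \<le> (M + 1) * d" using \<open>d > 0\<close> by simp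
      also have "\<dots> = e / 2" using M_nonneg by (simp add: d_def field_simps)
      finally show "M * d < e" using \<open>e > 0\<close> by simp
    qed
    have "\<forall>\<^sub>F j in sequentially. \<forall>x. norm (\<phi> j x) < d"
      using uniform_limitD[OF u d(1)] by (simp add: dist_norm)
    then show "\<forall>\<^sub>F j in sequentially. dist (regular_distribution D (\<phi> j)) 0 < e"
    proof eventually_elim
      case (elim j)
      have "norm (regular_distribution D (\<phi> j)) \<le> (LINT t|lborel. norm (zero_extend D t * \<phi> j t))"
        unfolding regular_distribution_eq by (rule integral_norm_bound)
      also have "\<dots> \<le> (LINT t|lborel. M * d * indicator unit_square t)"
      proof (rule integral_mono)
        show "integrable lborel (\<lambda>t. norm (zero_extend D t * \<phi> j t))"
          by (intro integrable_norm zero_extend_mult_integrable schwartz_integrable s)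
        show "integrable lborel (\<lambda>t. M * d * indicator unit_square t)"
          by (intro integrable_mult_right integrable_real_indicator) (auto simp: emeasure_unit_square)
        fix t
        have "norm (zero_extend D t * \<phi> j t) \<le> (M * indicator unit_square t) * d"
          unfolding norm_mult using elim[rule_format, of t] M_nonneg
          by (intro mult_mono norm_zero_extend) auto
        then show "norm (zero_extend D t * \<phi> j t) \<le> M * d * indicator unit_square t" by (simp add: mult_ac)
      qed
      also have "\<dots> = M * d" by (simp add: measure_def emeasure_unit_square)
      finally show ?case using d by simp
    qed
  qed
qed

end

text \<open>The kernel of a tensor product multiplier.\<close>
definition kern2 :: "(real \<Rightarrow> complex) \<Rightarrow> (real \<Rightarrow> complex) \<Rightarrow> real \<times> real \<Rightarrow> complex" where
  "kern2 \<eta> \<eta>' z = kern \<eta> (fst z) * kern \<eta>' (snd z)"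

lemma measurable_fst_borel [measurable]: "(fst :: real \<times> real \<Rightarrow> real) \<in> borel_measurable borel"
  by (rule borel_measurable_continuous_onI[OF continuous_on_fst[OF continuous_on_id]])

lemma measurable_snd_borel [measurable]: "(snd :: real \<times> real \<Rightarrow> real) \<in> borel_measurable borel"
  by (rule borel_measurable_continuous_onI[OF continuous_on_snd[OF continuous_on_id]])

lemma measurable_kern2:
  assumes [measurable]: "\<eta> \<in> borel_measurable borel" "\<eta>' \<in> borel_measurable borel"
  shows "kern2 \<eta> \<eta>' \<in> borel_measurable borel"
  unfolding kern2_def[abs_def] by measurable

lemma cis_inner_plane: "cis (z \<bullet> \<xi>) = cis (fst z * fst \<xi>) * cis (snd z * snd \<xi>)"
  by (cases z; cases \<xi>) (simp add: cis_mult)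

lemma kern2_eq:
  assumes "continuous_on UNIV \<eta>" "bounded_support \<eta>" "continuous_on UNIV \<eta>'" "bounded_support \<eta>'"
  shows "kern2 \<eta> \<eta>' z = of_real (1 / (2 * pi) ^ 2) * (LINT \<xi>|lborel. \<eta> (fst \<xi>) * \<eta>' (snd \<xi>) * cis (z \<bullet> \<xi>))"
proof -
  have "(LINT \<xi>|lborel. \<eta> (fst \<xi>) * \<eta>' (snd \<xi>) * cis (z \<bullet> \<xi>))
      = (LINT \<xi>|lborel. (\<eta> (fst \<xi>) * cis (fst z * fst \<xi>)) * (\<eta>' (snd \<xi>) * cis (snd z * snd \<xi>)))"
    by (simp add: cis_inner_plane mult_ac)
  also have "\<dots> = (LINT x|lborel. \<eta> x * cis (fst z * x)) * (LINT y|lborel. \<eta>' y * cis (snd z * y))"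
    by (intro integral_lborel_tensor integrable_bump_cis assms)
  finally show ?thesis by (simp add: kern2_def kern_def power2_eq_square)
qed

lemma two_pi_powr: "(2 * pi) powr (- real DIM(real \<times> real) / 2) = 1 / (2 * pi)"
  by (simp add: powr_minus_divide)

text \<open>The Fourier multiplier acting on a test function, written as an integral operator: exchanging the
integrals turns the composition of the two transforms into the kernel of the multiplier.\<close>
lemma fourier_mult_inv_fourier:
  fixes \<phi> :: "real \<times> real \<Rightarrow> complex"
  assumes \<eta>: "continuous_on UNIV \<eta>" "bounded_support \<eta>" "continuous_on UNIV \<eta>'" "bounded_support \<eta>'"
    and \<phi>: "integrable lborel \<phi>"
  shows "fourier (\<lambda>\<xi>. \<eta> (fst \<xi>) * \<eta>' (snd \<xi>) * inv_fourier \<phi> \<xi>) x = (LINT y|lborel. \<phi> y * kern2 \<eta> \<eta>' (y - x))"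
proof -
  define \<Phi> where "\<Phi> \<xi> = \<eta> (fst \<xi>) * \<eta>' (snd \<xi>)" for \<xi> :: "real \<times> real"
  have \<Phi>: "integrable lborel \<Phi>"
    unfolding \<Phi>_def by (intro integrable_lborel_tensor integrable_bump \<eta>)
  have [measurable]: "cis \<in> borel_measurable borel"
    by (intro borel_measurable_continuous_onI continuous_intros)
  let ?c = "complex_of_real (1 / (2 * pi))"
  have "fourier (\<lambda>\<xi>. \<Phi> \<xi> * inv_fourier \<phi> \<xi>) x
      = ?c * (LINT \<xi>|lborel. ?c * (LINT y|lborel. \<Phi> \<xi> * \<phi> y * cis ((y - x) \<bullet> \<xi>)))"
  proof -
    have "\<Phi> \<xi> * inv_fourier \<phi> \<xi> * cis (- (\<xi> \<bullet> x)) = ?c * (LINT y|lborel. \<Phi> \<xi> * \<phi> y * cis ((y - x) \<bullet> \<xi>))" for \<xi>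
    proof -
      have "(LINT y|lborel. \<Phi> \<xi> * \<phi> y * cis ((y - x) \<bullet> \<xi>)) = (LINT y|lborel. (\<Phi> \<xi> * cis (- (\<xi> \<bullet> x))) * (\<phi> y * cis (\<xi> \<bullet> y)))"
      proof -
        have "cis ((y - x) \<bullet> \<xi>) = cis (- (\<xi> \<bullet> x)) * cis (\<xi> \<bullet> y)" for y
          by (simp add: cis_mult inner_diff_left inner_diff_right inner_commute)
        then show ?thesis by (simp add: mult_ac)
      qed
      then show ?thesis by (simp add: inv_fourier_def two_pi_powr inner_commute)
    qed
    then show ?thesis by (simp only: fourier_def two_pi_powr)
  qed
  also have "\<dots> = ?c * ?c * (LINT \<xi>|lborel. LINT y|lborel. \<Phi> \<xi> * \<phi> y * cis ((y - x) \<bullet> \<xi>))" by simp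
  also have "(LINT \<xi>|lborel. LINT y|lborel. \<Phi> \<xi> * \<phi> y * cis ((y - x) \<bullet> \<xi>))
      = (LINT y|lborel. LINT \<xi>|lborel. \<Phi> \<xi> * \<phi> y * cis ((y - x) \<bullet> \<xi>))"
  proof (rule lborel_pair.Fubini_integral[symmetric])
    show "integrable (lborel \<Otimes>\<^sub>M lborel) (\<lambda>(\<xi>, y). \<Phi> \<xi> * \<phi> y * cis ((y - x) \<bullet> \<xi>))"
      using integrable_tensor[OF \<Phi> \<phi>, of "\<lambda>z. cis ((snd z - x) \<bullet> fst z)" 1] by simp
  qed
  also have "\<dots> = (LINT y|lborel. \<phi> y * (LINT \<xi>|lborel. \<Phi> \<xi> * cis ((y - x) \<bullet> \<xi>)))"
  proof -
    have "\<Phi> \<xi> * \<phi> y * cis ((y - x) \<bullet> \<xi>) = \<phi> y * (\<Phi> \<xi> * cis ((y - x) \<bullet> \<xi>))" for y \<xi> by (simp only: mult_ac)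
    then show ?thesis by (simp only: integral_mult_right_zero)
  qed
  also have "?c * ?c * \<dots> = (LINT y|lborel. ?c * ?c * (\<phi> y * (LINT \<xi>|lborel. \<Phi> \<xi> * cis ((y - x) \<bullet> \<xi>))))"
    by (simp only: integral_mult_right_zero)
  also have "\<dots> = (LINT y|lborel. \<phi> y * kern2 \<eta> \<eta>' (y - x))"
  proof -
    have "?c * ?c * (\<phi> y * (LINT \<xi>|lborel. \<Phi> \<xi> * cis ((y - x) \<bullet> \<xi>))) = \<phi> y * kern2 \<eta> \<eta>' (y - x)" for y
      unfolding kern2_eq[OF \<eta>] \<Phi>_def by (simp add: power2_eq_square)
    then show ?thesis by (simp only:)
  qed
  finally show ?thesis unfolding \<Phi>_def .
qed

text \<open>The operator of \<open>fourier_mult_inv_fourier\<close> has the transposed kernel of the convolution.\<close>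
lemma (in bounded_function) block_represented:
  assumes \<eta>: "continuous_on UNIV \<eta>" "bounded_support \<eta>" "continuous_on UNIV \<eta>'" "bounded_support \<eta>'"
  shows "represents (conv (kern2 \<eta> \<eta>') (zero_extend D))
    (dist_inv_fourier (dist_mult (\<lambda>\<xi>. \<eta> (fst \<xi>) * \<eta>' (snd \<xi>)) (dist_fourier (regular_distribution D))))"
  unfolding represents_def
proof (intro conjI ballI)
  have [measurable]: "\<eta> \<in> borel_measurable borel" "\<eta>' \<in> borel_measurable borel"
    using \<eta> by (auto intro: continuous_measurable)
  have [measurable]: "kern2 \<eta> \<eta>' \<in> borel_measurable borel"
    by (rule measurable_kern2) measurable
  show "conv (kern2 \<eta> \<eta>') (zero_extend D) \<in> borel_measurable lborel" by simp
  fix \<phi> :: "real \<times> real \<Rightarrow> complex" assume "\<phi> \<in> schwartz"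
  then have \<phi>: "integrable lborel \<phi>" by (rule schwartz_integrable)
  define B where "B = (\<integral>\<xi>. norm (\<eta> \<xi>) \<partial>lborel) * (\<integral>\<xi>. norm (\<eta>' \<xi>) \<partial>lborel)"
  have B: "norm (kern2 \<eta> \<eta>' z) \<le> B" for z
    unfolding kern2_def B_def norm_mult
    by (intro mult_mono norm_kern_le integrable_bump \<eta>) auto
  have int: "integrable (lborel \<Otimes>\<^sub>M lborel) (\<lambda>(y, x). \<phi> y * zero_extend D x * kern2 \<eta> \<eta>' (y - x))"
    using integrable_tensor[OF \<phi> zero_extend_integrable, of "\<lambda>z. kern2 \<eta> \<eta>' (fst z - snd z)" B] B by simp
  have u: "(LINT x|lborel. \<phi> y * zero_extend D x * kern2 \<eta> \<eta>' (y - x)) = conv (kern2 \<eta> \<eta>') (zero_extend D) y * \<phi> y" for y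
  proof -
    have "\<phi> y * zero_extend D x * kern2 \<eta> \<eta>' (y - x) = \<phi> y * (kern2 \<eta> \<eta>' (y - x) * zero_extend D x)" for x by (simp only: mult_ac)
    then show ?thesis unfolding conv_def by (simp only: integral_mult_right_zero mult.commute)
  qed
  show "integrable lborel (\<lambda>y. conv (kern2 \<eta> \<eta>') (zero_extend D) y * \<phi> y)"
    using lborel_pair.integrable_fst[OF int] by (simp add: u)
  have "dist_inv_fourier (dist_mult (\<lambda>\<xi>. \<eta> (fst \<xi>) * \<eta>' (snd \<xi>)) (dist_fourier (regular_distribution D))) \<phi>
      = (LINT x|lborel. zero_extend D x * (LINT y|lborel. \<phi> y * kern2 \<eta> \<eta>' (y - x)))"
    unfolding dist_inv_fourier_def dist_mult_def dist_fourier_def regular_distribution_eq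
      fourier_mult_inv_fourier[OF \<eta> \<phi>] ..
  also have "\<dots> = (LINT x|lborel. LINT y|lborel. \<phi> y * zero_extend D x * kern2 \<eta> \<eta>' (y - x))"
  proof -
    have "\<phi> y * zero_extend D x * kern2 \<eta> \<eta>' (y - x) = zero_extend D x * (\<phi> y * kern2 \<eta> \<eta>' (y - x))" for x y by (simp only: mult_ac)
    then show ?thesis by (simp only: integral_mult_right_zero)
  qed
  also have "\<dots> = (LINT y|lborel. LINT x|lborel. \<phi> y * zero_extend D x * kern2 \<eta> \<eta>' (y - x))"
    by (rule lborel_pair.Fubini_integral[OF int])
  finally show "dist_inv_fourier (dist_mult (\<lambda>\<xi>. \<eta> (fst \<xi>) * \<eta>' (snd \<xi>)) (dist_fourier (regular_distribution D))) \<phi>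
      = (LINT y|lborel. conv (kern2 \<eta> \<eta>') (zero_extend D) y * \<phi> y)"
    unfolding u .
qed

section \<open>Lebesgue and Besov norms\<close>

lemma ennreal_powr_le:
  assumes "X \<le> ennreal a" "0 \<le> a" "0 \<le> s"
  shows "ennreal_powr X s \<le> ennreal (a powr s)"
proof -
  have "X \<noteq> \<infinity>" using assms(1) by (auto simp: top_unique)
  moreover have "enn2real X \<le> a" using assms by (simp add: enn2real_leI)
  ultimately show ?thesis using assms by (auto simp: ennreal_powr_def intro!: ennreal_leI powr_mono2)
qed

lemma finite_exponent:
  assumes "1 \<le> (p :: ennreal)" "p \<noteq> \<infinity>"
  shows "1 \<le> enn2real p" "enn2real (1 / p) = 1 / enn2real p"
proof -
  obtain P where P: "p = ennreal P" "0 \<le> P" using assms(2) by (cases p) auto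
  have "ennreal 1 \<le> ennreal P" using assms(1) P by simp
  then have P1: "1 \<le> P" using P by (simp only: ennreal_le_iff)
  then show "1 \<le> enn2real p" using P by simp
  have "1 / p = ennreal (1 / P)" using P P1 divide_ennreal[of 1 P] by simp
  then show "enn2real (1 / p) = 1 / enn2real p" using P P1 by simp
qed

text \<open>For finite \<open>p\<close> this is \<open>\<bar>u\<bar>\<^sup>p \<le> a\<^bsup>p-1\<^esup> \<bar>u\<bar>\<close>. Strict positivity of \<open>b\<close> matters for \<open>p = \<infinity>\<close>, where the
factor \<open>b powr 0\<close> has to be \<open>1\<close>.\<close>
lemma Lp_norm_interpolation:
  assumes p: "1 \<le> p" and [measurable]: "u \<in> borel_measurable borel"
    and sup: "\<And>x. norm (u x) \<le> a" and L1: "L1 u \<le> ennreal b" and pos: "0 < a" "0 < b"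
  defines "\<theta> \<equiv> enn2real (1 / p)"
  shows "Lp_norm p u \<le> ennreal (a powr (1 - \<theta>) * b powr \<theta>)"
proof (cases "p = \<infinity>")
  case True
  then have "\<theta> = 0" by (simp add: \<theta>_def)
  have "esssup lborel (\<lambda>x. ennreal (norm (u x))) \<le> ennreal a"
    by (rule esssup_I) (auto intro: ennreal_leI sup)
  then show ?thesis using True pos \<open>\<theta> = 0\<close> by (simp add: Lp_norm_def)
next
  case False
  define P where "P = enn2real p"
  have P: "1 \<le> P" "\<theta> = 1 / P" using finite_exponent[OF p False] by (simp_all add: P_def \<theta>_def)
  have "norm (u x) powr P \<le> a powr (P - 1) * norm (u x)" for x
  proof (cases "u x = 0")
    case False
    have "norm (u x) powr P = norm (u x) powr (P - 1) * norm (u x)"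
      using False powr_add[of "norm (u x)" "P - 1" 1] by simp
    also have "\<dots> \<le> a powr (P - 1) * norm (u x)"
      using P by (intro mult_right_mono powr_mono2 sup) auto
    finally show ?thesis .
  qed simp
  then have "(\<integral>\<^sup>+x. ennreal (norm (u x) powr P) \<partial>lborel) \<le> (\<integral>\<^sup>+x. ennreal (a powr (P - 1)) * ennreal (norm (u x)) \<partial>lborel)"
    by (intro nn_integral_mono) (simp add: ennreal_mult[symmetric] ennreal_leI)
  also have "\<dots> = ennreal (a powr (P - 1)) * L1 u"
    unfolding L1_def by (rule nn_integral_cmult) measurable
  also have "\<dots> \<le> ennreal (a powr (P - 1)) * ennreal b"
    by (intro mult_left_mono L1) simp
  also have "\<dots> = ennreal (a powr (P - 1) * b)" using pos by (simp add: ennreal_mult)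
  finally have "ennreal_powr (\<integral>\<^sup>+x. ennreal (norm (u x) powr P) \<partial>lborel) (1 / P) \<le> ennreal ((a powr (P - 1) * b) powr (1 / P))"
    using pos P by (intro ennreal_powr_le) auto
  also have "(a powr (P - 1) * b) powr (1 / P) = a powr (1 - \<theta>) * b powr \<theta>"
    using pos P by (simp add: powr_mult powr_powr diff_divide_distrib)
  finally show ?thesis using False by (simp add: Lp_norm_def P_def)
qed

text \<open>The constant \<open>K\<close> depends on the rate \<open>\<eta>\<close> and on \<open>q\<close> only, so that it is uniform in \<open>n\<close> and in the
distribution.\<close>
lemma besov_norm_diagonal_decay:
  assumes q: "1 \<le> q" and \<eta>: "0 < \<eta>"
  obtains K where "K > 0" "\<And>\<phi>\<^sub>0 p r f B n. 0 \<le> B \<Longrightarrow>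
    (\<And>k l. besov_block \<phi>\<^sub>0 p r f (k, l) \<le> ennreal (B * 2 powr (- \<eta> * \<bar>real (k + l) - real n\<bar>))) \<Longrightarrow>
    besov_norm \<phi>\<^sub>0 p q r f \<le> ennreal (B * (K * (real n + 1)) powr enn2real (1 / q))"
proof (cases "q = \<infinity>")
  case True
  show thesis
  proof (rule that[of 1])
    fix \<phi>\<^sub>0 p r f and B :: real and n
    assume B: "0 \<le> B" and block: "\<And>k l. besov_block \<phi>\<^sub>0 p r f (k, l) \<le> ennreal (B * 2 powr (- \<eta> * \<bar>real (k + l) - real n\<bar>))"
    have "besov_block \<phi>\<^sub>0 p r f kl \<le> ennreal B" for kl
    proof -
      obtain k l where kl: "kl = (k, l)" by (cases kl)
      have "2 powr (- \<eta> * \<bar>real (k + l) - real n\<bar>) \<le> 2 powr 0" using \<eta> by (intro powr_mono) auto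
      then have "B * 2 powr (- \<eta> * \<bar>real (k + l) - real n\<bar>) \<le> B * 1" using B by (intro mult_left_mono) auto
      then show ?thesis unfolding kl using block[of k l] by (metis ennreal_leI mult_1_right order_trans)
    qed
    then have "(SUP k. besov_block \<phi>\<^sub>0 p r f k) \<le> ennreal B" by (rule SUP_least)
    then show "besov_norm \<phi>\<^sub>0 p q r f \<le> ennreal (B * (1 * (real n + 1)) powr enn2real (1 / q))"
      using True by (simp add: besov_norm_def)
  qed simp
next
  case False
  define Q where "Q = enn2real q"
  have Q: "1 \<le> Q" "enn2real (1 / q) = 1 / Q" using finite_exponent[OF q False] by (simp_all add: Q_def)
  define c where "c = 2 / (1 - 2 powr (- (\<eta> * Q)))"
  have \<eta>Q: "0 < \<eta> * Q" using \<eta> Q by simp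
  have c: "0 < c" using powr_less_mono[of "- (\<eta> * Q)" 0 2] \<eta>Q by (simp add: c_def)
  show thesis
  proof (rule that[of "c + c\<^sup>2"])
    show K: "c + c\<^sup>2 > 0" using c by (simp add: add_pos_pos)
    fix \<phi>\<^sub>0 p r f and B :: real and n
    assume B: "0 \<le> B" and block: "\<And>k l. besov_block \<phi>\<^sub>0 p r f (k, l) \<le> ennreal (B * 2 powr (- \<eta> * \<bar>real (k + l) - real n\<bar>))"
    let ?K = "(c + c\<^sup>2) * (real n + 1)"
    have "(\<Sum>\<^sub>\<infinity>k\<in>UNIV. ennreal_powr (besov_block \<phi>\<^sub>0 p r f k) Q) \<le> ennreal (B powr Q * ?K)"
    proof (rule infsum_le_finite_sums)
      show "(\<lambda>k. ennreal_powr (besov_block \<phi>\<^sub>0 p r f k) Q) summable_on UNIV" by (rule nonneg_summable_on_complete) simp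
      fix F :: "(nat \<times> nat) set" assume F: "finite F"
      have "(\<Sum>k\<in>F. ennreal_powr (besov_block \<phi>\<^sub>0 p r f k) Q)
          \<le> (\<Sum>k\<in>F. ennreal (B powr Q * (case k of (k, l) \<Rightarrow> 2 powr (- (\<eta> * Q) * \<bar>real (k + l) - real n\<bar>))))"
      proof (rule sum_mono)
        fix kl :: "nat \<times> nat"
        obtain k l where kl: "kl = (k, l)" by (cases kl)
        have "ennreal_powr (besov_block \<phi>\<^sub>0 p r f (k, l)) Q \<le> ennreal ((B * 2 powr (- \<eta> * \<bar>real (k + l) - real n\<bar>)) powr Q)"
          using block[of k l] B Q by (intro ennreal_powr_le) auto
        also have "(B * 2 powr (- \<eta> * \<bar>real (k + l) - real n\<bar>)) powr Q = B powr Q * 2 powr (- (\<eta> * Q) * \<bar>real (k + l) - real n\<bar>)"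
          using B by (simp add: powr_mult powr_powr mult_ac)
        finally show "ennreal_powr (besov_block \<phi>\<^sub>0 p r f kl) Q
            \<le> ennreal (B powr Q * (case kl of (k, l) \<Rightarrow> 2 powr (- (\<eta> * Q) * \<bar>real (k + l) - real n\<bar>)))"
          unfolding kl by simp
      qed
      also have "\<dots> = ennreal (B powr Q * (\<Sum>(k, l)\<in>F. 2 powr (- (\<eta> * Q) * \<bar>real (k + l) - real n\<bar>)))"
        unfolding sum_distrib_left by (rule sum_ennreal) (auto split: prod.split)
      also have "\<dots> \<le> ennreal (B powr Q * ?K)"
        unfolding c_def by (intro ennreal_leI mult_left_mono sum_diagonal_decay[OF \<eta>Q F]) simp
      finally show "(\<Sum>k\<in>F. ennreal_powr (besov_block \<phi>\<^sub>0 p r f k) Q) \<le> ennreal (B powr Q * ?K)" .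
    qed
    then have "ennreal_powr (\<Sum>\<^sub>\<infinity>k\<in>UNIV. ennreal_powr (besov_block \<phi>\<^sub>0 p r f k) Q) (1 / Q) \<le> ennreal ((B powr Q * ?K) powr (1 / Q))"
      using K Q by (intro ennreal_powr_le) auto
    also have "(B powr Q * ?K) powr (1 / Q) = B * ?K powr (1 / Q)"
      using K Q B by (subst powr_mult) (auto simp: powr_powr)
    finally show "besov_norm \<phi>\<^sub>0 p q r f \<le> ennreal (B * ?K powr enn2real (1 / q))"
      using False Q by (simp add: besov_norm_def Q_def)
  qed
qed

section \<open>Blocks of the discrepancy\<close>

lemma measurable_local_discrepancy [measurable]: "local_discrepancy P \<in> borel_measurable borel"
proof -
  have [measurable]: "(fst :: real \<times> real \<Rightarrow> real) \<in> borel_measurable borel" "(snd :: real \<times> real \<Rightarrow> real) \<in> borel_measurable borel"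
    by (simp_all add: borel_measurable_continuous_onI continuous_on_fst continuous_on_snd)
  have "(\<lambda>t. \<Sum>z\<in>#P. indicator ({0..<fst t} \<times> {0..<snd t}) z :: real) \<in> borel_measurable borel"
  proof (induction P)
    case (add z P)
    have "(\<lambda>t. indicator ({0..<fst t} \<times> {0..<snd t}) z :: real)
        = (\<lambda>t. if 0 \<le> fst z \<and> fst z < fst t \<and> 0 \<le> snd z \<and> snd z < snd t then 1 else 0)"
      by (auto simp: fun_eq_iff indicator_def mem_Times_iff)
    moreover have "\<dots> \<in> borel_measurable borel" by measurable
    ultimately have "(\<lambda>t. indicator ({0..<fst t} \<times> {0..<snd t}) z :: real) \<in> borel_measurable borel"
      by (simp only:)
    from borel_measurable_add[OF this add] show ?case by simp
  qed simp
  then show ?thesis unfolding local_discrepancy_def[abs_def] by measurable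
qed

lemma local_discrepancy_bound:
  assumes "t \<in> unit_square"
  shows "\<bar>local_discrepancy P t\<bar> \<le> 1"
proof -
  define S where "S = (\<Sum>z\<in>#P. indicator ({0..<fst t} \<times> {0..<snd t}) z :: real)"
  have "0 \<le> S \<and> S \<le> real (size P)" unfolding S_def
    by (induction P) (auto simp: indicator_def)
  then have "0 \<le> 1 / real (size P) * S" "1 / real (size P) * S \<le> 1" by (auto simp: divide_le_eq_1 nonempty_has_size)
  moreover have "0 \<le> fst t * snd t" "fst t * snd t \<le> 1"
    using assms by (auto simp: unit_square_def mem_Times_iff intro: mult_le_one)
  ultimately show ?thesis unfolding local_discrepancy_def S_def[symmetric] by linarith
qed

lemma L1_sum_le:
  assumes "\<And>i. i \<in> I \<Longrightarrow> f i \<in> borel_measurable borel"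
  shows "L1 (\<lambda>x. \<Sum>i\<in>I. f i x) \<le> (\<Sum>i\<in>I. L1 (f i))"
proof -
  have "L1 (\<lambda>x. \<Sum>i\<in>I. f i x) \<le> (\<integral>\<^sup>+x. (\<Sum>i\<in>I. ennreal (norm (f i x))) \<partial>lborel)"
    unfolding L1_def by (intro nn_integral_mono) (simp add: sum_ennreal ennreal_leI norm_sum)
  also have "\<dots> = (\<Sum>i\<in>I. L1 (f i))"
    unfolding L1_def using assms by (intro nn_integral_sum) simp
  finally show ?thesis .
qed

lemma L1_add_le:
  assumes [measurable]: "f \<in> borel_measurable borel" "g \<in> borel_measurable borel"
  shows "L1 (\<lambda>x. f x + g x) \<le> L1 f + L1 g"
proof -
  have "L1 (\<lambda>x. f x + g x) \<le> (\<integral>\<^sup>+x. ennreal (norm (f x)) + ennreal (norm (g x)) \<partial>lborel)"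
    unfolding L1_def by (intro nn_integral_mono) (simp add: norm_triangle_ineq ennreal_plus[symmetric] del: ennreal_plus)
  also have "\<dots> = L1 f + L1 g" unfolding L1_def by (rule nn_integral_add) measurable
  finally show ?thesis .
qed

text \<open>The square is half open on the right and the Haar functions are supported in \<open>(0, 1]\<close>; the two conventions differ
on lines only.\<close>
lemma AE_lborel_plane:
  fixes c :: real
  shows "AE t in (lborel :: (real \<times> real) measure). fst t \<noteq> c" "AE t in (lborel :: (real \<times> real) measure). snd t \<noteq> c"
proof -
  have "emeasure (lborel \<Otimes>\<^sub>M lborel) ({c} \<times> (UNIV :: real set)) = 0"
    by (subst lborel.emeasure_pair_measure_Times) auto
  then have "{c} \<times> (UNIV :: real set) \<in> null_sets lborel"
    by (intro null_setsI) (auto simp: lborel_prod intro: borel_Times)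
  then show "AE t in (lborel :: (real \<times> real) measure). fst t \<noteq> c"
    by (rule AE_I') auto
  have "emeasure (lborel \<Otimes>\<^sub>M lborel) ((UNIV :: real set) \<times> {c}) = 0"
    by (subst lborel.emeasure_pair_measure_Times) auto
  then have "(UNIV :: real set) \<times> {c} \<in> null_sets lborel"
    by (intro null_setsI) (auto simp: lborel_prod intro: borel_Times)
  then show "AE t in (lborel :: (real \<times> real) measure). snd t \<noteq> c"
    by (rule AE_I') auto
qed

lemma integrable_conv_bounded_kernel:
  fixes \<kappa> f :: "'a::euclidean_space \<Rightarrow> complex"
  assumes [measurable]: "\<kappa> \<in> borel_measurable borel" and f: "integrable lborel f" and B: "\<And>z. norm (\<kappa> z) \<le> B"
  shows "integrable lborel (\<lambda>y. \<kappa> (x - y) * f y)"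
proof (rule Bochner_Integration.integrable_bound[OF integrable_mult_right[OF f, of "of_real B"]])
  show "(\<lambda>y. \<kappa> (x - y) * f y) \<in> borel_measurable lborel"
    using borel_measurable_integrable[OF f] by simp
  show "AE y in lborel. norm (\<kappa> (x - y) * f y) \<le> norm (of_real B * f y)"
    unfolding norm_mult norm_of_real by (intro AE_I2 mult_right_mono order_trans[OF B abs_ge_self]) simp
qed

lemma integrable_indicator_Ioc:
  fixes a b :: real
  shows "integrable lborel (indicat_real {a<..b})"
proof (cases "a \<le> b")
  case True
  then show ?thesis by (intro integrable_real_indicator) auto
next
  case False
  then have "{a<..b} = {}" by simp
  then show ?thesis by simp
qed

lemma chaar_bounds: "norm (chaar i m y) \<le> 1" "integrable lborel (chaar i m)" "chaar i m y \<noteq> 0 \<Longrightarrow> m < 2 ^ (i - 1) \<Longrightarrow> 0 < y \<and> y \<le> 1"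
proof -
  show "norm (chaar i m y) \<le> 1" by (cases i) (auto simp: chaar_def indicator_def)
  show "integrable lborel (chaar i m)"
    unfolding chaar_def[abs_def] by (intro integrable_of_real, cases i) (auto intro!: Bochner_Integration.integrable_diff integrable_indicator_Ioc)
  assume nz: "chaar i m y \<noteq> 0" and m: "m < 2 ^ (i - 1)"
  show "0 < y \<and> y \<le> 1"
  proof (cases i)
    case 0
    then show ?thesis using nz by (auto simp: chaar_def indicator_def split: if_splits)
  next
    case (Suc j)
    have "real m + 1 \<le> 2 ^ j"
    proof -
      have "Suc m \<le> 2 ^ j" using m Suc by simp
      then have "real (Suc m) \<le> real (2 ^ j)" by (simp only: of_nat_le_iff)
      then show ?thesis by simp
    qed
    then have "(real m + 1) / 2 ^ j \<le> 1" by simp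
    moreover have "(real m + 1 / 2) / 2 ^ j \<le> (real m + 1) / 2 ^ j" "real m / 2 ^ j \<le> (real m + 1 / 2) / 2 ^ j" "0 \<le> real m / 2 ^ j"
      by (auto intro!: divide_right_mono)
    moreover have "real m / 2 ^ j < y \<and> y \<le> (real m + 1 / 2) / 2 ^ j \<or> (real m + 1 / 2) / 2 ^ j < y \<and> y \<le> (real m + 1) / 2 ^ j"
      using nz unfolding Suc chaar_def haar.simps by (auto simp: indicator_def split: if_splits)
    ultimately show ?thesis by linarith
  qed
qed

lemma conv_kern2_tensor:
  assumes "kern \<eta> \<in> borel_measurable borel" "kern \<eta>' \<in> borel_measurable borel"
    and "\<And>z. norm (kern \<eta> z) \<le> B" "\<And>z. norm (kern \<eta>' z) \<le> B'"
    and "integrable lborel f" "integrable lborel g"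
  shows "conv (kern2 \<eta> \<eta>') (\<lambda>y. f (fst y) * g (snd y)) x = conv (kern \<eta>) f (fst x) * conv (kern \<eta>') g (snd x)"
proof -
  have "conv (kern2 \<eta> \<eta>') (\<lambda>y. f (fst y) * g (snd y)) x
      = (LINT y|lborel. (kern \<eta> (fst x - fst y) * f (fst y)) * (kern \<eta>' (snd x - snd y) * g (snd y)))"
    unfolding conv_def kern2_def by (simp add: mult_ac)
  also have "\<dots> = conv (kern \<eta>) f (fst x) * conv (kern \<eta>') g (snd x)"
    unfolding conv_def by (intro integral_lborel_tensor integrable_conv_bounded_kernel assms(1,2,5,6)) (rule assms(3,4))+
  finally show ?thesis .
qed

text \<open>The bound holds almost everywhere on the square, and outside of it both functions vanish almost everywhere.\<close>
lemma (in hammersley_digits) discrepancy_haar_error: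
  assumes "n \<le> L"
  defines "D \<equiv> local_discrepancy (symmetrized_hammersley n \<sigma>)"
  shows "L1 (\<lambda>t. zero_extend D t - of_real (haar_sum L t)) \<le> ennreal (2 / 2 ^ L)"
proof -
  have "AE t in lborel. norm (zero_extend D t - of_real (haar_sum L t)) \<le> 2 / 2 ^ L * indicator unit_square t"
    using AE_lborel_plane(1)[of 0] AE_lborel_plane(1)[of 1] AE_lborel_plane(2)[of 0] AE_lborel_plane(2)[of 1]
  proof eventually_elim
    case (elim t)
    show ?case
    proof (cases "t \<in> unit_square")
      case True
      then have t: "0 < fst t" "fst t \<le> 1" "0 < snd t" "snd t \<le> 1" using elim by (auto simp: unit_square_def mem_Times_iff)
      have "\<bar>D (fst t, snd t) - haar_sum L (fst t, snd t)\<bar> \<le> 2 / 2 ^ L"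
        unfolding D_def by (rule discrepancy_haar_sum[OF assms(1) t])
      moreover have "zero_extend D t - of_real (haar_sum L t) = of_real (D t - haar_sum L t)"
        using True by (simp add: zero_extend_def)
      ultimately show ?thesis using True by (simp only: norm_of_real prod.collapse indicator_simps mult_1_right)
    next
      case False
      have "haar i m (fst t) * haar j l (snd t) = 0" if "m < 2 ^ (i - 1)" "l < 2 ^ (j - 1)" for i m j l
      proof (rule ccontr)
        assume "haar i m (fst t) * haar j l (snd t) \<noteq> 0"
        then have "chaar i m (fst t) \<noteq> 0" "chaar j l (snd t) \<noteq> 0" by (auto simp: chaar_def)
        from chaar_bounds(3)[OF this(1) that(1)] chaar_bounds(3)[OF this(2) that(2)]
        have "t \<in> unit_square" using elim by (auto simp: unit_square_def mem_Times_iff)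
        with False show False ..
      qed
      then have "haar_sum L t = 0" unfolding haar_sum_def by (intro sum.neutral ballI) auto
      then show ?thesis using False by (simp add: zero_extend_def)
    qed
  qed
  then have "L1 (\<lambda>t. zero_extend D t - of_real (haar_sum L t)) \<le> (\<integral>\<^sup>+t. ennreal (2 / 2 ^ L) * indicator unit_square t \<partial>lborel)"
    unfolding L1_def
    by (intro nn_integral_mono_AE, eventually_elim) (auto simp: indicator_def ennreal_leI)
  also have "\<dots> = ennreal (2 / 2 ^ L)"
    by (subst nn_integral_cmult) (auto simp: emeasure_unit_square)
  finally show ?thesis .
qed

text \<open>This removes the truncation level \<open>L\<close> from the estimates, whatever constant stands in front of the
truncation error.\<close>
lemma le_of_le_add_geometric:
  fixes X Y c :: real
  assumes "\<And>L. n \<le> L \<Longrightarrow> X \<le> Y + c / 2 ^ L"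
  shows "X \<le> Y"
proof (rule LIMSEQ_le_const)
  have "(\<lambda>L. Y + c * (1 / 2) ^ L) \<longlonglongrightarrow> Y + c * 0"
    by (intro tendsto_intros LIMSEQ_power_zero) simp
  then show "(\<lambda>L. Y + c / 2 ^ L) \<longlonglongrightarrow> Y" by (simp add: power_one_over)
  show "\<exists>N. \<forall>L\<ge>N. X \<le> Y + c / 2 ^ L" using assms by blast
qed

definition discrepancy_block ::
  "(real \<Rightarrow> complex) \<Rightarrow> nat \<Rightarrow> nat \<Rightarrow> nat \<Rightarrow> (nat \<Rightarrow> bool) \<Rightarrow> real \<times> real \<Rightarrow> complex" where
  "discrepancy_block \<phi>\<^sub>0 k l n \<sigma> = conv (kern2 (dyadic_part \<phi>\<^sub>0 k) (dyadic_part \<phi>\<^sub>0 l))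
     (zero_extend (local_discrepancy (symmetrized_hammersley n \<sigma>)))"

text \<open>On the truncated Haar sum, the coefficient bounds and the kernel bounds multiply to products of three factors
\<open>gain\<close>, in the supremum norm as well as in \<open>L\<^sub>1\<close>, and \<open>sum_gain_bound\<close> adds them up. The constant in the truncation error may
depend on \<open>k\<close> and \<open>l\<close>, as \<open>L\<close> tends to infinity first.\<close>
lemma block_bounds:
  assumes phi: "\<phi>\<^sub>0 \<in> schwartz" "\<And>t. \<bar>t\<bar> \<le> 1 \<Longrightarrow> \<phi>\<^sub>0 t = 1" "\<And>t. \<bar>t\<bar> > 3 / 2 \<Longrightarrow> \<phi>\<^sub>0 t = 0"
    and eps: "0 < \<epsilon>" "\<epsilon> \<le> \<gamma>" "\<epsilon> \<le> 1 - \<gamma>"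
  obtains C where "C > 0"
    "\<And>k. continuous_on UNIV (dyadic_part \<phi>\<^sub>0 k)" "\<And>k. bounded_support (dyadic_part \<phi>\<^sub>0 k)"
    "\<And>n \<sigma> k l x. norm (discrepancy_block \<phi>\<^sub>0 k l n \<sigma> x) \<le> C * ridge \<gamma> \<epsilon> n (k + l) / 2 ^ n"
    "\<And>n \<sigma> k l. L1 (discrepancy_block \<phi>\<^sub>0 k l n \<sigma>) \<le> ennreal (C * ridge \<gamma> \<epsilon> n (k + l) / 2 ^ (k + l))"
proof (rule haar_conv_bounds[OF phi])
  fix C :: real
  assume C: "C \<ge> 0"
    and cont: "\<And>k. continuous_on UNIV (dyadic_part \<phi>\<^sub>0 k)" and supp: "\<And>k. bounded_support (dyadic_part \<phi>\<^sub>0 k)"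
    and L1\<kappa>: "\<And>k. L1 (kern (dyadic_part \<phi>\<^sub>0 k)) \<le> ennreal C"
    and S: "\<And>k i x. (\<Sum>m<2 ^ (i - 1). norm (conv (kern (dyadic_part \<phi>\<^sub>0 k)) (chaar i m) x)) \<le> C * gain (real k - real i)"
    and I: "\<And>k i m. L1 (conv (kern (dyadic_part \<phi>\<^sub>0 k)) (chaar i m)) \<le> ennreal (C * gain (real k - real i) / 2 ^ k)"
  define A where "A = (2 / (1 - 2 powr (- (\<epsilon> / 2))))\<^sup>2"
  have "2 powr (- (\<epsilon> / 2)) < 1" using powr_less_mono[of "- (\<epsilon> / 2)" 0 2] eps by simp
  then have A: "0 < A" unfolding A_def by (intro zero_less_power divide_pos_pos) auto
  define G where "G n k l = ridge \<gamma> \<epsilon> n (k + l)" for n k l :: nat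
  have G0: "0 < G n k l" for n k l by (simp add: G_def ridge_def)
  define \<kappa> where "\<kappa> k = kern (dyadic_part \<phi>\<^sub>0 k)" for k
  have \<kappa>m [measurable]: "\<kappa> k \<in> borel_measurable borel" for k
    unfolding \<kappa>_def by (rule measurable_kern[OF continuous_measurable[OF cont]])
  define \<kappa>2 where "\<kappa>2 k l = kern2 (dyadic_part \<phi>\<^sub>0 k) (dyadic_part \<phi>\<^sub>0 l)" for k l
  have \<kappa>2m [measurable]: "\<kappa>2 k l \<in> borel_measurable borel" for k l
    unfolding \<kappa>2_def by (rule measurable_kern2[OF continuous_measurable[OF cont] continuous_measurable[OF cont]])
  define R where "R k = (\<integral>\<xi>. norm (dyadic_part \<phi>\<^sub>0 k \<xi>) \<partial>lborel)" for k
  have R: "norm (\<kappa> k z) \<le> R k" for k z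
    unfolding \<kappa>_def R_def by (rule norm_kern_le[OF integrable_bump[OF cont supp]])
  have R0: "0 \<le> R k" for k using R[of k 0] norm_ge_zero order_trans by blast
  have R2: "norm (\<kappa>2 k l z) \<le> R k * R l" for k l z
    unfolding \<kappa>2_def kern2_def norm_mult \<kappa>_def[symmetric] by (intro mult_mono R R0) simp
  have L1\<kappa>2: "L1 (\<kappa>2 k l) \<le> ennreal (C * C)" for k l
  proof -
    have "L1 (\<kappa>2 k l) = L1 (\<kappa> k) * L1 (\<kappa> l)"
      unfolding \<kappa>2_def kern2_def[abs_def] \<kappa>_def[symmetric] by (rule L1_tensor) measurable
    also have "\<dots> \<le> ennreal C * ennreal C" unfolding \<kappa>_def by (intro mult_mono L1\<kappa>) auto
    finally show ?thesis using C by (simp add: ennreal_mult)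
  qed

  let ?u = "\<lambda>k l n \<sigma>. conv (\<kappa>2 k l) (zero_extend (local_discrepancy (symmetrized_hammersley n \<sigma>)))"
  have main: "norm (?u k l n \<sigma> x) \<le> C * C * A * G n k l / 2 ^ n + R k * R l * 2 / 2 ^ L"
    "L1 (?u k l n \<sigma>) \<le> ennreal (C * C * A * G n k l / 2 ^ (k + l) + C * C * 2 / 2 ^ L)"
    if L: "n \<le> L" for n \<sigma> k l x L
  proof -
    interpret hammersley_digits n \<sigma> .
    define D where "D = local_discrepancy (symmetrized_hammersley n \<sigma>)"
    interpret bounded_function D 1
      unfolding D_def by unfold_locales (auto intro: local_discrepancy_bound)
    define h where "h i m j r = (\<lambda>t. chaar i m (fst t) * chaar j r (snd t))" for i m j r
    have hi: "integrable lborel (h i m j r)" for i m j r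
      unfolding h_def by (intro integrable_lborel_tensor chaar_bounds)
    define H where "H = (\<lambda>t. \<Sum>i\<le>L. \<Sum>j\<le>L. \<Sum>m<2 ^ (i - 1). \<Sum>r<2 ^ (j - 1). of_real (coeff i m j r) * h i m j r t)"
    have H: "H t = of_real (haar_sum L t)" for t
      unfolding H_def h_def haar_sum_def chaar_def by simp
    define E where "E = (\<lambda>t. zero_extend D t - H t)"
    have Hi: "integrable lborel H"
      unfolding H_def by (intro Bochner_Integration.integrable_sum integrable_mult_right hi)
    have Ei: "integrable lborel E" unfolding E_def by (intro Bochner_Integration.integrable_diff zero_extend_integrable Hi)
    have [measurable]: "E \<in> borel_measurable borel" "H \<in> borel_measurable borel"
      using borel_measurable_integrable[OF Ei] borel_measurable_integrable[OF Hi] by simp_all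
    have E: "L1 E \<le> ennreal (2 / 2 ^ L)"
      unfolding E_def H D_def by (rule discrepancy_haar_error[OF L])
    define a where "a = (\<lambda>i m j r x. of_real (coeff i m j r) * (conv (\<kappa> k) (chaar i m) (fst x) * conv (\<kappa> l) (chaar j r) (snd x)))"
    have am [measurable]: "(\<lambda>x. a i m j r x) \<in> borel_measurable borel" for i m j r
      unfolding a_def by measurable
    define V where "V = (\<lambda>x. \<Sum>i\<le>L. \<Sum>j\<le>L. \<Sum>m<2 ^ (i - 1). \<Sum>r<2 ^ (j - 1). a i m j r x)"
    have ci: "integrable lborel (\<lambda>y. \<kappa>2 k l (x - y) * f y)" if "integrable lborel f" for f x
      by (rule integrable_conv_bounded_kernel[OF \<kappa>2m that R2])
    have HV: "conv (\<kappa>2 k l) H x = V x" for x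
    proof -
      have "conv (\<kappa>2 k l) (\<lambda>t. \<Sum>i\<in>J. f i t) x = (\<Sum>i\<in>J. conv (\<kappa>2 k l) (f i) x)"
        if "\<And>i. i \<in> J \<Longrightarrow> integrable lborel (f i)" for f and J :: "nat set"
        unfolding conv_def sum_distrib_left
        by (rule Bochner_Integration.integral_sum) (rule ci[OF that])
      note cs = this
      have cm: "conv (\<kappa>2 k l) (\<lambda>t. c * f t) x = c * conv (\<kappa>2 k l) f x" for c f
        unfolding conv_def by (simp add: mult.left_commute)
      have ct: "conv (\<kappa>2 k l) (h i m j r) x = conv (\<kappa> k) (chaar i m) (fst x) * conv (\<kappa> l) (chaar j r) (snd x)" for i m j r
        unfolding h_def \<kappa>2_def \<kappa>_def
        by (rule conv_kern2_tensor[of _ _ "R k" "R l"]) (use \<kappa>m R chaar_bounds(2) in \<open>auto simp: \<kappa>_def\<close>)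
      show ?thesis
        unfolding H_def V_def a_def
        by (subst cs, intro Bochner_Integration.integrable_sum integrable_mult_right hi, intro sum.cong refl)+
          (simp only: cm ct)
    qed
    have u: "conv (\<kappa>2 k l) (zero_extend D) x = V x + conv (\<kappa>2 k l) E x" for x
    proof -
      have "conv (\<kappa>2 k l) E x = conv (\<kappa>2 k l) (zero_extend D) x - conv (\<kappa>2 k l) H x"
        unfolding conv_def E_def right_diff_distrib
        by (rule Bochner_Integration.integral_diff[OF ci[OF zero_extend_integrable] ci[OF Hi]])
      then show ?thesis by (simp add: HV)
    qed
    define gg where "gg i j = gain (real k - real i) * gain (real l - real j) * gain (real i + real j - real n)" for i j
    have gg0: "0 \<le> gg i j" for i j unfolding gg_def by (intro mult_nonneg_nonneg gain_nonneg)
    have gg: "(\<Sum>i\<le>L. \<Sum>j\<le>L. gg i j) \<le> A * G n k l"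
      unfolding gg_def A_def G_def by (rule sum_gain_bound[OF eps])
    have "norm (V x) \<le> (\<Sum>i\<le>L. \<Sum>j\<le>L. C * C / 2 ^ n * gg i j)"
    proof -
      have "norm (V x) \<le> (\<Sum>i\<le>L. \<Sum>j\<le>L. \<Sum>m<2 ^ (i - 1). \<Sum>r<2 ^ (j - 1). norm (a i m j r x))"
        unfolding V_def by (intro order_trans[OF norm_sum] sum_mono order_refl)
      also have "\<dots> \<le> (\<Sum>i\<le>L. \<Sum>j\<le>L. C * C / 2 ^ n * gg i j)"
      proof (intro sum_mono)
        fix i j
        let ?g = "gain (real i + real j - real n) / 2 ^ n"
        have "(\<Sum>m<2 ^ (i - 1). \<Sum>r<2 ^ (j - 1). norm (a i m j r x))
            \<le> (\<Sum>m<2 ^ (i - 1). \<Sum>r<2 ^ (j - 1). ?g * (norm (conv (\<kappa> k) (chaar i m) (fst x)) * norm (conv (\<kappa> l) (chaar j r) (snd x))))"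
          unfolding a_def norm_mult norm_of_real
          by (intro sum_mono mult_right_mono abs_coeff_le) auto
        also have "\<dots> = ?g * ((\<Sum>m<2 ^ (i - 1). norm (conv (\<kappa> k) (chaar i m) (fst x))) * (\<Sum>r<2 ^ (j - 1). norm (conv (\<kappa> l) (chaar j r) (snd x))))"
          unfolding sum_product by (simp only: sum_distrib_left)
        also have "\<dots> \<le> ?g * ((C * gain (real k - real i)) * (C * gain (real l - real j)))"
          unfolding \<kappa>_def using C by (intro mult_left_mono mult_mono S sum_nonneg) (auto simp: gain_nonneg)
        also have "\<dots> = C * C / 2 ^ n * gg i j" by (simp add: gg_def)
        finally show "(\<Sum>m<2 ^ (i - 1). \<Sum>r<2 ^ (j - 1). norm (a i m j r x)) \<le> C * C / 2 ^ n * gg i j" .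
      qed
      finally show ?thesis .
    qed
    also have "\<dots> = C * C / 2 ^ n * (\<Sum>i\<le>L. \<Sum>j\<le>L. gg i j)" by (simp only: sum_distrib_left)
    also have "\<dots> \<le> C * C / 2 ^ n * (A * G n k l)" by (intro mult_left_mono gg) (simp add: C)
    finally have V1: "norm (V x) \<le> C * C * A * G n k l / 2 ^ n" by simp
    have "ennreal (norm (conv (\<kappa>2 k l) E x)) \<le> (\<integral>\<^sup>+y. ennreal (norm (\<kappa>2 k l (x - y))) * ennreal (norm (E y)) \<partial>lborel)"
      by (rule norm_conv_le)
    also have "\<dots> \<le> (\<integral>\<^sup>+y. ennreal (R k * R l) * ennreal (norm (E y)) \<partial>lborel)"
      by (intro nn_integral_mono mult_right_mono ennreal_leI R2) simp
    also have "\<dots> = ennreal (R k * R l) * L1 E" unfolding L1_def by (rule nn_integral_cmult) measurable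
    also have "\<dots> \<le> ennreal (R k * R l) * ennreal (2 / 2 ^ L)" by (intro mult_left_mono E) simp
    also have "\<dots> = ennreal (R k * R l * 2 / 2 ^ L)" using R0 by (simp add: ennreal_mult[symmetric])
    finally have "norm (conv (\<kappa>2 k l) E x) \<le> R k * R l * 2 / 2 ^ L"
      using R0 by (subst (asm) ennreal_le_iff) auto
    with V1 norm_triangle_ineq[of "V x" "conv (\<kappa>2 k l) E x"]
    show "norm (?u k l n \<sigma> x) \<le> C * C * A * G n k l / 2 ^ n + R k * R l * 2 / 2 ^ L"
      unfolding D_def[symmetric] u by linarith
    have La: "L1 (a i m j r) \<le> ennreal (\<bar>coeff i m j r\<bar> * (C * gain (real k - real i) / 2 ^ k * (C * gain (real l - real j) / 2 ^ l)))" for i m j r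
    proof -
      have "L1 (a i m j r) = ennreal \<bar>coeff i m j r\<bar> * (L1 (conv (\<kappa> k) (chaar i m)) * L1 (conv (\<kappa> l) (chaar j r)))"
      proof -
        have "L1 (a i m j r) = ennreal (norm (complex_of_real (coeff i m j r))) * L1 (\<lambda>x. conv (\<kappa> k) (chaar i m) (fst x) * conv (\<kappa> l) (chaar j r) (snd x))"
          unfolding a_def by (rule L1_scale) measurable
        then show ?thesis by (simp add: L1_tensor)
      qed
      also have "\<dots> \<le> ennreal \<bar>coeff i m j r\<bar> * (ennreal (C * gain (real k - real i) / 2 ^ k) * ennreal (C * gain (real l - real j) / 2 ^ l))"
        unfolding \<kappa>_def by (intro mult_left_mono mult_mono I) auto
      finally show ?thesis using C by (simp add: ennreal_mult[symmetric] gain_nonneg)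
    qed
    have "L1 V \<le> (\<Sum>i\<le>L. \<Sum>j\<le>L. \<Sum>m<2 ^ (i - 1). \<Sum>r<2 ^ (j - 1). L1 (a i m j r))"
      unfolding V_def
      by (intro order_trans[OF L1_sum_le] sum_mono order_refl) measurable
    also have "\<dots> \<le> (\<Sum>i\<le>L. \<Sum>j\<le>L. ennreal (C * C / 2 ^ (k + l) * gg i j))"
    proof (intro sum_mono)
      fix i j
      let ?w = "C * gain (real k - real i) / 2 ^ k * (C * gain (real l - real j) / 2 ^ l)"
      have w: "0 \<le> ?w" using C by (simp add: gain_nonneg)
      have "(\<Sum>m<2 ^ (i - 1). \<Sum>r<2 ^ (j - 1). L1 (a i m j r)) \<le> (\<Sum>m<2 ^ (i - 1). \<Sum>r<2 ^ (j - 1). ennreal (\<bar>coeff i m j r\<bar> * ?w))"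
        by (intro sum_mono La)
      also have "\<dots> = ennreal ((\<Sum>m<2 ^ (i - 1). \<Sum>r<2 ^ (j - 1). \<bar>coeff i m j r\<bar>) * ?w)"
        using w by (simp only: sum_distrib_right sum_ennreal sum_nonneg mult_nonneg_nonneg abs_ge_zero)
      also have "\<dots> \<le> ennreal (gain (real i + real j - real n) * ?w)"
        using w by (intro ennreal_leI mult_right_mono sum_abs_coeff_le)
      also have "gain (real i + real j - real n) * ?w = C * C / 2 ^ (k + l) * gg i j"
        by (simp add: gg_def power_add)
      finally show "(\<Sum>m<2 ^ (i - 1). \<Sum>r<2 ^ (j - 1). L1 (a i m j r)) \<le> ennreal (C * C / 2 ^ (k + l) * gg i j)" .
    qed
    also have "\<dots> = ennreal (C * C / 2 ^ (k + l) * (\<Sum>i\<le>L. \<Sum>j\<le>L. gg i j))"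
    proof -
      have nn: "0 \<le> C * C / 2 ^ (k + l) * gg i j" for i j using gg0 C by simp
      show ?thesis unfolding sum_distrib_left by (simp only: sum_ennreal nn sum_nonneg)
    qed
    also have "\<dots> \<le> ennreal (C * C / 2 ^ (k + l) * (A * G n k l))"
      by (intro ennreal_leI mult_left_mono gg) (simp add: C)
    finally have V2: "L1 V \<le> ennreal (C * C * A * G n k l / 2 ^ (k + l))" by (simp add: mult_ac)
    have Vm [measurable]: "V \<in> borel_measurable borel" unfolding V_def by measurable
    have "L1 (conv (\<kappa>2 k l) (zero_extend D)) \<le> L1 V + L1 (conv (\<kappa>2 k l) E)"
      unfolding u[abs_def] by (rule L1_add_le) measurable
    also have "L1 (conv (\<kappa>2 k l) E) \<le> L1 (\<kappa>2 k l) * L1 E" by (rule L1_conv_le) measurable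
    also have "\<dots> \<le> ennreal (C * C) * ennreal (2 / 2 ^ L)" by (intro mult_mono L1\<kappa>2 E) auto
    also have "\<dots> = ennreal (C * C * 2 / 2 ^ L)" by (simp add: ennreal_mult[symmetric] C)
    finally have "L1 (conv (\<kappa>2 k l) (zero_extend D)) \<le> L1 V + ennreal (C * C * 2 / 2 ^ L)" by (simp add: add_left_mono)
    also have "\<dots> \<le> ennreal (C * C * A * G n k l / 2 ^ (k + l)) + ennreal (C * C * 2 / 2 ^ L)"
      by (intro add_right_mono V2)
    also have "\<dots> = ennreal (C * C * A * G n k l / 2 ^ (k + l) + C * C * 2 / 2 ^ L)"
      using A G0[of n k l] by (subst ennreal_plus) (auto simp: C)
    finally show "L1 (?u k l n \<sigma>) \<le> ennreal (C * C * A * G n k l / 2 ^ (k + l) + C * C * 2 / 2 ^ L)"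
      unfolding D_def .
  qed
  \<comment> \<open>The summand \<open>1\<close> makes the constant positive even if \<open>C = 0\<close>.\<close>
  define K where "K = C * C * A + 1"
  have KC: "C * C * A \<le> K" by (simp add: K_def)
  show thesis
  proof (rule that[of K])
    show "K > 0" unfolding K_def using A C by (intro add_nonneg_pos mult_nonneg_nonneg) auto
    show "continuous_on UNIV (dyadic_part \<phi>\<^sub>0 k)" "bounded_support (dyadic_part \<phi>\<^sub>0 k)" for k by (rule cont supp)+
    fix n :: nat and \<sigma> k l
    show "norm (discrepancy_block \<phi>\<^sub>0 k l n \<sigma> x) \<le> K * ridge \<gamma> \<epsilon> n (k + l) / 2 ^ n" for x
    proof -
      have "norm (?u k l n \<sigma> x) \<le> C * C * A * G n k l / 2 ^ n"
        by (rule le_of_le_add_geometric[of n]) (rule main(1))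
      also have "\<dots> \<le> K * G n k l / 2 ^ n"
        using G0[of n k l] by (intro divide_right_mono mult_right_mono KC) auto
      finally show ?thesis unfolding G_def \<kappa>2_def discrepancy_block_def .
    qed
    have "L1 (?u k l n \<sigma>) \<le> ennreal (C * C * A * G n k l / 2 ^ (k + l))"
    proof -
      have fin: "L1 (?u k l n \<sigma>) < \<infinity>" using main(2)[OF order_refl, of k l n \<sigma>] by (auto intro: le_less_trans)
      then have *: "L1 (?u k l n \<sigma>) = ennreal (enn2real (L1 (?u k l n \<sigma>)))" by simp
      have "enn2real (L1 (?u k l n \<sigma>)) \<le> C * C * A * G n k l / 2 ^ (k + l)"
      proof (rule le_of_le_add_geometric[of n _ _ "C * C * 2"])
        fix L assume "n \<le> L"
        have "0 \<le> C * C * A * G n k l / 2 ^ (k + l) + C * C * 2 / 2 ^ L"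
          using A G0[of n k l] C by simp
        then show "enn2real (L1 (?u k l n \<sigma>)) \<le> C * C * A * G n k l / 2 ^ (k + l) + C * C * 2 / 2 ^ L"
          using main(2)[OF \<open>n \<le> L\<close>] by (intro enn2real_leI)
      qed
      then show ?thesis by (subst *) (rule ennreal_leI)
    qed
    also have "\<dots> \<le> ennreal (K * G n k l / 2 ^ (k + l))"
      using G0[of n k l] by (intro ennreal_leI divide_right_mono mult_right_mono KC) auto
    finally show "L1 (discrepancy_block \<phi>\<^sub>0 k l n \<sigma>) \<le> ennreal (K * ridge \<gamma> \<epsilon> n (k + l) / 2 ^ (k + l))"
      unfolding G_def \<kappa>2_def discrepancy_block_def .
  qed
qed

section \<open>The bound for the Besov norm\<close>

theorem theorem1:
  fixes \<phi>\<^sub>0 :: "real \<Rightarrow> complex" and p q :: ennreal and r :: real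
  assumes "\<phi>\<^sub>0 \<in> schwartz"
    and "\<And>t. \<bar>t\<bar> \<le> 1 \<Longrightarrow> \<phi>\<^sub>0 t = 1"
    and "\<And>t. \<bar>t\<bar> > 3 / 2 \<Longrightarrow> \<phi>\<^sub>0 t = 0"
    and "1 \<le> p" and "1 \<le> q"
    and "enn2real (1 / p) - 1 < r" and "r < enn2real (1 / p)"
  shows "\<exists>C::real. C > 0 \<and> (\<forall>n\<ge>1. \<forall>\<sigma>.
    besov_norm_square \<phi>\<^sub>0 p q r
        (regular_distribution (local_discrepancy (symmetrized_hammersley n \<sigma>)))
      \<le> ennreal (C * real (2 ^ (n + 2)) powr (r - 1) * ln (real (2 ^ (n + 2))) powr enn2real (1 / q)))"
proof -
  define \<theta> where "\<theta> = enn2real (1 / p)"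
  \<comment> \<open>With this slope the interpolated bound of a block scales like the weight of the Besov norm.\<close>
  define \<gamma> where "\<gamma> = \<theta> - r"
  define \<epsilon> where "\<epsilon> = min \<gamma> (1 - \<gamma>)"
  have eps: "0 < \<epsilon>" "\<epsilon> \<le> \<gamma>" "\<epsilon> \<le> 1 - \<gamma>"
    using assms(6,7) by (auto simp: \<epsilon>_def \<gamma>_def \<theta>_def)
  show ?thesis
  proof (rule block_bounds[OF assms(1-3) eps])
    fix C :: real
    let ?D = "\<lambda>n \<sigma>. local_discrepancy (symmetrized_hammersley n \<sigma>)"
    let ?u = "\<lambda>n \<sigma> k l. discrepancy_block \<phi>\<^sub>0 k l n \<sigma>"
    assume C: "C > 0"
      and cont: "\<And>k. continuous_on UNIV (dyadic_part \<phi>\<^sub>0 k)" and supp: "\<And>k. bounded_support (dyadic_part \<phi>\<^sub>0 k)"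
      and sup: "\<And>n \<sigma> k l x. norm (?u n \<sigma> k l x)
          \<le> C * ridge \<gamma> \<epsilon> n (k + l) / 2 ^ n"
      and L1: "\<And>n \<sigma> k l. L1 (?u n \<sigma> k l)
          \<le> ennreal (C * ridge \<gamma> \<epsilon> n (k + l) / 2 ^ (k + l))"
    have block: "besov_block \<phi>\<^sub>0 p r (regular_distribution (?D n \<sigma>)) (k, l)
        \<le> ennreal (C * 2 powr ((r - 1) * real n) * 2 powr (- (\<epsilon> / 2) * \<bar>real (k + l) - real n\<bar>))" for n \<sigma> k l
    proof -
      interpret bounded_function "?D n \<sigma>" 1
        by unfold_locales (auto intro: local_discrepancy_bound)
      define s where "s = real (k + l)"
      define E where "E = \<gamma> * (s - real n) - \<epsilon> / 2 * \<bar>s - real n\<bar>"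
      have sup': "norm (?u n \<sigma> k l x) \<le> C * 2 powr E / 2 ^ n" for x
        using sup[of k l n \<sigma> x] by (simp only: ridge_def E_def s_def)
      have L1': "L1 (?u n \<sigma> k l) \<le> ennreal (C * 2 powr E / 2 ^ (k + l))"
        using L1[of k l n \<sigma>] by (simp only: ridge_def E_def s_def)
      have um: "?u n \<sigma> k l \<in> borel_measurable borel"
        unfolding discrepancy_block_def by (intro measurable_conv measurable_kern2 continuous_measurable cont) measurable
      have "dyadic_part2 \<phi>\<^sub>0 (k, l) = (\<lambda>\<xi>. dyadic_part \<phi>\<^sub>0 k (fst \<xi>) * dyadic_part \<phi>\<^sub>0 l (snd \<xi>))"
        by (simp add: dyadic_part2_def fun_eq_iff)
      then have "dist_Lp_norm p (dist_inv_fourier (dist_mult (dyadic_part2 \<phi>\<^sub>0 (k, l)) (dist_fourier (regular_distribution (?D n \<sigma>)))))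
          \<le> Lp_norm p (?u n \<sigma> k l)"
        unfolding dist_Lp_norm_def discrepancy_block_def using block_represented[OF cont supp cont supp, of k l]
        by (intro Inf_lower) auto
      also have "\<dots> \<le> ennreal ((C * 2 powr E / 2 ^ n) powr (1 - \<theta>) * (C * 2 powr E / 2 ^ (k + l)) powr \<theta>)"
        unfolding \<theta>_def
        by (rule Lp_norm_interpolation[OF assms(4) um sup' L1']) (use C in auto)
      also have "(C * 2 powr E / 2 ^ n) powr (1 - \<theta>) * (C * 2 powr E / 2 ^ (k + l)) powr \<theta>
          = C * 2 powr (E - real n * (1 - \<theta>) - s * \<theta>)"
      proof -
        have "C * 2 powr E / 2 ^ n = C * 2 powr (E - real n)" "C * 2 powr E / 2 ^ (k + l) = C * 2 powr (E - s)"
          by (simp_all add: powr_diff powr_realpow s_def flip: of_nat_add)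
        then have "(C * 2 powr E / 2 ^ n) powr (1 - \<theta>) * (C * 2 powr E / 2 ^ (k + l)) powr \<theta>
            = C powr (1 - \<theta>) * C powr \<theta> * (2 powr ((E - real n) * (1 - \<theta>)) * 2 powr ((E - s) * \<theta>))"
          using C by (simp add: powr_mult powr_powr mult_ac)
        also have "C powr (1 - \<theta>) * C powr \<theta> = C" using C by (simp flip: powr_add)
        also have "2 powr ((E - real n) * (1 - \<theta>)) * 2 powr ((E - s) * \<theta>) = 2 powr (E - real n * (1 - \<theta>) - s * \<theta>)"
          by (simp add: powr_add[symmetric] algebra_simps)
        finally show ?thesis .
      qed
      finally have "besov_block \<phi>\<^sub>0 p r (regular_distribution (?D n \<sigma>)) (k, l)
          \<le> ennreal (2 powr (r * s)) * ennreal (C * 2 powr (E - real n * (1 - \<theta>) - s * \<theta>))"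
        unfolding besov_block_def fst_conv snd_conv s_def by (intro mult_left_mono) auto
      also have "\<dots> = ennreal (C * (2 powr (r * s) * 2 powr (E - real n * (1 - \<theta>) - s * \<theta>)))"
        using C by (simp add: ennreal_mult[symmetric] mult_ac)
      also have "2 powr (r * s) * 2 powr (E - real n * (1 - \<theta>) - s * \<theta>)
          = 2 powr ((r - 1) * real n) * 2 powr (- (\<epsilon> / 2) * \<bar>s - real n\<bar>)"
        by (simp add: powr_add[symmetric] E_def \<gamma>_def algebra_simps)
      finally show ?thesis by (simp add: s_def mult.assoc)
    qed
    show ?thesis
    proof (rule besov_norm_diagonal_decay[OF assms(5)])
      show "0 < \<epsilon> / 2" using eps by simp
      fix K :: real
      assume K: "K > 0"
        and decay: "\<And>\<phi>\<^sub>0 p r f B n. 0 \<le> B \<Longrightarrow>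
          (\<And>k l. besov_block \<phi>\<^sub>0 p r f (k, l) \<le> ennreal (B * 2 powr (- (\<epsilon> / 2) * \<bar>real (k + l) - real n\<bar>))) \<Longrightarrow>
          besov_norm \<phi>\<^sub>0 p q r f \<le> ennreal (B * (K * (real n + 1)) powr enn2real (1 / q))"
      define c where "c = C * 2 powr (2 * (1 - r)) * (K / ln 2) powr enn2real (1 / q)"
      have "c > 0" using C K by (simp add: c_def)
      moreover have "besov_norm_square \<phi>\<^sub>0 p q r (regular_distribution (?D n \<sigma>))
          \<le> ennreal (c * real (2 ^ (n + 2)) powr (r - 1) * ln (real (2 ^ (n + 2))) powr enn2real (1 / q))" for n \<sigma>
      proof -
        let ?f = "regular_distribution (?D n \<sigma>)"
        interpret bounded_function "?D n \<sigma>" 1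
          by unfold_locales (auto intro: local_discrepancy_bound)
        have norm: "besov_norm \<phi>\<^sub>0 p q r ?f \<le> ennreal (C * 2 powr ((r - 1) * real n) * (K * (real n + 1)) powr enn2real (1 / q))"
          by (rule decay[OF _ block]) (use C in simp)
        then have "?f \<in> besov_space \<phi>\<^sub>0 p q r"
          using regular_distribution_tempered by (auto simp: besov_space_def intro: le_less_trans)
        then have "besov_norm_square \<phi>\<^sub>0 p q r ?f \<le> besov_norm \<phi>\<^sub>0 p q r ?f"
          unfolding besov_norm_square_def by (intro Inf_lower) auto
        also note norm
        also have "C * 2 powr ((r - 1) * real n) * (K * (real n + 1)) powr enn2real (1 / q)
            \<le> c * real (2 ^ (n + 2)) powr (r - 1) * ln (real (2 ^ (n + 2))) powr enn2real (1 / q)"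
        proof -
          have ln2: "0 < ln (2 :: real)" by simp
          have lnN: "ln (real (2 ^ (n + 2))) = (real n + 2) * ln 2"
            using ln_realpow[of 2 "n + 2"] by (simp only: of_nat_power of_nat_numeral of_nat_add zero_less_numeral)
          have "real (2 ^ (n + 2)) = 2 powr (real n + 2)" by (simp add: powr_add powr_realpow)
          then have N: "real (2 ^ (n + 2)) powr (r - 1) = 2 powr ((real n + 2) * (r - 1))"
            by (simp only: powr_powr)
          \<comment> \<open>Here \<open>(n + 2) ln 2\<close> is the logarithm of the number of points.\<close>
          have "(K * (real n + 1)) powr enn2real (1 / q) \<le> (K / ln 2 * ((real n + 2) * ln 2)) powr enn2real (1 / q)"
            using K ln2 by (intro powr_mono2) auto
          also have "\<dots> = (K / ln 2) powr enn2real (1 / q) * ((real n + 2) * ln 2) powr enn2real (1 / q)"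
            using K ln2 by (intro powr_mult)
          finally have le: "C * 2 powr ((r - 1) * real n) * (K * (real n + 1)) powr enn2real (1 / q)
              \<le> C * 2 powr ((r - 1) * real n) * ((K / ln 2) powr enn2real (1 / q) * ((real n + 2) * ln 2) powr enn2real (1 / q))"
            using C by (intro mult_left_mono) auto
          have shift: "2 powr ((r - 1) * real n) = 2 powr (2 * (1 - r)) * 2 powr ((real n + 2) * (r - 1))"
            by (simp add: powr_add[symmetric] algebra_simps)
          show ?thesis using le unfolding N lnN c_def shift by (simp only: mult_ac)
        qed
        finally show ?thesis by (simp add: ennreal_leI)
      qed
      ultimately show ?thesis by blast
    qed
  qed
qed

end
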